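(* For all $\varepsilon>0$ and $R>0$ there exist $M=M(\varepsilon)>0$ and $\delta_0=\delta_0(\varepsilon,R)>0$ such that the following holds for all $\delta\in(0,\delta_0]$. Let $L\subset \mathcal{L}_{SL_2}\cap B(0,R)$ (a finite set) satisfy the two-dimensional ball condition $$\#(L\cap B)\le (r/\delta)^2\quad\text{for all } r\in[\delta,1] \text{ and all balls } B\subset\mathbb{R}^4 \text{ of radius } r.$$ Let $E\subset B(0,R)\subset\mathbb{R}^3$ be a union of $\delta$-cubes, and suppose $|\ell\cap E|\ge\lambda$ for each $\ell\in L$. Then $$|E|\ge \delta^{\varepsilon}\lambda^{M}\,(\delta^2\,\#L).$$
   Context: For $(a,b,c,d)\in\mathbb{R}^4$ with $ad-bc=1$, let $\ell_{(a,b,c,d)}=\{(a,b,0)+s(c,d,1): s\in\mathbb{R}\}\subset\mathbb{R}^3$, and let $\mathcal{L}_{SL_2}$ be the set of all such lines. Each line $\ell_{(a,b,c,d)}$ is identified with the point $(a,b,c,d)\in\mathbb{R}^4$; thus $\mathcal{L}_{SL_2}\cap B(0,R)$ means the lines whose parameter $(a,b,c,d)$ lies in the ball $B(0,R)\subset\mathbb{R}^4$, and $L\cap B$ for a ball $B\subset\mathbb{R}^4$ refers to parameters. $|\ell\cap E|$ denotes the one-dimensional Lebesgue measure of $\ell\cap E$, and $|E|$ the three-dimensional Lebesgue measure. *)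

theory Defs
  imports "HOL-Analysis.Analysis"
begin

definition SL2_param :: "real^4 \<Rightarrow> bool" where
  "SL2_param p \<longleftrightarrow> p$1 * p$4 - p$2 * p$3 = 1"

definition line_of :: "real^4 \<Rightarrow> real \<Rightarrow> real^3" where
  "line_of p s = vector [p$1 + s * p$3, p$2 + s * p$4, s]"

definition SL2_line :: "real^4 \<Rightarrow> (real^3) set" where
  "SL2_line p = range (line_of p)"

text \<open>One-dimensional Lebesgue (arc-length) measure of l_p \<inter> E, via the
  affine parametrisation s \<mapsto> (a,b,0)+s(c,d,1), whose speed is |(c,d,1)|.\<close>
definition line_meas :: "real^4 \<Rightarrow> (real^3) set \<Rightarrow> real" where
  "line_meas p E = sqrt ((p$3)\<^sup>2 + (p$4)\<^sup>2 + 1) * measure lebesgue {s. line_of p s \<in> E}"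

definition delta_cube :: "real \<Rightarrow> int^3 \<Rightarrow> (real^3) set" where
  "delta_cube \<delta> k = {x. \<forall>i. \<delta> * of_int (k$i) \<le> x$i \<and> x$i \<le> \<delta> * (of_int (k$i) + 1)}"

definition union_of_delta_cubes :: "real \<Rightarrow> (real^3) set \<Rightarrow> bool" where
  "union_of_delta_cubes \<delta> E \<longleftrightarrow> (\<exists>K. E = (\<Union>k\<in>K. delta_cube \<delta> k))"

end

theory Submission
  imports Defs "HOL-Probability.Characteristic_Functions" "HOL-Probability.Sinc_Integral"
begin

text \<open>Where \<open>d\<close> is not small, an \<open>SL\<^sub>2\<close> line is the graph \<open>y \<mapsto> (x, t) = (W + C y, W y - B)\<close> with
  \<open>(B, C, W) = (b / d, c / d, 1 / d)\<close>, so that \<open>\<bar>\<ell> \<inter> E\<bar>\<close> becomes a function \<open>F\<close> of \<open>(B, C, W) \<in> \<real>\<^sup>3\<close>: an integral over \<open>y\<close>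
  of functions of the linear projections \<open>(W + C y, W y - B)\<close>. The spectrum of \<open>F\<close> lies in the union of
  the planes spanned by \<open>(-1, y\<^sup>2, 2 y)\<close> and \<open>(0, y, 1)\<close>, which are tangent to a light cone. Decompose \<open>F\<close>
  according to the position \<open>s (-1, y\<^sup>2, 2 y) + t (0, y, 1)\<close> of the frequency, \<open>\<bar>s\<bar> \<sim> V\<close> and \<open>\<bar>t\<bar> \<sim> \<rho>\<close>. Far
  from the cone (\<open>\<rho> \<sim> V\<close>) each frequency lies in boundedly many planes, and orthogonality gives
  \<open>\<integral> \<bar>F\<bar>\<^sup>2 \<lesssim> \<bar>E\<bar> / \<rho>\<close>. Near the cone, \<open>L\<^sup>4\<close> decoupling into caps of \<open>y\<close> of length \<open>\<sigma> = max \<rho> (sqrt V) / V\<close>,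
  together with the same orthogonality and the trivial bound \<open>\<sigma>\<close> on each cap, gives \<open>\<integral> \<bar>F\<bar>\<^sup>4 \<lesssim> \<bar>E\<bar> / V\<close>. Since
  \<open>F\<close> is constant at scale \<open>1 / V\<close> and the lines are two-dimensionally spaced, both bounds limit the number
  of lines with \<open>F \<ge> \<lambda>\<close> to \<open>\<delta>\<^sup>-\<^sup>2 \<bar>E\<bar>\<close> up to powers of \<open>\<lambda>\<close> and \<open>\<delta>\<^sup>-\<^sup>\<epsilon>\<close>. The decoupling is elementary: passing
  from one angular scale to the next uses only that two numbers are determined by their sum and
  their sum of squares.\<close>

section \<open>The Fejer kernel\<close>

text \<open>A folded copy of the library abbreviation \<open>sinc\<close>, which the simplifier would expand into a
  case distinction.\<close>
definition sinc_fun :: "real \<Rightarrow> real" where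
  "sinc_fun = sinc"

definition fejer :: "real \<Rightarrow> real" where
  "fejer x = (sinc_fun x)\<^sup>2"

lemma sinc_fun_0 [simp]: "sinc_fun 0 = 1"
  by (simp add: sinc_fun_def)

lemma mult_sinc_fun: "x * sinc_fun x = sin x"
  by (simp add: sinc_fun_def)

lemma continuous_on_sinc_fun [continuous_intros]:
  "continuous_on A f \<Longrightarrow> continuous_on A (\<lambda>x. sinc_fun (f x))"
  unfolding sinc_fun_def by (rule continuous_on_sinc)

lemma abs_sinc_fun_le_1: "\<bar>sinc_fun x\<bar> \<le> 1"
  using abs_sin_x_le_abs_x[of x] by (simp add: sinc_fun_def)

lemma sinc_fun_decay: "\<bar>sinc_fun x\<bar> \<le> 2 / (1 + \<bar>x\<bar>)"
proof -
  have "\<bar>x\<bar> * \<bar>sinc_fun x\<bar> \<le> 1"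
    by (metis abs_mult mult_sinc_fun abs_sin_le_one)
  then show ?thesis
    using abs_sinc_fun_le_1[of x] by (simp add: field_simps)
qed

lemma norm_cis_diff_le: "norm (cis a - cis b) \<le> \<bar>a - b\<bar>"
proof -
  have "cis a - cis b = cis b * (iexp (a - b) - 1)"
    by (simp add: cis_conv_exp right_diff_distrib flip: exp_add)
  then have "norm (cis a - cis b) = norm (iexp (a - b) - 1)"
    by (simp only: norm_mult norm_cis mult_1)
  then show ?thesis
    using iexp_approx1[of "a - b" 0] by simp
qed

lemma abs_sin_diff_le: "\<bar>sin x - sin y\<bar> \<le> \<bar>x - y\<bar>" for x y :: real
  using abs_Im_le_cmod[of "cis x - cis y"] norm_cis_diff_le[of x y] by simp

lemma sin_mult_sum_cis:
  "of_real (sin z) * (\<Sum>j<K. cis ((2 * real j + 1 - real K) * z)) = complex_of_real (sin (real K * z))"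
proof -
  have two_i_sin: "2 * \<i> * complex_of_real (sin t) = cis t - cis (- t)" for t
    by (simp add: complex_eq_iff)
  have "2 * \<i> * (complex_of_real (sin z) * (\<Sum>j<K. cis ((2 * real j + 1 - real K) * z)))
      = (\<Sum>j<K. (cis z - cis (- z)) * cis ((2 * real j + 1 - real K) * z))"
    by (subst two_i_sin[symmetric]) (simp add: sum_distrib_left mult_ac)
  also have "\<dots> = (\<Sum>j<K. cis ((2 * real (Suc j) - real K) * z) - cis ((2 * real j - real K) * z))"
    by (intro sum.cong refl) (simp add: left_diff_distrib cis_mult algebra_simps)
  also have "\<dots> = cis (real K * z) - cis (- (real K * z))"
    by (subst sum_lessThan_telescope) (simp add: algebra_simps)
  also have "\<dots> = 2 * \<i> * complex_of_real (sin (real K * z))"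
    by (rule two_i_sin[symmetric])
  finally show ?thesis by simp
qed

lemma sinc_fun_mult_nat:
  assumes "K > 0"
  shows "complex_of_real (sinc_fun (real K * z)) =
    (\<Sum>j<K. cis ((2 * real j + 1 - real K) * z)) * of_real (sinc_fun z) / of_nat K"
proof (cases "z = 0")
  case False
  then show ?thesis
    using sin_mult_sum_cis[of z K] assms
    by (simp add: sinc_fun_def divide_simps mult_ac)
qed (use assms in simp)

definition dirichlet_node :: "nat \<Rightarrow> nat \<Rightarrow> real" where
  "dirichlet_node K j = (2 * real j + 1 - real K) / real K"

definition dirichlet_mean :: "nat \<Rightarrow> real \<Rightarrow> complex" where
  "dirichlet_mean K x = (\<Sum>j<K. cis (dirichlet_node K j * x)) / of_nat K"

lemma abs_dirichlet_node_le_1: "j < K \<Longrightarrow> \<bar>dirichlet_node K j\<bar> \<le> 1"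
  by (auto simp: dirichlet_node_def divide_simps)

lemma norm_dirichlet_mean_le_1: "norm (dirichlet_mean K x) \<le> 1"
proof -
  have "norm (\<Sum>j<K. cis (dirichlet_node K j * x)) \<le> (\<Sum>j<K. 1)"
    by (rule order_trans[OF norm_sum]) simp
  then show ?thesis
    by (simp add: dirichlet_mean_def norm_divide divide_simps)
qed

lemma dirichlet_mean_lipschitz: "norm (dirichlet_mean K x - dirichlet_mean K y) \<le> \<bar>x - y\<bar>"
proof -
  have node: "norm (cis (dirichlet_node K j * x) - cis (dirichlet_node K j * y)) \<le> \<bar>x - y\<bar>"
    if "j < K" for j
  proof -
    have "norm (cis (dirichlet_node K j * x) - cis (dirichlet_node K j * y))
        \<le> \<bar>dirichlet_node K j\<bar> * \<bar>x - y\<bar>"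
      using norm_cis_diff_le[of "dirichlet_node K j * x" "dirichlet_node K j * y"]
      by (simp add: right_diff_distrib[symmetric] abs_mult)
    also have "\<dots> \<le> \<bar>x - y\<bar>"
      using abs_dirichlet_node_le_1[OF that] by (simp add: mult_left_le_one_le)
    finally show ?thesis .
  qed
  have "norm (\<Sum>j<K. cis (dirichlet_node K j * x) - cis (dirichlet_node K j * y)) \<le> (\<Sum>j<K. \<bar>x - y\<bar>)"
    by (rule order_trans[OF norm_sum], rule sum_mono) (use node in simp)
  then show ?thesis
    by (simp add: dirichlet_mean_def norm_divide divide_simps sum_subtractf mult.commute
        flip: diff_divide_distrib)
qed

lemma dirichlet_mean_tendsto: "(\<lambda>K. dirichlet_mean K x) \<longlonglongrightarrow> complex_of_real (sinc_fun x)"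
proof -
  have factor: "complex_of_real (sinc_fun x) = dirichlet_mean K x * of_real (sinc_fun (x / real K))"
    if "K > 0" for K
    using sinc_fun_mult_nat[OF that, of "x / real K"] that
    by (simp add: dirichlet_mean_def dirichlet_node_def)
  have "isCont sinc_fun 0"
    unfolding sinc_fun_def by (rule isCont_sinc)
  then have "(\<lambda>K. sinc_fun (x / real K)) \<longlonglongrightarrow> 1"
    using isCont_tendsto_compose[OF _ lim_const_over_n[of x]] by force
  then have lim_1: "(\<lambda>K. complex_of_real (sinc_fun (x / real K))) \<longlonglongrightarrow> 1"
    using tendsto_of_real by fastforce
  have "(\<lambda>K. of_real (sinc_fun x) / complex_of_real (sinc_fun (x / real K))) \<longlonglongrightarrow> of_real (sinc_fun x) / 1"
    by (intro tendsto_divide tendsto_const lim_1) simp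
  moreover have "\<forall>\<^sub>F K in sequentially. complex_of_real (sinc_fun (x / real K)) \<noteq> 0"
    by (rule tendsto_imp_eventually_ne[OF lim_1]) simp
  then have "\<forall>\<^sub>F K in sequentially.
      of_real (sinc_fun x) / complex_of_real (sinc_fun (x / real K)) = dirichlet_mean K x"
    using eventually_gt_at_top[of "0::nat"] by eventually_elim (use factor in simp)
  ultimately show ?thesis
    by (simp add: Lim_transform_eventually)
qed

lemma sinc_fun_lipschitz: "\<bar>sinc_fun x - sinc_fun y\<bar> \<le> \<bar>x - y\<bar>"
proof -
  have "norm (complex_of_real (sinc_fun x) - complex_of_real (sinc_fun y)) \<le> \<bar>x - y\<bar>"
    by (rule Lim_bounded[OF tendsto_norm[OF tendsto_diff[OF dirichlet_mean_tendsto dirichlet_mean_tendsto]]])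
      (simp add: dirichlet_mean_lipschitz)
  then show ?thesis
    by (metis norm_of_real of_real_diff)
qed

lemma sinc_fun_lipschitz_decay: "\<bar>sinc_fun x - sinc_fun y\<bar> \<le> 3 * \<bar>x - y\<bar> / (1 + \<bar>x\<bar>)"
proof -
  have "x * (sinc_fun x - sinc_fun y) = (sin x - sin y) - (x - y) * sinc_fun y"
    using mult_sinc_fun[of x] mult_sinc_fun[of y] by (simp add: algebra_simps)
  moreover have "\<bar>(x - y) * sinc_fun y\<bar> \<le> \<bar>x - y\<bar>"
    using abs_sinc_fun_le_1[of y] by (simp add: abs_mult mult_left_le)
  ultimately have "\<bar>x * (sinc_fun x - sinc_fun y)\<bar> \<le> 2 * \<bar>x - y\<bar>"
    using abs_sin_diff_le[of x y] abs_triangle_ineq4[of "sin x - sin y" "(x - y) * sinc_fun y"] by simp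
  then have "(1 + \<bar>x\<bar>) * \<bar>sinc_fun x - sinc_fun y\<bar> \<le> 3 * \<bar>x - y\<bar>"
    using sinc_fun_lipschitz[of x y] by (simp add: distrib_right abs_mult)
  then show ?thesis
    by (simp add: pos_le_divide_eq mult.commute)
qed

lemma fejer_0 [simp]: "fejer 0 = 1"
  by (simp add: fejer_def)

lemma fejer_nonneg [simp]: "0 \<le> fejer x"
  by (simp add: fejer_def)

lemma fejer_le_1: "fejer x \<le> 1"
  using abs_sinc_fun_le_1[of x] by (simp add: fejer_def abs_square_le_1)

lemma fejer_minus: "fejer (- x) = fejer x"
  by (simp add: fejer_def sinc_fun_def)

lemma continuous_on_fejer [continuous_intros]:
  "continuous_on A f \<Longrightarrow> continuous_on A (\<lambda>x. fejer (f x))"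
  unfolding fejer_def by (intro continuous_intros)

lemma borel_measurable_fejer [measurable]: "fejer \<in> borel_measurable borel"
  by (intro borel_measurable_continuous_onI continuous_on_fejer continuous_on_id)

lemma one_plus_square_le: "1 + x\<^sup>2 \<le> (1 + \<bar>x\<bar>)\<^sup>2" for x :: real
  by (simp add: power2_eq_square algebra_simps flip: abs_mult)

lemma fejer_decay: "fejer x \<le> 4 / (1 + x\<^sup>2)"
proof -
  have "fejer x \<le> (2 / (1 + \<bar>x\<bar>))\<^sup>2"
    unfolding fejer_def using sinc_fun_decay[of x] by (metis abs_ge_zero power2_abs power_mono)
  also have "\<dots> = 4 / (1 + \<bar>x\<bar>)\<^sup>2"
    by (simp add: power_divide)
  also have "\<dots> \<le> 4 / (1 + x\<^sup>2)"
    using one_plus_square_le[of x] by (intro divide_left_mono) (auto intro!: mult_pos_pos add_pos_nonneg)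
  finally show ?thesis .
qed

lemma fejer_lipschitz_decay:
  assumes "\<bar>x - y\<bar> \<le> 1"
  shows "\<bar>fejer x - fejer y\<bar> \<le> 18 * \<bar>x - y\<bar> / (1 + x\<^sup>2)"
proof -
  have "\<bar>sinc_fun y\<bar> \<le> 2 / (1 + \<bar>y\<bar>)" by (rule sinc_fun_decay)
  also have "\<dots> \<le> 2 / ((1 + \<bar>x\<bar>) / 2)"
    using assms by (intro divide_left_mono) auto
  finally have "\<bar>sinc_fun x + sinc_fun y\<bar> \<le> 6 / (1 + \<bar>x\<bar>)"
    using sinc_fun_decay[of x] abs_triangle_ineq[of "sinc_fun x" "sinc_fun y"]
    by (simp add: add_divide_distrib[symmetric])
  then have "\<bar>sinc_fun x - sinc_fun y\<bar> * \<bar>sinc_fun x + sinc_fun y\<bar>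
      \<le> 3 * \<bar>x - y\<bar> / (1 + \<bar>x\<bar>) * (6 / (1 + \<bar>x\<bar>))"
    by (intro mult_mono sinc_fun_lipschitz_decay) auto
  also have "\<dots> = 18 * \<bar>x - y\<bar> / (1 + \<bar>x\<bar>)\<^sup>2"
    by (simp add: power2_eq_square)
  also have "\<dots> \<le> 18 * \<bar>x - y\<bar> / (1 + x\<^sup>2)"
    using one_plus_square_le[of x] by (intro divide_left_mono) (auto intro!: mult_pos_pos add_pos_nonneg)
  finally show ?thesis
    by (simp add: fejer_def power2_eq_square square_diff_square_factored abs_mult mult_ac)
qed

lemma fejer_ge_half:
  assumes "\<bar>x\<bar> \<le> 1/4"
  shows "1/2 \<le> fejer x"
proof -
  have "3/4 \<le> sinc_fun x"
    using sinc_fun_lipschitz[of x 0] assms by (simp add: abs_if split: if_splits)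
  then have "(3/4)\<^sup>2 \<le> fejer x"
    unfolding fejer_def by (intro power_mono) auto
  then show ?thesis by (simp add: power2_eq_square)
qed

lemma inverse_1_plus_square_le_arctan_diff:
  fixes u \<theta> :: real
  assumes "0 < \<theta>" "\<theta> \<le> 1"
  shows "1 / (1 + u\<^sup>2) \<le> 3 / \<theta> * (arctan (u + \<theta>) - arctan u)"
proof -
  obtain \<xi> where \<xi>: "u < \<xi>" "\<xi> < u + \<theta>"
    and mvt: "arctan (u + \<theta>) - arctan u = (u + \<theta> - u) * inverse (1 + \<xi>\<^sup>2)"
    using MVT2[of u "u + \<theta>" arctan "\<lambda>x. inverse (1 + x\<^sup>2)"] DERIV_arctan assms(1) by auto
  have "\<bar>\<xi>\<bar> \<le> \<bar>u\<bar> + 1" using \<xi> assms by auto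
  then have "\<xi>\<^sup>2 \<le> (\<bar>u\<bar> + 1)\<^sup>2"
    by (metis abs_ge_zero power2_abs power_mono)
  also have "\<dots> \<le> 2 * u\<^sup>2 + 2"
    using sum_squares_bound[of "\<bar>u\<bar>" 1] by (simp add: power2_eq_square algebra_simps flip: abs_mult)
  finally have "1 + \<xi>\<^sup>2 \<le> 3 * (1 + u\<^sup>2)"
    using zero_le_power2[of u] unfolding distrib_left by linarith
  then have "1 / (1 + u\<^sup>2) \<le> 3 / (1 + \<xi>\<^sup>2)"
    by (simp add: divide_simps add_pos_nonneg)
  then show ?thesis
    using mvt assms by (simp add: field_simps)
qed

lemma sum_int_telescope:
  fixes f :: "int \<Rightarrow> 'a::ab_group_add"
  assumes "a \<le> b"
  shows "(\<Sum>n\<in>{a..<b}. f (n + 1) - f n) = f b - f a"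
  using assms
proof (induction b rule: int_ge_induct)
  case (step b)
  have "{a..<b + 1} = insert b {a..<b}" using step.hyps by auto
  then show ?case using step.IH by simp
qed simp

lemma lattice_decay_sum_le:
  fixes A :: "int set" and h z \<delta> :: real
  assumes "finite A" "0 < h" "0 < \<delta>" "h * \<delta> \<le> 1"
  shows "(\<Sum>n\<in>A. 1 / (1 + (h * (z - of_int n * \<delta>))\<^sup>2)) \<le> 10 / (h * \<delta>)"
proof -
  define \<theta> where "\<theta> = h * \<delta>"
  define u where "u n = \<theta> * of_int n - h * z" for n :: int
  have \<theta>: "0 < \<theta>" "\<theta> \<le> 1" using assms by (simp_all add: \<theta>_def)
  obtain a b where ab: "A \<subseteq> {a..<b}" "a \<le> b"
  proof (cases "A = {}")
    case False
    then have "Min A \<le> Max A" using assms(1) by simp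
    moreover have "A \<subseteq> {Min A..<Max A + 1}"
      using assms(1) by (auto simp: zless_add1_eq simp flip: le_less)
    ultimately show ?thesis using that[of "Min A" "Max A + 1"] by simp
  qed (use that[of 0 0] in simp)
  have "(\<Sum>n\<in>A. 1 / (1 + (h * (z - of_int n * \<delta>))\<^sup>2)) = (\<Sum>n\<in>A. 1 / (1 + (u n)\<^sup>2))"
    by (intro sum.cong refl) (simp add: u_def \<theta>_def power2_eq_square algebra_simps)
  also have "\<dots> \<le> (\<Sum>n\<in>{a..<b}. 1 / (1 + (u n)\<^sup>2))"
    using ab by (intro sum_mono2) (auto simp: add_nonneg_nonneg)
  also have "\<dots> \<le> (\<Sum>n\<in>{a..<b}. 3 / \<theta> * (arctan (u n + \<theta>) - arctan (u n)))"
    by (intro sum_mono inverse_1_plus_square_le_arctan_diff \<theta>)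
  also have "\<dots> = 3 / \<theta> * (\<Sum>n\<in>{a..<b}. arctan (u (n + 1)) - arctan (u n))"
    by (simp add: u_def sum_distrib_left algebra_simps)
  also have "\<dots> = 3 / \<theta> * (arctan (u b) - arctan (u a))"
    by (simp only: sum_int_telescope[OF ab(2), of "\<lambda>n. arctan (u n)"])
  also have "\<dots> \<le> 3 / \<theta> * pi"
    using arctan_bounded[of "u b"] arctan_bounded[of "u a"] \<theta> by (intro mult_left_mono) auto
  also have "\<dots> \<le> 10 / \<theta>"
    using pi_approx \<theta> by (simp add: divide_simps)
  finally show ?thesis by (simp add: \<theta>_def)
qed

lemma nn_integral_inverse_1_plus_square:
  "(\<integral>\<^sup>+x. ennreal (1 / (1 + x\<^sup>2)) \<partial>lborel) = ennreal pi"
proof -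
  have "integrable lborel (\<lambda>x::real. 1 / (1 + x\<^sup>2))"
    using integrable_inverse_1_plus_square by (simp add: set_integrable_def inverse_eq_divide einterval_def)
  moreover have "(\<integral>x. 1 / (1 + x\<^sup>2) \<partial>lborel) = pi"
    using LBINT_inverse_1_plus_square
    by (simp add: interval_lebesgue_integral_def set_lebesgue_integral_def inverse_eq_divide einterval_def)
  ultimately show ?thesis
    by (subst nn_integral_eq_integral) (auto simp: add_nonneg_nonneg)
qed

lemma nn_integral_fejer_affine_le:
  assumes "h \<noteq> 0"
  shows "(\<integral>\<^sup>+x. ennreal (fejer (c + h * x)) \<partial>lborel) \<le> ennreal (13 / \<bar>h\<bar>)"
proof -
  have "ennreal \<bar>h\<bar> * (\<integral>\<^sup>+x. ennreal (fejer (c + h * x)) \<partial>lborel) = (\<integral>\<^sup>+x. ennreal (fejer x) \<partial>lborel)"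
    using nn_integral_real_affine[of "\<lambda>x. ennreal (fejer x)" h c] assms by simp
  also have "\<dots> \<le> (\<integral>\<^sup>+x. ennreal 4 * ennreal (1 / (1 + x\<^sup>2)) \<partial>lborel)"
    by (intro nn_integral_mono, subst ennreal_mult[symmetric]) (auto simp: fejer_decay intro!: ennreal_leI)
  also have "\<dots> = ennreal (4 * pi)"
    by (subst nn_integral_cmult) (auto simp: nn_integral_inverse_1_plus_square ennreal_mult)
  also have "\<dots> \<le> ennreal 13"
    using pi_approx by (intro ennreal_leI) simp
  finally have "ennreal (1 / \<bar>h\<bar>) * (ennreal \<bar>h\<bar> * (\<integral>\<^sup>+x. ennreal (fejer (c + h * x)) \<partial>lborel))
      \<le> ennreal (1 / \<bar>h\<bar>) * ennreal 13"
    by (intro mult_left_mono) auto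
  moreover have "ennreal (1 / \<bar>h\<bar>) * ennreal \<bar>h\<bar> = 1"
    using assms by (simp add: ennreal_mult[symmetric])
  moreover have "ennreal (1 / \<bar>h\<bar>) * ennreal 13 = ennreal (13 / \<bar>h\<bar>)"
    by (subst ennreal_mult[symmetric]) auto
  ultimately show ?thesis
    by (simp add: mult.assoc[symmetric])
qed

lemma integrable_fejer: "integrable lborel fejer"
proof (rule integrableI_bounded)
  have "(\<integral>\<^sup>+x. ennreal (norm (fejer x)) \<partial>lborel) \<le> ennreal 13"
    using nn_integral_fejer_affine_le[of 1 0] by simp
  then show "(\<integral>\<^sup>+x. ennreal (norm (fejer x)) \<partial>lborel) < \<infinity>"
    by (rule order_le_less_trans) simp
qed simp

lemma has_bochner_integral_square_mult_fejer:
  "has_bochner_integral lborel (\<lambda>x. k\<^sup>2 * fejer (k * x / 2)) (2 * \<bar>k\<bar> * (\<integral>x. fejer x \<partial>lborel))"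
proof (cases "k = 0")
  case False
  have "has_bochner_integral lborel (\<lambda>x. fejer (0 + k / 2 * x)) ((\<integral>x. fejer x \<partial>lborel) /\<^sub>R \<bar>k / 2\<bar>)"
    using False has_bochner_integral_integrable[OF integrable_fejer]
    by (subst lborel_has_bochner_integral_real_affine_iff[symmetric]) auto
  from has_bochner_integral_mult_right[OF this, of "k\<^sup>2"]
  have "has_bochner_integral lborel (\<lambda>x. k\<^sup>2 * fejer (k * x / 2)) (k\<^sup>2 * ((\<integral>x. fejer x \<partial>lborel) /\<^sub>R \<bar>k / 2\<bar>))"
    by simp
  also have "k\<^sup>2 * ((\<integral>x. fejer x \<partial>lborel) /\<^sub>R \<bar>k / 2\<bar>) = 2 * \<bar>k\<bar> * (\<integral>x. fejer x \<partial>lborel)"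
    using False by (cases "k > 0") (simp_all add: divide_simps power2_eq_square)
  finally show ?thesis .
qed (simp add: has_bochner_integral_zero)

lemma cos_mult_fejer:
  "8 * (cos (\<xi> * x) * fejer x) = (\<xi> + 2)\<^sup>2 * fejer ((\<xi> + 2) * x / 2)
     + (\<xi> - 2)\<^sup>2 * fejer ((\<xi> - 2) * x / 2) - 2 * (\<xi>\<^sup>2 * fejer (\<xi> * x / 2))" (is "_ = ?rhs")
proof (cases "x = 0")
  case True
  then show ?thesis by (simp add: power2_eq_square algebra_simps)
next
  case False
  have x2_fejer: "x\<^sup>2 * (k\<^sup>2 * fejer (k * x / 2)) = 2 * (1 - cos (k * x))" for k
  proof -
    have "x\<^sup>2 * (k\<^sup>2 * fejer (k * x / 2)) = 4 * ((k * x / 2) * sinc_fun (k * x / 2))\<^sup>2"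
      by (simp add: fejer_def power2_eq_square)
    also have "\<dots> = 4 * (sin (k * x / 2))\<^sup>2" by (simp only: mult_sinc_fun)
    also have "\<dots> = 2 * (1 - cos (k * x))"
      using cos_double_sin[of "k * x / 2"] by simp
    finally show ?thesis .
  qed
  have "x\<^sup>2 * ?rhs = 2 * (1 - cos ((\<xi> + 2) * x)) + 2 * (1 - cos ((\<xi> - 2) * x)) - 2 * (2 * (1 - cos (\<xi> * x)))"
    by (simp only: distrib_left right_diff_distrib mult.left_commute[of "x\<^sup>2" 2] x2_fejer)
  also have "\<dots> = 4 * cos (\<xi> * x) - 2 * (cos (\<xi> * x + 2 * x) + cos (\<xi> * x - 2 * x))"
    by (simp add: algebra_simps)
  also have "\<dots> = 4 * cos (\<xi> * x) * (1 - cos (2 * x))"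
    by (simp add: cos_add cos_diff algebra_simps)
  also have "1 - cos (2 * x) = 2 * (x\<^sup>2 * fejer x)"
    using x2_fejer[of 2] by simp
  finally have "x\<^sup>2 * ?rhs = x\<^sup>2 * (8 * (cos (\<xi> * x) * fejer x))"
    by (simp add: mult_ac)
  then show ?thesis using False by simp
qed

text \<open>By \<open>cos_mult_fejer\<close> the integral is a second difference of the even, piecewise linear function
  \<open>k \<mapsto> \<bar>k\<bar>\<close>, which vanishes away from the kink.\<close>
lemma integral_cos_fejer_eq_0:
  assumes "\<bar>\<xi>\<bar> \<ge> 2"
  shows "(\<integral>x. cos (\<xi> * x) * fejer x \<partial>lborel) = 0"
proof -
  let ?I = "\<integral>x. fejer x \<partial>lborel"
  have "has_bochner_integral lborel (\<lambda>x. 8 * (cos (\<xi> * x) * fejer x))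
      (2 * \<bar>\<xi> + 2\<bar> * ?I + 2 * \<bar>\<xi> - 2\<bar> * ?I - 2 * (2 * \<bar>\<xi>\<bar> * ?I))"
    unfolding cos_mult_fejer
    by (intro has_bochner_integral_diff has_bochner_integral_add has_bochner_integral_mult_right
        has_bochner_integral_square_mult_fejer)
  then have "(\<integral>x. 8 * (cos (\<xi> * x) * fejer x) \<partial>lborel) = (2 * \<bar>\<xi> + 2\<bar> + 2 * \<bar>\<xi> - 2\<bar> - 4 * \<bar>\<xi>\<bar>) * ?I"
    by (simp add: has_bochner_integral_integral_eq algebra_simps)
  also have "2 * \<bar>\<xi> + 2\<bar> + 2 * \<bar>\<xi> - 2\<bar> - 4 * \<bar>\<xi>\<bar> = 0"
    using assms by (auto simp: abs_if split: if_splits)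
  finally show ?thesis by simp
qed

lemma integrable_cis_fejer:
  assumes "\<tau> > 0"
  shows "integrable lborel (\<lambda>x. cis (\<zeta> * x) * complex_of_real (fejer (\<tau> * x)))"
proof (rule Bochner_Integration.integrable_bound)
  show "integrable lborel (\<lambda>x. fejer (\<tau> * x))"
    using lborel_integrable_real_affine[OF integrable_fejer, of \<tau> 0] assms by simp
  have "continuous_on UNIV (\<lambda>x. cis (\<zeta> * x) * complex_of_real (fejer (\<tau> * x)))"
    unfolding cis_conv_exp by (intro continuous_intros)
  then show "(\<lambda>x. cis (\<zeta> * x) * complex_of_real (fejer (\<tau> * x))) \<in> borel_measurable lborel"
    by (simp add: borel_measurable_continuous_onI)
qed (simp add: norm_mult)

lemma integral_cis_fejer_eq_0:
  assumes "\<tau> > 0" "\<bar>\<zeta>\<bar> \<ge> 2 * \<tau>"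
  shows "(\<integral>x. cis (\<zeta> * x) * complex_of_real (fejer (\<tau> * x)) \<partial>lborel) = 0"
proof -
  define \<xi> where "\<xi> = \<zeta> / \<tau>"
  have \<xi>: "\<bar>\<xi>\<bar> \<ge> 2" using assms by (simp add: \<xi>_def divide_simps)
  let ?f = "\<lambda>x. cis (\<xi> * x) * complex_of_real (fejer x)"
  have int: "integrable lborel ?f"
    using integrable_cis_fejer[of 1 \<xi>] by simp
  have Re_0: "Re (\<integral>x. ?f x \<partial>lborel) = 0"
    using integral_Re[OF int] integral_cos_fejer_eq_0[OF \<xi>] by simp
  have "(\<integral>x. sin (\<xi> * x) * fejer x \<partial>lborel) = - (\<integral>x. sin (\<xi> * x) * fejer x \<partial>lborel)"
    using lborel_integral_real_affine[of "-1" "\<lambda>x. sin (\<xi> * x) * fejer x" 0] by (simp add: fejer_minus)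
  then have "Im (\<integral>x. ?f x \<partial>lborel) = 0"
    using integral_Im[OF int] by simp
  with Re_0 have "(\<integral>x. ?f x \<partial>lborel) = 0"
    by (simp add: complex_eq_iff)
  moreover have "(\<integral>x. ?f x \<partial>lborel) = \<tau> *\<^sub>R (\<integral>x. cis (\<zeta> * x) * complex_of_real (fejer (\<tau> * x)) \<partial>lborel)"
    using lborel_integral_real_affine[of \<tau> ?f 0] assms by (simp add: \<xi>_def)
  ultimately show ?thesis using assms by simp
qed

section \<open>Band-limited functions and almost orthogonality\<close>

lemma
  fixes f :: "'a::euclidean_space \<Rightarrow> real \<Rightarrow> 'c::{real_normed_field,banach,second_countable_topology}"
  assumes f: "\<And>b. b \<in> Basis \<Longrightarrow> integrable lborel (f b)"
  shows integrable_prod_Basis: "integrable lborel (\<lambda>p. \<Prod>b\<in>Basis. f b (p \<bullet> b))"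
    and integral_prod_Basis: "(\<integral>p. (\<Prod>b\<in>Basis. f b (p \<bullet> b)) \<partial>lborel) = (\<Prod>b\<in>Basis. \<integral>x. f b x \<partial>lborel)"
proof -
  interpret product_sigma_finite "\<lambda>_::'a. lborel :: real measure" by standard
  define coords where "coords = (\<lambda>g::'a \<Rightarrow> real. \<Sum>b\<in>Basis. g b *\<^sub>R b)"
  have lborel_coords: "(lborel :: 'a measure) = distr (\<Pi>\<^sub>M b\<in>Basis. lborel) borel coords"
    unfolding coords_def by (rule lborel_eq)
  have [measurable]: "coords \<in> (\<Pi>\<^sub>M b\<in>Basis. lborel) \<rightarrow>\<^sub>M borel"
    unfolding coords_def by measurable
  have [measurable]: "f b \<in> borel_measurable borel" if "b \<in> Basis" for b
    using f[OF that] by auto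
  have prod_meas: "(\<lambda>p. \<Prod>b\<in>Basis. f b (p \<bullet> b)) \<in> borel_measurable borel"
    by measurable
  have coords_inner: "(\<Prod>b\<in>Basis. f b (coords g \<bullet> b)) = (\<Prod>b\<in>Basis. f b (g b))" for g
    by (intro prod.cong refl) (simp add: coords_def)
  show "integrable lborel (\<lambda>p. \<Prod>b\<in>Basis. f b (p \<bullet> b))"
    unfolding lborel_coords
    by (subst integrable_distr_eq) (auto simp: prod_meas coords_inner intro!: product_integrable_prod f)
  show "(\<integral>p. (\<Prod>b\<in>Basis. f b (p \<bullet> b)) \<partial>lborel) = (\<Prod>b\<in>Basis. \<integral>x. f b x \<partial>lborel)"
    unfolding lborel_coords
    by (subst integral_distr) (auto simp: prod_meas coords_inner intro!: product_integral_prod f)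
qed

definition weight :: "real \<Rightarrow> 'a::euclidean_space \<Rightarrow> real" where
  "weight \<tau> p = (\<Prod>b\<in>Basis. fejer (\<tau> * (p \<bullet> b)))"

lemma weight_nonneg [simp]: "0 \<le> weight \<tau> p"
  by (simp add: weight_def prod_nonneg)

lemma weight_le_fejer:
  assumes "b \<in> Basis"
  shows "weight \<tau> p \<le> fejer (\<tau> * (p \<bullet> b))"
proof -
  have "weight \<tau> p = fejer (\<tau> * (p \<bullet> b)) * (\<Prod>c\<in>Basis - {b}. fejer (\<tau> * (p \<bullet> c)))"
    unfolding weight_def by (rule prod.remove) (use assms in auto)
  also have "\<dots> \<le> fejer (\<tau> * (p \<bullet> b)) * 1"
    by (intro mult_left_mono prod_le_1) (auto simp: fejer_le_1)
  finally show ?thesis by simp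
qed

lemma weight_ge:
  fixes p :: "'a::euclidean_space"
  assumes "\<And>b. b \<in> Basis \<Longrightarrow> \<bar>\<tau> * (p \<bullet> b)\<bar> \<le> 1/4"
  shows "(1/2) ^ DIM('a) \<le> weight \<tau> p"
proof -
  have "(\<Prod>b\<in>(Basis::'a set). 1/2) \<le> weight \<tau> p"
    unfolding weight_def by (intro prod_mono) (use assms fejer_ge_half in force)
  then show ?thesis by simp
qed

lemma continuous_on_weight [continuous_intros]: "continuous_on A (weight \<tau>)"
  unfolding weight_def by (intro continuous_intros)

definition near :: "real \<Rightarrow> 'a::euclidean_space \<Rightarrow> bool" where
  "near \<tau> z \<longleftrightarrow> (\<forall>b\<in>Basis. \<bar>z \<bullet> b\<bar> < 2 * \<tau>)"

lemma
  fixes z :: "'a::euclidean_space"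
  assumes "\<tau> > 0"
  shows integrable_cis_weight: "integrable lborel (\<lambda>p. cis (z \<bullet> p) * complex_of_real (weight \<tau> p))"
    and integral_cis_weight_eq_0:
      "\<not> near \<tau> z \<Longrightarrow> (\<integral>p. cis (z \<bullet> p) * complex_of_real (weight \<tau> p) \<partial>lborel) = 0"
proof -
  have factor: "cis (z \<bullet> p) * complex_of_real (weight \<tau> p)
      = (\<Prod>b\<in>Basis. cis ((z \<bullet> b) * (p \<bullet> b)) * complex_of_real (fejer (\<tau> * (p \<bullet> b))))" for p
  proof -
    have "cis (z \<bullet> p) = (\<Prod>b\<in>Basis. cis ((z \<bullet> b) * (p \<bullet> b)))"
      unfolding cis_conv_exp by (subst euclidean_inner) (simp add: sum_distrib_left exp_sum)
    then show ?thesis by (simp add: weight_def prod.distrib)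
  qed
  note int = integrable_cis_fejer[OF assms]
  show "integrable lborel (\<lambda>p. cis (z \<bullet> p) * complex_of_real (weight \<tau> p))"
    unfolding factor by (rule integrable_prod_Basis[OF int])
  assume "\<not> near \<tau> z"
  then obtain b where "b \<in> Basis" "2 * \<tau> \<le> \<bar>z \<bullet> b\<bar>"
    by (auto simp: near_def not_less)
  then show "(\<integral>p. cis (z \<bullet> p) * complex_of_real (weight \<tau> p) \<partial>lborel) = 0"
    unfolding factor
    by (subst integral_prod_Basis[OF int]) (auto intro!: prod_zero bexI integral_cis_fejer_eq_0 assms)
qed

lemma integrable_weight:
  assumes "\<tau> > 0"
  shows "integrable lborel (weight \<tau> :: 'a::euclidean_space \<Rightarrow> real)"
proof -
  have "complex_integrable lborel (\<lambda>p::'a. complex_of_real (weight \<tau> p))"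
    using integrable_cis_weight[OF assms, of "0::'a"] by simp
  then show ?thesis by (simp only: complex_of_real_integrable_eq)
qed

lemma bcontfun_sum: "(\<And>i. i \<in> I \<Longrightarrow> f i \<in> bcontfun) \<Longrightarrow> (\<lambda>p. \<Sum>i\<in>I. f i p) \<in> bcontfun"
  for f :: "'i \<Rightarrow> 'a::topological_space \<Rightarrow> 'b::real_normed_vector"
  by (induction I rule: infinite_finite_induct) (auto intro: plus_cont const_bcontfun)

lemma bcontfun_mult:
  fixes f g :: "'a::topological_space \<Rightarrow> 'b::real_normed_algebra"
  assumes "f \<in> bcontfun" "g \<in> bcontfun"
  shows "(\<lambda>p. f p * g p) \<in> bcontfun"
proof -
  obtain C D where C: "\<And>p. norm (f p) \<le> C" and D: "\<And>p. norm (g p) \<le> D"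
    using assms by (auto simp: bcontfun_def bounded_iff)
  have "norm (f p * g p) \<le> C * D" for p
    by (intro order_trans[OF norm_mult_ineq] mult_mono C D norm_ge_zero order_trans[OF norm_ge_zero C])
  then show ?thesis
    using assms by (intro bcontfun_normI) (auto simp: bcontfun_def intro: continuous_on_mult)
qed

lemma bcontfun_cnj: "f \<in> bcontfun \<Longrightarrow> (\<lambda>p. cnj (f p)) \<in> bcontfun"
  by (auto simp: bcontfun_def bounded_iff intro!: continuous_intros)

lemma bcontfun_norm_power:
  fixes f :: "'a::topological_space \<Rightarrow> 'b::real_normed_vector"
  assumes "f \<in> bcontfun"
  shows "(\<lambda>p. norm (f p) ^ n) \<in> bcontfun"
proof -
  obtain C where "\<And>p. norm (f p) \<le> C"
    using assms by (auto simp: bcontfun_def bounded_iff)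
  then show ?thesis
    using assms by (intro bcontfun_normI[of _ "C ^ n"])
      (auto simp: bcontfun_def power_mono intro!: continuous_intros)
qed

lemma bcontfun_cis: "(\<lambda>p::'a::real_inner. c * cis (\<xi> \<bullet> p)) \<in> bcontfun"
  by (rule bcontfun_normI[of _ "norm c"]) (auto simp: norm_mult cis_conv_exp intro!: continuous_intros)

lemmas bcontfun_intros = plus_cont bcontfun_sum bcontfun_mult bcontfun_cnj bcontfun_norm_power
  bcontfun_cis const_bcontfun

lemma integrable_bcontfun_weight:
  fixes f :: "'a::euclidean_space \<Rightarrow> 'b::{banach, second_countable_topology, real_normed_algebra_1}"
  assumes "\<tau> > 0" "f \<in> bcontfun"
  shows "integrable lborel (\<lambda>p. f p * of_real (weight \<tau> p))"
proof -
  obtain C where C: "\<And>p. norm (f p) \<le> C"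
    using assms(2) by (auto simp: bcontfun_def bounded_iff)
  have bound: "norm (f p * of_real (weight \<tau> p)) \<le> norm (C * weight \<tau> p)" for p
    using order_trans[OF norm_mult_ineq mult_right_mono[OF order_trans[OF C abs_ge_self] norm_ge_zero],
        of p "of_real (weight \<tau> p)"]
    by (simp add: abs_mult)
  have "continuous_on UNIV (\<lambda>p. f p * of_real (weight \<tau> p))"
    using assms(2) by (auto simp: bcontfun_def intro!: continuous_intros)
  then have "(\<lambda>p. f p * of_real (weight \<tau> p)) \<in> borel_measurable lborel"
    by (simp add: borel_measurable_continuous_onI)
  then show ?thesis
    by (rule Bochner_Integration.integrable_bound[OF
          integrable_mult_right[OF integrable_weight[OF assms(1)]] _ AE_I2[OF bound]])
qed

definition weighted_integral :: "real \<Rightarrow> ('a::euclidean_space \<Rightarrow> real) \<Rightarrow> real" where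
  "weighted_integral \<tau> g = (\<integral>p. g p * weight \<tau> p \<partial>lborel)"

definition weighted_inner ::
    "real \<Rightarrow> ('a::euclidean_space \<Rightarrow> complex) \<Rightarrow> ('a \<Rightarrow> complex) \<Rightarrow> complex" where
  "weighted_inner \<tau> f g = (\<integral>p. f p * cnj (g p) * complex_of_real (weight \<tau> p) \<partial>lborel)"

lemma integrable_mult_weight: "\<tau> > 0 \<Longrightarrow> g \<in> bcontfun \<Longrightarrow> integrable lborel (\<lambda>p. g p * weight \<tau> p)"
  for g :: "'a::euclidean_space \<Rightarrow> real"
  using integrable_bcontfun_weight[of \<tau> g] by simp

lemma integrable_weighted_inner:
  fixes f g :: "'a::euclidean_space \<Rightarrow> complex"
  assumes "\<tau> > 0" "f \<in> bcontfun" "g \<in> bcontfun"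
  shows "integrable lborel (\<lambda>p. f p * cnj (g p) * complex_of_real (weight \<tau> p))"
  by (intro integrable_bcontfun_weight bcontfun_intros assms)

lemma weighted_integral_nonneg: "(\<And>p. 0 \<le> g p) \<Longrightarrow> 0 \<le> weighted_integral \<tau> g"
  unfolding weighted_integral_def by (intro integral_nonneg_AE) auto

lemma weighted_integral_mono:
  assumes "\<tau> > 0" "f \<in> bcontfun" "g \<in> bcontfun" "\<And>p. f p \<le> g p"
  shows "weighted_integral \<tau> f \<le> weighted_integral \<tau> g"
  unfolding weighted_integral_def
  by (intro integral_mono integrable_mult_weight mult_right_mono assms weight_nonneg)

lemma weighted_integral_cmult: "weighted_integral \<tau> (\<lambda>p. c * g p) = c * weighted_integral \<tau> g"
  by (simp add: weighted_integral_def mult.assoc)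

lemma weighted_integral_sum:
  "\<tau> > 0 \<Longrightarrow> (\<And>i. i \<in> I \<Longrightarrow> g i \<in> bcontfun) \<Longrightarrow>
    weighted_integral \<tau> (\<lambda>p. \<Sum>i\<in>I. g i p) = (\<Sum>i\<in>I. weighted_integral \<tau> (g i))"
  unfolding weighted_integral_def sum_distrib_right
  by (intro Bochner_Integration.integral_sum integrable_mult_weight)

lemma power_sum_le:
  fixes f :: "'i \<Rightarrow> real"
  assumes "\<And>i. i \<in> I \<Longrightarrow> 0 \<le> f i"
  shows "(\<Sum>i\<in>I. f i) ^ Suc n \<le> real (card I) ^ n * (\<Sum>i\<in>I. f i ^ Suc n)"
proof (cases "finite I \<and> I \<noteq> {}")
  case True
  then have card: "0 < real (card I)" by (simp add: card_gt_0_iff)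
  have "convex_on {0::real..} (\<lambda>x. x ^ Suc n)"
    using convex_power_even[of "Suc n"] convex_power_odd[of "Suc n"] convex_on_subset
    by (cases "even (Suc n)") auto
  from convex_on_sum[OF _ _ this, of I "\<lambda>_. 1 / real (card I)" f]
  have "(\<Sum>i\<in>I. 1 / real (card I) * f i) ^ Suc n \<le> (\<Sum>i\<in>I. 1 / real (card I) * f i ^ Suc n)"
    using True assms by (simp del: power_Suc)
  then have "((\<Sum>i\<in>I. f i) / card I) ^ Suc n \<le> (\<Sum>i\<in>I. f i ^ Suc n) / card I"
    by (simp add: sum_divide_distrib del: power_Suc)
  then show ?thesis
    using card by (simp add: power_divide field_simps)
qed auto

lemma weighted_integral_norm_sum_power_le:
  fixes u :: "'i \<Rightarrow> 'a::euclidean_space \<Rightarrow> 'b::real_normed_vector"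
  assumes \<tau>: "\<tau> > 0" and u: "\<And>i. i \<in> I \<Longrightarrow> u i \<in> bcontfun"
  shows "weighted_integral \<tau> (\<lambda>p. norm (\<Sum>i\<in>I. u i p) ^ Suc n)
    \<le> real (card I) ^ n * (\<Sum>i\<in>I. weighted_integral \<tau> (\<lambda>p. norm (u i p) ^ Suc n))"
proof -
  have "norm (\<Sum>i\<in>I. u i p) ^ Suc n \<le> real (card I) ^ n * (\<Sum>i\<in>I. norm (u i p) ^ Suc n)" for p
    by (intro order_trans[OF power_mono power_sum_le] norm_sum norm_ge_zero)
  then have "weighted_integral \<tau> (\<lambda>p. norm (\<Sum>i\<in>I. u i p) ^ Suc n)
      \<le> weighted_integral \<tau> (\<lambda>p. real (card I) ^ n * (\<Sum>i\<in>I. norm (u i p) ^ Suc n))"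
    using \<tau> u by (intro weighted_integral_mono bcontfun_intros)
  also have "\<dots> = real (card I) ^ n * (\<Sum>i\<in>I. weighted_integral \<tau> (\<lambda>p. norm (u i p) ^ Suc n))"
    using \<tau> u by (simp only: weighted_integral_cmult weighted_integral_sum bcontfun_norm_power)
  finally show ?thesis .
qed

lemma weighted_inner_self: "weighted_inner \<tau> f f = of_real (weighted_integral \<tau> (\<lambda>p. (norm (f p))\<^sup>2))"
proof -
  have "f p * cnj (f p) * complex_of_real (weight \<tau> p) = complex_of_real ((norm (f p))\<^sup>2 * weight \<tau> p)" for p
    by (simp only: complex_norm_square of_real_mult)
  then show ?thesis
    unfolding weighted_inner_def weighted_integral_def by (simp only: integral_complex_of_real)
qed

lemma weighted_inner_commute: "weighted_inner \<tau> g f = cnj (weighted_inner \<tau> f g)"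
  unfolding weighted_inner_def by (simp add: Bochner_Integration.integral_cnj[symmetric] mult_ac)

lemma norm_weighted_inner_le:
  assumes "\<tau> > 0" "f \<in> bcontfun" "g \<in> bcontfun"
  shows "norm (weighted_inner \<tau> f g)
    \<le> (weighted_integral \<tau> (\<lambda>p. (norm (f p))\<^sup>2) + weighted_integral \<tau> (\<lambda>p. (norm (g p))\<^sup>2)) / 2"
proof -
  have "norm (weighted_inner \<tau> f g) \<le> (\<integral>p. norm (f p * cnj (g p) * complex_of_real (weight \<tau> p)) \<partial>lborel)"
    unfolding weighted_inner_def by (rule integral_norm_bound)
  also have "\<dots> \<le> (\<integral>p. ((norm (f p))\<^sup>2 * weight \<tau> p + (norm (g p))\<^sup>2 * weight \<tau> p) / 2 \<partial>lborel)"
  proof (rule integral_mono)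
    fix p
    have "norm (f p) * norm (g p) \<le> ((norm (f p))\<^sup>2 + (norm (g p))\<^sup>2) / 2"
      using sum_squares_bound[of "norm (f p)" "norm (g p)"] by simp
    then have "norm (f p) * norm (g p) * weight \<tau> p \<le> ((norm (f p))\<^sup>2 + (norm (g p))\<^sup>2) / 2 * weight \<tau> p"
      by (rule mult_right_mono) simp
    then show "norm (f p * cnj (g p) * complex_of_real (weight \<tau> p))
        \<le> ((norm (f p))\<^sup>2 * weight \<tau> p + (norm (g p))\<^sup>2 * weight \<tau> p) / 2"
      by (simp add: norm_mult algebra_simps)
  qed (use assms in \<open>auto intro!: integrable_norm integrable_weighted_inner integrable_mult_weight bcontfun_intros\<close>)
  also have "\<dots> = (weighted_integral \<tau> (\<lambda>p. (norm (f p))\<^sup>2) + weighted_integral \<tau> (\<lambda>p. (norm (g p))\<^sup>2)) / 2"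
    unfolding weighted_integral_def using assms by (simp add: integrable_mult_weight bcontfun_norm_power)
  finally show ?thesis .
qed

lemma almost_orthogonality:
  fixes f :: "'i \<Rightarrow> 'a::euclidean_space \<Rightarrow> complex"
  assumes \<tau>: "\<tau> > 0" and J: "finite J" and f: "\<And>j. j \<in> J \<Longrightarrow> f j \<in> bcontfun"
    and overlap: "\<And>j. j \<in> J \<Longrightarrow> real (card {i\<in>J. weighted_inner \<tau> (f j) (f i) \<noteq> 0}) \<le> N"
  shows "weighted_integral \<tau> (\<lambda>p. (norm (\<Sum>j\<in>J. f j p))\<^sup>2)
    \<le> N * (\<Sum>j\<in>J. weighted_integral \<tau> (\<lambda>p. (norm (f j p))\<^sup>2))"
proof -
  define a where "a j = weighted_integral \<tau> (\<lambda>p. (norm (f j p))\<^sup>2)" for j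
  define n where "n j i = (if weighted_inner \<tau> (f j) (f i) \<noteq> 0 then 1 else 0 :: real)" for j i
  have a_nonneg: "a j \<ge> 0" for j unfolding a_def by (rule weighted_integral_nonneg) simp
  have n_sym: "n j i = n i j" for i j
    unfolding n_def using weighted_inner_commute[of \<tau> "f i" "f j"] by simp
  have n_row: "(\<Sum>i\<in>J. n j i) \<le> N" if "j \<in> J" for j
    using overlap[OF that] J by (simp add: n_def sum.If_cases Int_def)
  have "complex_of_real (weighted_integral \<tau> (\<lambda>p. (norm (\<Sum>j\<in>J. f j p))\<^sup>2))
      = weighted_inner \<tau> (\<lambda>p. \<Sum>j\<in>J. f j p) (\<lambda>p. \<Sum>j\<in>J. f j p)"
    by (rule weighted_inner_self[symmetric])
  also have "\<dots> = (\<integral>p. (\<Sum>j\<in>J. \<Sum>i\<in>J. f j p * cnj (f i p) * complex_of_real (weight \<tau> p)) \<partial>lborel)"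
    unfolding weighted_inner_def by (simp only: cnj_sum sum_product) (simp only: sum_distrib_right)
  also have "\<dots> = (\<Sum>j\<in>J. \<Sum>i\<in>J. weighted_inner \<tau> (f j) (f i))"
    unfolding weighted_inner_def using \<tau> f
    by (simp add: Bochner_Integration.integral_sum integrable_weighted_inner)
  finally have expand: "complex_of_real (weighted_integral \<tau> (\<lambda>p. (norm (\<Sum>j\<in>J. f j p))\<^sup>2))
      = (\<Sum>j\<in>J. \<Sum>i\<in>J. weighted_inner \<tau> (f j) (f i))" .
  have "weighted_integral \<tau> (\<lambda>p. (norm (\<Sum>j\<in>J. f j p))\<^sup>2) \<le> norm (\<Sum>j\<in>J. \<Sum>i\<in>J. weighted_inner \<tau> (f j) (f i))"
    unfolding expand[symmetric] norm_of_real by (rule abs_ge_self)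
  also have "\<dots> \<le> (\<Sum>j\<in>J. \<Sum>i\<in>J. norm (weighted_inner \<tau> (f j) (f i)))"
    by (rule order_trans[OF norm_sum]) (intro sum_mono norm_sum)
  also have "\<dots> \<le> (\<Sum>j\<in>J. \<Sum>i\<in>J. n j i * ((a j + a i) / 2))"
    using norm_weighted_inner_le[OF \<tau> f f] by (intro sum_mono) (auto simp: n_def a_def)
  also have "\<dots> = (\<Sum>j\<in>J. \<Sum>i\<in>J. n j i * a j) / 2 + (\<Sum>j\<in>J. \<Sum>i\<in>J. n j i * a i) / 2"
    by (simp add: sum.distrib add_divide_distrib distrib_left sum_divide_distrib)
  also have "(\<Sum>j\<in>J. \<Sum>i\<in>J. n j i * a i) = (\<Sum>j\<in>J. \<Sum>i\<in>J. n j i * a j)"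
    by (subst sum.swap) (simp add: n_sym)
  also have "(\<Sum>j\<in>J. \<Sum>i\<in>J. n j i * a j) / 2 + (\<Sum>j\<in>J. \<Sum>i\<in>J. n j i * a j) / 2 = (\<Sum>j\<in>J. (\<Sum>i\<in>J. n j i) * a j)"
    by (simp add: sum_distrib_right)
  also have "\<dots> \<le> (\<Sum>j\<in>J. N * a j)"
    by (intro sum_mono mult_right_mono n_row a_nonneg)
  finally show ?thesis by (simp add: a_def sum_distrib_left)
qed

lemma weighted_integral_norm_mult_square_le:
  fixes f g :: "'a::euclidean_space \<Rightarrow> complex"
  assumes "\<tau> > 0" "f \<in> bcontfun" "g \<in> bcontfun"
  shows "weighted_integral \<tau> (\<lambda>p. (norm (f p * g p))\<^sup>2)
    \<le> (weighted_integral \<tau> (\<lambda>p. norm (f p) ^ 4) + weighted_integral \<tau> (\<lambda>p. norm (g p) ^ 4)) / 2"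
proof -
  have "(norm (f p * g p))\<^sup>2 \<le> 1/2 * (norm (f p) ^ 4 + norm (g p) ^ 4)" for p
    using sum_squares_bound[of "(norm (f p))\<^sup>2" "(norm (g p))\<^sup>2"]
    by (simp add: norm_mult power_mult_distrib flip: power_mult)
  then have "weighted_integral \<tau> (\<lambda>p. (norm (f p * g p))\<^sup>2)
      \<le> weighted_integral \<tau> (\<lambda>p. 1/2 * (norm (f p) ^ 4 + norm (g p) ^ 4))"
    using assms by (intro weighted_integral_mono bcontfun_intros)
  also have "\<dots> = (weighted_integral \<tau> (\<lambda>p. norm (f p) ^ 4) + weighted_integral \<tau> (\<lambda>p. norm (g p) ^ 4)) / 2"
    unfolding weighted_integral_cmult unfolding weighted_integral_def using assms
    by (simp add: distrib_right integrable_mult_weight bcontfun_norm_power)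
  finally show ?thesis .
qed

lemma bilinear_L4_orthogonality:
  fixes x :: "'i \<Rightarrow> 'a::euclidean_space \<Rightarrow> complex"
  assumes \<tau>: "\<tau> > 0" and B: "finite B" and x: "\<And>b. b \<in> B \<Longrightarrow> x b \<in> bcontfun" and N: "0 \<le> N"
    and overlap: "\<And>b c. b \<in> B \<Longrightarrow> c \<in> B \<Longrightarrow> real (card {q \<in> B \<times> B.
      weighted_inner \<tau> (\<lambda>p. x b p * x c p) (\<lambda>p. x (fst q) p * x (snd q) p) \<noteq> 0}) \<le> N"
  shows "weighted_integral \<tau> (\<lambda>p. norm (\<Sum>b\<in>B. x b p) ^ 4)
    \<le> N * (real (card B) * (\<Sum>b\<in>B. weighted_integral \<tau> (\<lambda>p. norm (x b p) ^ 4)))"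
proof -
  define G where "G q p = x (fst q) p * x (snd q) p" for q p
  define W where "W b = weighted_integral \<tau> (\<lambda>p. norm (x b p) ^ 4)" for b
  have square: "norm (\<Sum>b\<in>B. x b p) ^ 4 = (norm (\<Sum>q\<in>B \<times> B. G q p))\<^sup>2" for p
  proof -
    have "(\<Sum>q\<in>B \<times> B. G q p) = (\<Sum>b\<in>B. x b p) * (\<Sum>b\<in>B. x b p)"
      by (simp add: G_def sum_product sum.cartesian_product case_prod_beta)
    then show ?thesis
      by (simp add: norm_mult power2_eq_square power4_eq_xxxx mult.assoc)
  qed
  have "weighted_integral \<tau> (\<lambda>p. norm (\<Sum>b\<in>B. x b p) ^ 4)
      \<le> N * (\<Sum>q\<in>B \<times> B. weighted_integral \<tau> (\<lambda>p. (norm (G q p))\<^sup>2))"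
    unfolding square
  proof (rule almost_orthogonality[OF \<tau>])
    show "real (card {q'\<in>B \<times> B. weighted_inner \<tau> (G q) (G q') \<noteq> 0}) \<le> N" if "q \<in> B \<times> B" for q
      using overlap[of "fst q" "snd q"] that by (auto simp: G_def[abs_def])
  qed (use B x in \<open>auto simp: G_def[abs_def] intro!: bcontfun_intros\<close>)
  also have "\<dots> \<le> N * (\<Sum>q\<in>B \<times> B. (W (fst q) + W (snd q)) / 2)"
    unfolding G_def W_def using \<tau> x N
    by (intro mult_left_mono sum_mono weighted_integral_norm_mult_square_le) auto
  also have "(\<Sum>q\<in>B \<times> B. (W (fst q) + W (snd q)) / 2) = (\<Sum>b\<in>B. \<Sum>c\<in>B. (W b + W c) / 2)"
    by (simp add: sum.cartesian_product case_prod_beta)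
  also have "\<dots> = real (card B) * (\<Sum>b\<in>B. W b)"
    by (simp add: add_divide_distrib sum.distrib flip: sum_distrib_left sum_divide_distrib)
  finally show ?thesis unfolding W_def .
qed

inductive trig_poly :: "'a::real_inner set \<Rightarrow> ('a \<Rightarrow> complex) \<Rightarrow> bool" for A where
  trig_poly_zero: "trig_poly A (\<lambda>p. 0)"
| trig_poly_step: "trig_poly A f \<Longrightarrow> \<xi> \<in> A \<Longrightarrow> trig_poly A (\<lambda>p. f p + c * cis (\<xi> \<bullet> p))"

lemma trig_poly_add:
  assumes "trig_poly A f" "trig_poly A g"
  shows "trig_poly A (\<lambda>p. f p + g p)"
  using assms(2)
proof induction
  case (trig_poly_step g \<xi> c)
  then show ?case
    using trig_poly.trig_poly_step[of A "\<lambda>p. f p + g p" \<xi> c] by (simp add: add.assoc)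
qed (use assms in simp)

lemma trig_poly_cis: "\<xi> \<in> A \<Longrightarrow> trig_poly A (\<lambda>p. c * cis (\<xi> \<bullet> p))"
  using trig_poly_step[OF trig_poly_zero, of \<xi> A c] by simp

lemma trig_poly_sum: "(\<And>i. i \<in> I \<Longrightarrow> trig_poly A (f i)) \<Longrightarrow> trig_poly A (\<lambda>p. \<Sum>i\<in>I. f i p)"
  by (induction I rule: infinite_finite_induct) (auto intro: trig_poly_zero trig_poly_add)

lemma trig_poly_mult_cis:
  assumes "trig_poly A f" "\<eta> \<in> B"
  shows "trig_poly (A + B) (\<lambda>p. f p * (c * cis (\<eta> \<bullet> p)))"
  using assms(1)
proof induction
  case (trig_poly_step f \<xi> d)
  have "trig_poly (A + B) (\<lambda>p. (d * c) * cis ((\<xi> + \<eta>) \<bullet> p))"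
    by (intro trig_poly_cis set_plus_intro trig_poly_step.hyps(2) assms(2))
  from trig_poly_add[OF trig_poly_step.IH this] show ?case
    by (simp add: inner_add_left cis_mult[symmetric] algebra_simps)
qed (auto intro: trig_poly_zero)

lemma trig_poly_mult:
  assumes "trig_poly A f" "trig_poly B g"
  shows "trig_poly (A + B) (\<lambda>p. f p * g p)"
  using assms(2)
proof induction
  case (trig_poly_step g \<xi> c)
  from trig_poly_add[OF trig_poly_step.IH trig_poly_mult_cis[OF assms(1) trig_poly_step.hyps(2)], of c]
  show ?case by (simp add: distrib_left)
qed (auto intro: trig_poly_zero)

lemma trig_poly_mono: "trig_poly A f \<Longrightarrow> A \<subseteq> B \<Longrightarrow> trig_poly B f"
  by (induction rule: trig_poly.induct) (auto intro: trig_poly.intros)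

lemma trig_poly_bcontfun: "trig_poly A f \<Longrightarrow> f \<in> bcontfun"
  by (induction rule: trig_poly.induct) (auto intro: bcontfun_intros)

text \<open>Functions whose spectrum is contained in \<open>A\<close>, described without Fourier transforms as
  bounded pointwise limits of trigonometric polynomials with frequencies in \<open>A\<close>.\<close>
definition band_limited :: "'a::real_inner set \<Rightarrow> ('a \<Rightarrow> complex) \<Rightarrow> bool" where
  "band_limited A f \<longleftrightarrow> f \<in> bcontfun \<and> (\<exists>g C. (\<forall>n::nat. trig_poly A (g n)) \<and>
     (\<forall>n p. norm (g n p) \<le> C) \<and> (\<forall>p. (\<lambda>n. g n p) \<longlonglongrightarrow> f p))"

lemma band_limited_bcontfun: "band_limited A f \<Longrightarrow> f \<in> bcontfun"
  by (simp add: band_limited_def)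

lemma band_limited_mono: "band_limited A f \<Longrightarrow> A \<subseteq> B \<Longrightarrow> band_limited B f"
  unfolding band_limited_def using trig_poly_mono by blast

lemma band_limited_add:
  assumes "band_limited A f" "band_limited A g"
  shows "band_limited A (\<lambda>p. f p + g p)"
proof -
  obtain f' C where f: "\<And>n. trig_poly A (f' n)" "\<And>n p. norm (f' n p) \<le> C" "\<And>p. (\<lambda>n. f' n p) \<longlonglongrightarrow> f p"
    using assms(1) unfolding band_limited_def by blast
  obtain g' D where g: "\<And>n. trig_poly A (g' n)" "\<And>n p. norm (g' n p) \<le> D" "\<And>p. (\<lambda>n. g' n p) \<longlonglongrightarrow> g p"
    using assms(2) unfolding band_limited_def by blast
  have "norm (f' n p + g' n p) \<le> C + D" for n p
    using f(2)[of n p] g(2)[of n p] norm_triangle_ineq[of "f' n p" "g' n p"] by linarith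
  then show ?thesis
    unfolding band_limited_def using assms f g
    by (intro conjI exI[of _ "\<lambda>n p. f' n p + g' n p"] exI[of _ "C + D"])
      (auto intro!: plus_cont trig_poly_add tendsto_add dest: band_limited_bcontfun)
qed

lemma band_limited_mult:
  assumes "band_limited A f" "band_limited B g"
  shows "band_limited (A + B) (\<lambda>p. f p * g p)"
proof -
  obtain f' C where f: "\<And>n. trig_poly A (f' n)" "\<And>n p. norm (f' n p) \<le> C" "\<And>p. (\<lambda>n. f' n p) \<longlonglongrightarrow> f p"
    using assms(1) unfolding band_limited_def by blast
  obtain g' D where g: "\<And>n. trig_poly B (g' n)" "\<And>n p. norm (g' n p) \<le> D" "\<And>p. (\<lambda>n. g' n p) \<longlonglongrightarrow> g p"
    using assms(2) unfolding band_limited_def by blast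
  have "norm (f' n p) * norm (g' n p) \<le> C * D" for n p
    by (intro mult_mono f(2) g(2) norm_ge_zero order_trans[OF norm_ge_zero f(2)[of 0 0]])
  then have "\<forall>n p. norm (f' n p * g' n p) \<le> C * D"
    by (simp add: norm_mult)
  moreover have "\<forall>n. trig_poly (A + B) (\<lambda>p. f' n p * g' n p)"
    using trig_poly_mult[OF f(1) g(1)] by blast
  moreover have "\<forall>p. (\<lambda>n. f' n p * g' n p) \<longlonglongrightarrow> f p * g p"
    using tendsto_mult[OF f(3) g(3)] by blast
  ultimately show ?thesis
    unfolding band_limited_def
    using bcontfun_mult[OF band_limited_bcontfun[OF assms(1)] band_limited_bcontfun[OF assms(2)]]
    by (intro conjI exI[of _ "\<lambda>n p. f' n p * g' n p"] exI[of _ "C * D"])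
qed

lemma trig_poly_band_limited:
  assumes "trig_poly A f"
  shows "band_limited A f"
proof -
  have continuous: "f \<in> bcontfun" by (rule trig_poly_bcontfun[OF assms])
  then obtain C where "\<forall>p. norm (f p) \<le> C"
    by (auto simp: bcontfun_def bounded_iff)
  with assms continuous show ?thesis
    unfolding band_limited_def by (intro conjI exI[of _ "\<lambda>n. f"] exI[of _ C]) auto
qed

lemma band_limited_sum:
  "(\<And>i. i \<in> I \<Longrightarrow> band_limited A (f i)) \<Longrightarrow> band_limited A (\<lambda>p. \<Sum>i\<in>I. f i p)"
  by (induction I rule: infinite_finite_induct)
    (auto intro: band_limited_add trig_poly_band_limited trig_poly_zero)

lemma band_limited_cmult:
  assumes "band_limited A f"
  shows "band_limited A (\<lambda>p. c * f p)"
proof -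
  have "band_limited {0} (\<lambda>p. c * cis (0 \<bullet> p))"
    by (intro trig_poly_band_limited trig_poly_cis) simp
  from band_limited_mult[OF this assms] show ?thesis
    by (simp add: set_zero[symmetric] del: set_zero)
qed

lemma weighted_inner_cis_eq_0:
  assumes \<tau>: "\<tau> > 0" and "trig_poly A f" and far: "\<And>\<xi>. \<xi> \<in> A \<Longrightarrow> \<not> near \<tau> (\<xi> - \<eta>)"
  shows "weighted_inner \<tau> f (\<lambda>p. d * cis (\<eta> \<bullet> p)) = 0"
  using assms(2)
proof induction
  case (trig_poly_step f \<xi> c)
  have "(f p + c * cis (\<xi> \<bullet> p)) * cnj (d * cis (\<eta> \<bullet> p)) * complex_of_real (weight \<tau> p)
      = f p * cnj (d * cis (\<eta> \<bullet> p)) * complex_of_real (weight \<tau> p)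
        + (c * cnj d) * (cis ((\<xi> - \<eta>) \<bullet> p) * complex_of_real (weight \<tau> p))" for p
  proof -
    have "cis ((\<xi> - \<eta>) \<bullet> p) = cis (\<xi> \<bullet> p) * cis (- (\<eta> \<bullet> p))"
      by (simp add: inner_diff_left cis_mult)
    then show ?thesis by (simp add: cis_cnj algebra_simps del: cis_mult)
  qed
  moreover have "integrable lborel (\<lambda>p. f p * cnj (d * cis (\<eta> \<bullet> p)) * complex_of_real (weight \<tau> p))"
    by (intro integrable_weighted_inner \<tau> trig_poly_bcontfun[OF trig_poly_step.hyps(1)] bcontfun_intros)
  ultimately show ?case
    using trig_poly_step.IH integrable_cis_weight[OF \<tau>, of "\<xi> - \<eta>"]
      integral_cis_weight_eq_0[OF \<tau> far[OF trig_poly_step.hyps(2)]]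
    unfolding weighted_inner_def by simp
qed (simp add: weighted_inner_def)

lemma weighted_inner_trig_poly_eq_0:
  assumes \<tau>: "\<tau> > 0" and f: "trig_poly A f" and "trig_poly B g"
    and far: "\<And>\<xi> \<eta>. \<xi> \<in> A \<Longrightarrow> \<eta> \<in> B \<Longrightarrow> \<not> near \<tau> (\<xi> - \<eta>)"
  shows "weighted_inner \<tau> f g = 0"
  using assms(3)
proof induction
  case (trig_poly_step g \<eta> d)
  have "integrable lborel (\<lambda>p. f p * cnj (g p) * complex_of_real (weight \<tau> p))"
    "integrable lborel (\<lambda>p. f p * cnj (d * cis (\<eta> \<bullet> p)) * complex_of_real (weight \<tau> p))"
    by (intro integrable_weighted_inner \<tau> trig_poly_bcontfun[OF f]
        trig_poly_bcontfun[OF trig_poly_step.hyps(1)] bcontfun_intros)+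
  then show ?case
    using trig_poly_step.IH weighted_inner_cis_eq_0[OF \<tau> f far[OF _ trig_poly_step.hyps(2)], of d]
    unfolding weighted_inner_def by (simp add: distrib_left distrib_right)
qed (simp add: weighted_inner_def)

lemma weighted_inner_eq_0_if_far:
  fixes f g :: "'a::euclidean_space \<Rightarrow> complex"
  assumes \<tau>: "\<tau> > 0" and f: "band_limited A f" and g: "band_limited B g"
    and far: "\<And>\<xi> \<eta>. \<xi> \<in> A \<Longrightarrow> \<eta> \<in> B \<Longrightarrow> \<not> near \<tau> (\<xi> - \<eta>)"
  shows "weighted_inner \<tau> f g = 0"
proof -
  obtain f' C where f': "\<And>n. trig_poly A (f' n)" "\<And>n p. norm (f' n p) \<le> C" "\<And>p. (\<lambda>n. f' n p) \<longlonglongrightarrow> f p"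
    using f unfolding band_limited_def by blast
  obtain g' D where g': "\<And>n. trig_poly B (g' n)" "\<And>n p. norm (g' n p) \<le> D" "\<And>p. (\<lambda>n. g' n p) \<longlonglongrightarrow> g p"
    using g unfolding band_limited_def by blast
  have "(\<lambda>n. weighted_inner \<tau> (f' n) (g' n)) \<longlonglongrightarrow> weighted_inner \<tau> f g"
    unfolding weighted_inner_def
  proof (rule integral_dominated_convergence[where w="\<lambda>p. C * D * weight \<tau> p"])
    show "integrable lborel (\<lambda>p::'a. C * D * weight \<tau> p)"
      by (intro integrable_mult_right integrable_weight \<tau>)
    show "(\<lambda>p. f' n p * cnj (g' n p) * complex_of_real (weight \<tau> p)) \<in> borel_measurable lborel" for n
      by (intro borel_measurable_integrable integrable_weighted_inner \<tau> trig_poly_bcontfun[OF f'(1)] trig_poly_bcontfun[OF g'(1)])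
    show "(\<lambda>p. f p * cnj (g p) * complex_of_real (weight \<tau> p)) \<in> borel_measurable lborel"
      by (intro borel_measurable_integrable integrable_weighted_inner \<tau> band_limited_bcontfun[OF f] band_limited_bcontfun[OF g])
    show "AE p in lborel. (\<lambda>n. f' n p * cnj (g' n p) * complex_of_real (weight \<tau> p))
        \<longlonglongrightarrow> f p * cnj (g p) * complex_of_real (weight \<tau> p)"
      using f'(3) g'(3) by (auto intro!: tendsto_intros)
    have "norm (f' n p) * norm (g' n p) * weight \<tau> p \<le> C * D * weight \<tau> p" for n p
      by (intro mult_right_mono mult_mono f'(2) g'(2) norm_ge_zero weight_nonneg
          order_trans[OF norm_ge_zero f'(2)[of 0 0]])
    then show "AE p in lborel. norm (f' n p * cnj (g' n p) * complex_of_real (weight \<tau> p)) \<le> C * D * weight \<tau> p" for n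
      by (simp add: norm_mult)
  qed
  then show ?thesis
    using weighted_inner_trig_poly_eq_0[OF \<tau> f'(1) g'(1) far] by (simp add: LIMSEQ_const_iff)
qed

section \<open>Counting large values\<close>

definition cube :: "'a::euclidean_space \<Rightarrow> real \<Rightarrow> 'a set" where
  "cube a \<rho> = cbox (a - \<rho> *\<^sub>R One) (a + \<rho> *\<^sub>R One)"

lemma mem_cube: "p \<in> cube a \<rho> \<longleftrightarrow> (\<forall>b\<in>Basis. \<bar>(p - a) \<bullet> b\<bar> \<le> \<rho>)"
  by (auto simp: cube_def mem_box inner_diff_left inner_add_left abs_le_iff algebra_simps)

lemma mem_cube_commute: "p \<in> cube a \<rho> \<longleftrightarrow> a \<in> cube p \<rho>"
  by (simp add: mem_cube inner_diff_left abs_minus_commute)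

lemma cube_mono: "\<rho> \<le> \<sigma> \<Longrightarrow> cube a \<rho> \<subseteq> cube a \<sigma>"
  by (meson subsetI mem_cube order_trans)

lemma cube_triangle:
  fixes p q a :: "'a::euclidean_space"
  assumes "p \<in> cube a r" "q \<in> cube a r"
  shows "p \<in> cube q (r + r)"
  unfolding mem_cube
proof
  fix b :: 'a assume "b \<in> Basis"
  then have "\<bar>(p - a) \<bullet> b\<bar> \<le> r" "\<bar>(q - a) \<bullet> b\<bar> \<le> r" using assms by (auto simp: mem_cube)
  then show "\<bar>(p - q) \<bullet> b\<bar> \<le> r + r" by (simp add: inner_diff_left)
qed

lemma weight_ge_on_cube:
  fixes p :: "'a::euclidean_space"
  assumes "0 \<le> \<tau>" "\<tau> * M \<le> 1/4" "p \<in> cube 0 M"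
  shows "(1/2) ^ DIM('a) \<le> weight \<tau> p"
proof (rule weight_ge)
  fix b :: 'a assume "b \<in> Basis"
  then have "\<tau> * \<bar>p \<bullet> b\<bar> \<le> \<tau> * M"
    using assms by (intro mult_left_mono) (auto simp: mem_cube)
  then show "\<bar>\<tau> * (p \<bullet> b)\<bar> \<le> 1/4"
    using assms by (simp add: abs_mult)
qed

lemma has_bochner_integral_indicator_cube:
  fixes a :: "'a::euclidean_space"
  assumes "0 \<le> \<rho>"
  shows "has_bochner_integral lborel (indicator (cube a \<rho>)) ((2 * \<rho>) ^ DIM('a))"
proof -
  have "measure lborel (cube a \<rho>) = (2 * \<rho>) ^ DIM('a)"
    using assms by (simp add: cube_def measure_lborel_cbox_eq inner_add_left inner_diff_left)
  then show ?thesis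
    using has_bochner_integral_real_indicator[of "cube a \<rho>" lborel]
      emeasure_lborel_cbox_finite[of "a - \<rho> *\<^sub>R One" "a + \<rho> *\<^sub>R One"]
    by (simp add: cube_def)
qed

lemma card_large_values_le:
  fixes P :: "'a::euclidean_space set" and f :: "'a \<Rightarrow> 'b::real_normed_vector"
  assumes P: "finite P" "P \<subseteq> cube 0 Y" and \<tau>: "0 < \<tau>" "\<tau> * (Y + \<eta>) \<le> 1/4"
    and f: "f \<in> bcontfun" and \<eta>: "0 \<le> \<eta>" and t: "0 \<le> t"
    and large: "\<And>p x. p \<in> P \<Longrightarrow> x \<in> cube p \<eta> \<Longrightarrow> t \<le> norm (f x)"
    and sparse: "\<And>x. real (card (P \<inter> cube x \<eta>)) \<le> N"
  shows "real (card P) * (\<eta> ^ DIM('a) * t ^ n) \<le> N * weighted_integral \<tau> (\<lambda>x. norm (f x) ^ n)"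
proof -
  define c where "c = t ^ n * (1/2) ^ DIM('a)"
  have N: "0 \<le> N" using sparse[of 0] by linarith
  have pointwise: "(\<Sum>p\<in>P. indicator (cube p \<eta>) x * c) \<le> N * (norm (f x) ^ n * weight \<tau> x)" for x
  proof (cases "P \<inter> cube x \<eta> = {}")
    case True
    then have "(\<Sum>p\<in>P. indicator (cube p \<eta>) x * c) = 0"
      by (intro sum.neutral) (auto simp: indicator_def mem_cube_commute[of x])
    then show ?thesis using N by simp
  next
    case False
    then obtain p where p: "p \<in> P" "x \<in> cube p \<eta>" by (auto simp: mem_cube_commute[of x])
    have "\<bar>x \<bullet> b\<bar> \<le> Y + \<eta>" if "b \<in> Basis" for b
      using p P(2) that abs_triangle_ineq[of "p \<bullet> b" "(x - p) \<bullet> b"]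
      by (force simp: mem_cube inner_diff_left)
    then have "x \<in> cube 0 (Y + \<eta>)" by (simp add: mem_cube)
    then have c_le: "c \<le> norm (f x) ^ n * weight \<tau> x"
      unfolding c_def using \<tau> t large[OF p]
      by (intro mult_mono power_mono weight_ge_on_cube[of \<tau> "Y + \<eta>"]) auto
    have "(\<Sum>p\<in>P. indicator (cube p \<eta>) x * c) = (\<Sum>p\<in>P \<inter> cube x \<eta>. c)"
      using P(1) by (intro sum.mono_neutral_cong_right) (auto simp: mem_cube_commute[of x])
    also have "\<dots> \<le> N * (norm (f x) ^ n * weight \<tau> x)"
      using sparse[of x] c_le t by (simp add: mult_mono c_def)
    finally show ?thesis .
  qed
  have cubes: "has_bochner_integral lborel (\<lambda>x. \<Sum>p\<in>P. indicator (cube p \<eta>) x * c)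
      (\<Sum>p\<in>P. (2 * \<eta>) ^ DIM('a) * c)"
    by (intro has_bochner_integral_sum has_bochner_integral_mult_left
        has_bochner_integral_indicator_cube \<eta>)
  have "real (card P) * (\<eta> ^ DIM('a) * t ^ n) = (\<Sum>p\<in>P. (2 * \<eta>) ^ DIM('a) * c)"
    by (simp add: c_def power_mult_distrib power_divide)
  also have "\<dots> = (\<integral>x. (\<Sum>p\<in>P. indicator (cube p \<eta>) x * c) \<partial>lborel)"
    by (rule has_bochner_integral_integral_eq[OF cubes, symmetric])
  also have "\<dots> \<le> (\<integral>x. N * (norm (f x) ^ n * weight \<tau> x) \<partial>lborel)"
    by (intro integral_mono pointwise integrable_mult_right integrable_mult_weight \<tau>
        bcontfun_norm_power f integrable.intros[OF cubes])
  finally show ?thesis by (simp add: weighted_integral_def)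
qed

section \<open>Wave packets\<close>

definition modulated_fejer :: "real \<Rightarrow> real \<Rightarrow> real \<Rightarrow> complex" where
  "modulated_fejer v h z = cis (v * z) * complex_of_real (fejer (h * z))"

lemma norm_modulated_fejer: "norm (modulated_fejer v h z) = fejer (h * z)"
  by (simp add: modulated_fejer_def norm_mult)

lemma norm_modulated_fejer_le: "norm (modulated_fejer v h z) \<le> 4 / (1 + (h * z)\<^sup>2)"
  by (simp add: norm_modulated_fejer fejer_decay)

lemma fejer_scaled_lipschitz:
  assumes "0 \<le> h" "\<bar>z - z'\<bar> \<le> e" "h * e \<le> 1"
  shows "\<bar>fejer (h * z) - fejer (h * z')\<bar> \<le> 18 * (h * e) / (1 + (h * z)\<^sup>2)"
proof -
  have scaled_diff: "\<bar>h * z - h * z'\<bar> \<le> h * e"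
    using mult_left_mono[OF assms(2,1)] assms(1) by (simp add: right_diff_distrib[symmetric] abs_mult)
  then have "\<bar>fejer (h * z) - fejer (h * z')\<bar> \<le> 18 * \<bar>h * z - h * z'\<bar> / (1 + (h * z)\<^sup>2)"
    using assms by (intro fejer_lipschitz_decay) linarith
  also have "\<dots> \<le> 18 * (h * e) / (1 + (h * z)\<^sup>2)"
    using scaled_diff by (intro divide_right_mono mult_left_mono) auto
  finally show ?thesis .
qed

lemma norm_modulated_fejer_nearby_le:
  assumes "0 \<le> h" "\<bar>z - z'\<bar> \<le> e" "h * e \<le> 1"
  shows "norm (modulated_fejer v h z') \<le> 22 / (1 + (h * z)\<^sup>2)"
proof -
  have "18 * (h * e) / (1 + (h * z)\<^sup>2) \<le> 18 / (1 + (h * z)\<^sup>2)"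
    using assms(3) by (intro divide_right_mono) auto
  then have "fejer (h * z') \<le> 4 / (1 + (h * z)\<^sup>2) + 18 / (1 + (h * z)\<^sup>2)"
    using fejer_scaled_lipschitz[OF assms] fejer_decay[of "h * z"] by linarith
  then show ?thesis
    by (simp add: norm_modulated_fejer add_divide_distrib[symmetric])
qed

lemma modulated_fejer_lipschitz:
  assumes "0 \<le> h" "\<bar>z - z'\<bar> \<le> e" "h * e \<le> 1"
  shows "norm (modulated_fejer v h z - modulated_fejer v h z') \<le> 18 * (\<bar>v\<bar> + h) * e / (1 + (h * z)\<^sup>2)"
proof -
  let ?d = "1 + (h * z)\<^sup>2"
  have "norm (cis (v * z) - cis (v * z')) \<le> \<bar>v\<bar> * e"
    using norm_cis_diff_le[of "v * z" "v * z'"] mult_left_mono[OF assms(2), of "\<bar>v\<bar>"]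
    by (simp add: right_diff_distrib[symmetric] abs_mult)
  then have phase: "norm (cis (v * z) - cis (v * z')) * fejer (h * z) \<le> (\<bar>v\<bar> * e) * (4 / ?d)"
    using assms(2) by (intro mult_mono fejer_decay) auto
  have "modulated_fejer v h z - modulated_fejer v h z' =
      (cis (v * z) - cis (v * z')) * of_real (fejer (h * z))
      + cis (v * z') * of_real (fejer (h * z) - fejer (h * z'))"
    by (simp add: modulated_fejer_def algebra_simps)
  then have "norm (modulated_fejer v h z - modulated_fejer v h z')
      \<le> norm (cis (v * z) - cis (v * z')) * fejer (h * z) + \<bar>fejer (h * z) - fejer (h * z')\<bar>"
    using norm_triangle_ineq[of "(cis (v * z) - cis (v * z')) * of_real (fejer (h * z))"
        "cis (v * z') * complex_of_real (fejer (h * z) - fejer (h * z'))"]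
    by (simp only: norm_mult norm_of_real norm_cis mult_1 abs_of_nonneg[OF fejer_nonneg])
  also have "\<dots> \<le> (\<bar>v\<bar> * e) * (4 / ?d) + 18 * (h * e) / ?d"
    by (intro add_mono phase fejer_scaled_lipschitz assms)
  also have "\<dots> = (4 * \<bar>v\<bar> * e + 18 * h * e) / ?d"
    by (simp add: add_divide_distrib mult_ac)
  also have "\<dots> \<le> 18 * (\<bar>v\<bar> + h) * e / ?d"
    using assms(2) by (intro divide_right_mono) (auto simp: algebra_simps intro!: mult_right_mono)
  finally show ?thesis .
qed

lemma band_limited_sinc_fun:
  fixes \<theta> :: "'a::euclidean_space"
  assumes "0 \<le> h"
  shows "band_limited {t *\<^sub>R \<theta> |t. \<bar>t\<bar> \<le> h} (\<lambda>p. complex_of_real (sinc_fun (h * (\<theta> \<bullet> p - a))))"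
  unfolding band_limited_def
proof (intro conjI exI[of _ "\<lambda>K p. dirichlet_mean K (h * (\<theta> \<bullet> p - a))"] exI[of _ 1] allI)
  show "(\<lambda>p. complex_of_real (sinc_fun (h * (\<theta> \<bullet> p - a)))) \<in> bcontfun"
    using abs_sinc_fun_le_1 by (intro bcontfun_normI[of _ 1]) (auto intro!: continuous_intros)
  fix K :: nat
  have dirichlet: "dirichlet_mean K (h * (\<theta> \<bullet> p - a)) =
      (\<Sum>j<K. cis (- (dirichlet_node K j * h * a)) / of_nat K * cis (((dirichlet_node K j * h) *\<^sub>R \<theta>) \<bullet> p))" for p
  proof -
    have "cis (t * (h * (\<theta> \<bullet> p - a))) = cis (- (t * h * a)) * cis (((t * h) *\<^sub>R \<theta>) \<bullet> p)" for t
      by (simp add: cis_mult algebra_simps)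
    then show ?thesis
      unfolding dirichlet_mean_def sum_divide_distrib
      by (intro sum.cong refl) (simp only: times_divide_eq_left[symmetric])
  qed
  show "trig_poly {t *\<^sub>R \<theta> |t. \<bar>t\<bar> \<le> h} (\<lambda>p. dirichlet_mean K (h * (\<theta> \<bullet> p - a)))"
    unfolding dirichlet
  proof (intro trig_poly_sum trig_poly_cis CollectI exI conjI)
    show "\<bar>dirichlet_node K j * h\<bar> \<le> h" if "j \<in> {..<K}" for j
      using abs_dirichlet_node_le_1[of j K] that assms mult_right_mono[of "\<bar>dirichlet_node K j\<bar>" 1 h]
      by (simp add: abs_mult)
  qed (rule refl)
qed (auto simp: norm_dirichlet_mean_le_1 dirichlet_mean_tendsto)

lemma band_limited_modulated_fejer:
  fixes \<theta> :: "'a::euclidean_space"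
  assumes "0 \<le> h"
  shows "band_limited {t *\<^sub>R \<theta> |t. \<bar>t - v\<bar> \<le> 2 * h} (\<lambda>p. modulated_fejer v h (\<theta> \<bullet> p - a))"
proof -
  let ?segment = "{t *\<^sub>R \<theta> |t. \<bar>t\<bar> \<le> h}"
  have carrier: "band_limited {v *\<^sub>R \<theta>} (\<lambda>p. cis (- (v * a)) * cis ((v *\<^sub>R \<theta>) \<bullet> p))"
    by (intro trig_poly_band_limited trig_poly_cis) simp
  have factor: "modulated_fejer v h (\<theta> \<bullet> p - a) = cis (- (v * a)) * cis ((v *\<^sub>R \<theta>) \<bullet> p) *
      (complex_of_real (sinc_fun (h * (\<theta> \<bullet> p - a))) * complex_of_real (sinc_fun (h * (\<theta> \<bullet> p - a))))" for p
    by (simp add: modulated_fejer_def fejer_def power2_eq_square cis_mult right_diff_distrib)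
  have "band_limited ({v *\<^sub>R \<theta>} + (?segment + ?segment)) (\<lambda>p. modulated_fejer v h (\<theta> \<bullet> p - a))"
    unfolding factor by (intro band_limited_mult carrier band_limited_sinc_fun assms)
  moreover have "{v *\<^sub>R \<theta>} + (?segment + ?segment) \<subseteq> {t *\<^sub>R \<theta> |t. \<bar>t - v\<bar> \<le> 2 * h}"
  proof
    fix \<xi> assume "\<xi> \<in> {v *\<^sub>R \<theta>} + (?segment + ?segment)"
    then obtain s t where st: "\<bar>s\<bar> \<le> h" "\<bar>t\<bar> \<le> h" "\<xi> = v *\<^sub>R \<theta> + (s *\<^sub>R \<theta> + t *\<^sub>R \<theta>)"
      by (auto simp: set_plus_def)
    then have "\<xi> = (v + (s + t)) *\<^sub>R \<theta>" "\<bar>(v + (s + t)) - v\<bar> \<le> 2 * h"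
      by (auto simp: scaleR_add_left)
    then show "\<xi> \<in> {t *\<^sub>R \<theta> |t. \<bar>t - v\<bar> \<le> 2 * h}" by blast
  qed
  ultimately show ?thesis by (rule band_limited_mono)
qed

type_synonym pt = "real \<times> real \<times> real"

text \<open>The light ray of direction \<open>y\<close> on the cone \<open>{(a, b, c). 4 a b + c\<^sup>2 = 0}\<close>, and its tangential
  derivative. A point \<open>p = (B, C, W)\<close> encodes the line \<open>y \<mapsto> (x, t) = (W + C y, W y - B)\<close>, whose
  intercepts are \<open>x = cone_tangent y \<bullet> p\<close> and \<open>t + y x = cone_ray y \<bullet> p\<close>.\<close>
definition cone_ray :: "real \<Rightarrow> pt" where
  "cone_ray y = (-1, y\<^sup>2, 2 * y)"

definition cone_tangent :: "real \<Rightarrow> pt" where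
  "cone_tangent y = (0, y, 1)"

definition plank :: "real \<Rightarrow> real \<Rightarrow> real \<Rightarrow> real \<Rightarrow> real \<Rightarrow> pt set" where
  "plank v h r g y = {s *\<^sub>R cone_ray y + t *\<^sub>R cone_tangent y |s t. \<bar>s - v\<bar> \<le> 2 * h \<and> \<bar>t - r\<bar> \<le> 2 * g}"

text \<open>The cell \<open>(m, l)\<close> in the layer \<open>y\<close> is centred at \<open>(x, t) = (m \<delta>, l \<delta>)\<close>.\<close>
definition ray_offset :: "real \<Rightarrow> real \<Rightarrow> int \<times> int \<Rightarrow> pt \<Rightarrow> real" where
  "ray_offset \<delta> y c p = cone_ray y \<bullet> p - (of_int (snd c) * \<delta> + y * (of_int (fst c) * \<delta>))"

definition tangent_offset :: "real \<Rightarrow> real \<Rightarrow> int \<times> int \<Rightarrow> pt \<Rightarrow> real" where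
  "tangent_offset \<delta> y c p = cone_tangent y \<bullet> p - of_int (fst c) * \<delta>"

definition packet :: "real \<Rightarrow> real \<Rightarrow> real \<Rightarrow> real \<Rightarrow> real \<Rightarrow> real \<Rightarrow> int \<times> int \<Rightarrow> pt \<Rightarrow> complex" where
  "packet \<delta> v h r g y c p =
     modulated_fejer v h (ray_offset \<delta> y c p) * modulated_fejer r g (tangent_offset \<delta> y c p)"

definition layer :: "real \<Rightarrow> real \<Rightarrow> real \<Rightarrow> real \<Rightarrow> real \<Rightarrow> real \<Rightarrow> (int \<times> int) set \<Rightarrow> pt \<Rightarrow> complex" where
  "layer \<delta> v h r g y S p = complex_of_real (\<delta> ^ 3 * h * g) * (\<Sum>c\<in>S. packet \<delta> v h r g y c p)"

lemma band_limited_packet: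
  assumes "0 \<le> h" "0 \<le> g"
  shows "band_limited (plank v h r g y) (packet \<delta> v h r g y c)"
  unfolding packet_def[abs_def] ray_offset_def tangent_offset_def
  by (rule band_limited_mono[OF band_limited_mult[OF band_limited_modulated_fejer[OF assms(1)]
          band_limited_modulated_fejer[OF assms(2)]]])
    (unfold plank_def set_plus_def, blast)

lemma band_limited_layer:
  assumes "0 \<le> h" "0 \<le> g"
  shows "band_limited (plank v h r g y) (layer \<delta> v h r g y S)"
  unfolding layer_def[abs_def] by (intro band_limited_cmult band_limited_sum band_limited_packet assms)

definition packet_decay :: "real \<Rightarrow> real \<Rightarrow> real \<Rightarrow> real \<Rightarrow> int \<times> int \<Rightarrow> pt \<Rightarrow> real" where
  "packet_decay \<delta> h g y c p =
     1 / (1 + (h * ray_offset \<delta> y c p)\<^sup>2) * (1 / (1 + (g * tangent_offset \<delta> y c p)\<^sup>2))"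

lemma packet_decay_nonneg: "0 \<le> packet_decay \<delta> h g y c p"
  by (simp add: packet_decay_def add_nonneg_nonneg)

lemma sum_packet_decay_le:
  assumes "finite S" "0 < h" "0 < g" "0 < \<delta>" "h * \<delta> \<le> 1" "g * \<delta> \<le> 1"
  shows "(\<Sum>c\<in>S. packet_decay \<delta> h g y c p) \<le> 100 / (h * g * \<delta>\<^sup>2)"
proof -
  let ?ray = "\<lambda>m n. 1 / (1 + (h * (cone_ray y \<bullet> p - y * (of_int m * \<delta>) - of_int n * \<delta>))\<^sup>2)"
  let ?tangent = "\<lambda>m. 1 / (1 + (g * (cone_tangent y \<bullet> p - of_int m * \<delta>))\<^sup>2)"
  have decay: "packet_decay \<delta> h g y c p = ?ray (fst c) (snd c) * ?tangent (fst c)" for c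
    by (simp add: packet_decay_def ray_offset_def tangent_offset_def diff_diff_eq add.commute)
  have "(\<Sum>c\<in>S. packet_decay \<delta> h g y c p) \<le> (\<Sum>c\<in>fst ` S \<times> snd ` S. packet_decay \<delta> h g y c p)"
    using assms(1) packet_decay_nonneg
    by (intro sum_mono2 finite_cartesian_product finite_imageI subset_fst_snd) auto
  also have "\<dots> = (\<Sum>m\<in>fst ` S. \<Sum>n\<in>snd ` S. ?ray m n * ?tangent m)"
    unfolding decay by (subst sum.cartesian_product) (simp add: case_prod_beta)
  also have "\<dots> = (\<Sum>m\<in>fst ` S. (\<Sum>n\<in>snd ` S. ?ray m n) * ?tangent m)"
    by (simp only: sum_distrib_right)
  also have "\<dots> \<le> (\<Sum>m\<in>fst ` S. 10 / (h * \<delta>) * ?tangent m)"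
    using assms by (intro sum_mono mult_right_mono lattice_decay_sum_le) (auto simp: add_nonneg_nonneg)
  also have "\<dots> = 10 / (h * \<delta>) * (\<Sum>m\<in>fst ` S. ?tangent m)"
    by (simp only: sum_distrib_left)
  also have "\<dots> \<le> 10 / (h * \<delta>) * (10 / (g * \<delta>))"
    using assms by (intro mult_left_mono lattice_decay_sum_le) auto
  also have "\<dots> = 100 / (h * g * \<delta>\<^sup>2)"
    by (simp add: power2_eq_square mult_ac)
  finally show ?thesis .
qed

lemma norm_packet_le: "norm (packet \<delta> v h r g y c p) \<le> 16 * packet_decay \<delta> h g y c p"
proof -
  have "norm (packet \<delta> v h r g y c p)
      \<le> (4 / (1 + (h * ray_offset \<delta> y c p)\<^sup>2)) * (4 / (1 + (g * tangent_offset \<delta> y c p)\<^sup>2))"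
    unfolding packet_def norm_mult
    by (intro mult_mono norm_modulated_fejer_le) (auto simp: add_nonneg_nonneg)
  then show ?thesis by (simp add: packet_decay_def)
qed

lemma packet_lipschitz:
  assumes "0 \<le> h" "0 \<le> g"
    and close: "\<bar>cone_ray y \<bullet> p - cone_ray y \<bullet> p'\<bar> \<le> e" "\<bar>cone_tangent y \<bullet> p - cone_tangent y \<bullet> p'\<bar> \<le> e"
    and X: "\<bar>v\<bar> + h + \<bar>r\<bar> + g \<le> X" "X * e \<le> 1"
  shows "norm (packet \<delta> v h r g y c p - packet \<delta> v h r g y c p') \<le> 400 * X * e * packet_decay \<delta> h g y c p"
proof -
  let ?k = "modulated_fejer v h (ray_offset \<delta> y c p)" and ?k' = "modulated_fejer v h (ray_offset \<delta> y c p')"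
  let ?l = "modulated_fejer r g (tangent_offset \<delta> y c p)"
  let ?l' = "modulated_fejer r g (tangent_offset \<delta> y c p')"
  let ?a = "1 + (h * ray_offset \<delta> y c p)\<^sup>2" and ?b = "1 + (g * tangent_offset \<delta> y c p)\<^sup>2"
  have e: "0 \<le> e" using close by linarith
  have "h * e \<le> X * e" "g * e \<le> X * e"
    using X(1) assms(1,2) e by (auto intro!: mult_right_mono)
  then have scaled: "h * e \<le> 1" "g * e \<le> 1" using X by auto
  have offsets: "\<bar>ray_offset \<delta> y c p - ray_offset \<delta> y c p'\<bar> \<le> e"
    "\<bar>tangent_offset \<delta> y c p - tangent_offset \<delta> y c p'\<bar> \<le> e"
    using close by (simp_all add: ray_offset_def tangent_offset_def)
  have "packet \<delta> v h r g y c p - packet \<delta> v h r g y c p' = (?k - ?k') * ?l + ?k' * (?l - ?l')"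
    by (simp add: packet_def algebra_simps)
  then have "norm (packet \<delta> v h r g y c p - packet \<delta> v h r g y c p')
      \<le> norm (?k - ?k') * norm ?l + norm ?k' * norm (?l - ?l')"
    using norm_triangle_ineq[of "(?k - ?k') * ?l" "?k' * (?l - ?l')"] by (simp only: norm_mult)
  also have "\<dots> \<le> (18 * (\<bar>v\<bar> + h) * e / ?a) * (4 / ?b) + (22 / ?a) * (18 * (\<bar>r\<bar> + g) * e / ?b)"
    using assms(1,2) scaled e
    by (intro add_mono mult_mono norm_modulated_fejer_le modulated_fejer_lipschitz offsets
        norm_modulated_fejer_nearby_le[OF _ offsets(1)]) (auto intro!: divide_nonneg_pos add_pos_nonneg)
  also have "\<dots> = (72 * (\<bar>v\<bar> + h) + 396 * (\<bar>r\<bar> + g)) * e * packet_decay \<delta> h g y c p"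
    by (simp add: packet_decay_def add_divide_distrib[symmetric] algebra_simps)
  also have "\<dots> \<le> (400 * X) * e * packet_decay \<delta> h g y c p"
    using X(1) e assms(1,2) packet_decay_nonneg by (intro mult_right_mono) auto
  finally show ?thesis .
qed

lemma norm_layer_le:
  assumes "finite S" "0 < h" "0 < g" "0 < \<delta>" "h * \<delta> \<le> 1" "g * \<delta> \<le> 1"
  shows "norm (layer \<delta> v h r g y S p) \<le> 1600 * \<delta>"
proof -
  have "norm (layer \<delta> v h r g y S p) = \<delta> ^ 3 * h * g * norm (\<Sum>c\<in>S. packet \<delta> v h r g y c p)"
    unfolding layer_def norm_mult norm_of_real using assms by simp
  also have "\<dots> \<le> \<delta> ^ 3 * h * g * (\<Sum>c\<in>S. 16 * packet_decay \<delta> h g y c p)"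
    using assms by (intro mult_left_mono order_trans[OF norm_sum] sum_mono norm_packet_le) auto
  also have "\<dots> = \<delta> ^ 3 * h * g * (16 * (\<Sum>c\<in>S. packet_decay \<delta> h g y c p))"
    by (simp only: sum_distrib_left)
  also have "\<dots> \<le> \<delta> ^ 3 * h * g * (16 * (100 / (h * g * \<delta>\<^sup>2)))"
    using assms by (intro mult_left_mono sum_packet_decay_le) auto
  also have "\<dots> = 1600 * \<delta>"
    using assms by (simp add: power2_eq_square power3_eq_cube)
  finally show ?thesis .
qed

lemma layer_lipschitz:
  assumes "finite S" "0 < h" "0 < g" "0 < \<delta>" "h * \<delta> \<le> 1" "g * \<delta> \<le> 1"
    and close: "\<bar>cone_ray y \<bullet> p - cone_ray y \<bullet> p'\<bar> \<le> e" "\<bar>cone_tangent y \<bullet> p - cone_tangent y \<bullet> p'\<bar> \<le> e"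
    and X: "\<bar>v\<bar> + h + \<bar>r\<bar> + g \<le> X" "X * e \<le> 1"
  shows "norm (layer \<delta> v h r g y S p - layer \<delta> v h r g y S p') \<le> 40000 * \<delta> * X * e"
proof -
  have nonneg: "0 \<le> e" "0 \<le> X" using close X(1) assms by linarith+
  have "norm (layer \<delta> v h r g y S p - layer \<delta> v h r g y S p')
     = \<delta> ^ 3 * h * g * norm (\<Sum>c\<in>S. packet \<delta> v h r g y c p - packet \<delta> v h r g y c p')"
    unfolding layer_def right_diff_distrib[symmetric] sum_subtractf[symmetric] norm_mult norm_of_real
    using assms by simp
  also have "\<dots> \<le> \<delta> ^ 3 * h * g * (\<Sum>c\<in>S. 400 * X * e * packet_decay \<delta> h g y c p)"
    using assms by (intro mult_left_mono order_trans[OF norm_sum] sum_mono packet_lipschitz) auto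
  also have "\<dots> = \<delta> ^ 3 * h * g * (400 * X * e * (\<Sum>c\<in>S. packet_decay \<delta> h g y c p))"
    by (simp only: sum_distrib_left)
  also have "\<dots> \<le> \<delta> ^ 3 * h * g * (400 * X * e * (100 / (h * g * \<delta>\<^sup>2)))"
    using assms nonneg by (intro mult_left_mono sum_packet_decay_le) auto
  also have "\<dots> = 40000 * \<delta> * X * e"
    using assms by (simp add: power2_eq_square power3_eq_cube)
  finally show ?thesis .
qed

lemma
  fixes p p' :: pt
  assumes close: "p' \<in> cube p \<eta>" and y: "\<bar>y\<bar> \<le> Y" "1 \<le> Y"
  shows abs_cone_ray_diff_le: "\<bar>cone_ray y \<bullet> p - cone_ray y \<bullet> p'\<bar> \<le> 4 * Y\<^sup>2 * \<eta>"
    and abs_cone_tangent_diff_le: "\<bar>cone_tangent y \<bullet> p - cone_tangent y \<bullet> p'\<bar> \<le> 4 * Y\<^sup>2 * \<eta>"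
proof -
  obtain a b c a' b' c' where p: "p = (a, b, c)" "p' = (a', b', c')"
    by (cases p; cases p')
  have d: "\<bar>a - a'\<bar> \<le> \<eta>" "\<bar>b - b'\<bar> \<le> \<eta>" "\<bar>c - c'\<bar> \<le> \<eta>"
    using close by (auto simp: mem_cube p Basis_prod_def abs_minus_commute)
  have Y: "Y \<le> Y\<^sup>2" "1 \<le> Y\<^sup>2" using y(2) self_le_power[of Y 2] by auto
  have "y\<^sup>2 \<le> Y\<^sup>2" using power_mono[OF y(1), of 2] by simp
  then have square_term: "\<bar>y\<^sup>2 * (b - b')\<bar> \<le> Y\<^sup>2 * \<eta>"
    unfolding abs_mult using d by (intro mult_mono) auto
  have c_term: "\<bar>y * (c - c')\<bar> \<le> Y\<^sup>2 * \<eta>" and b_term: "\<bar>y * (b - b')\<bar> \<le> Y\<^sup>2 * \<eta>"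
    unfolding abs_mult using d y Y by (intro mult_mono; simp)+
  have \<eta>: "0 \<le> \<eta>" "\<eta> \<le> Y\<^sup>2 * \<eta>" using d(1) mult_right_mono[OF Y(2), of \<eta>] by auto
  have "cone_ray y \<bullet> p - cone_ray y \<bullet> p' = - (a - a') + y\<^sup>2 * (b - b') + 2 * (y * (c - c'))"
    by (simp add: cone_ray_def p algebra_simps)
  then show "\<bar>cone_ray y \<bullet> p - cone_ray y \<bullet> p'\<bar> \<le> 4 * Y\<^sup>2 * \<eta>"
    using square_term c_term \<eta> d by simp
  have "cone_tangent y \<bullet> p - cone_tangent y \<bullet> p' = y * (b - b') + (c - c')"
    by (simp add: cone_tangent_def p algebra_simps)
  then show "\<bar>cone_tangent y \<bullet> p - cone_tangent y \<bullet> p'\<bar> \<le> 4 * Y\<^sup>2 * \<eta>"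
    using b_term \<eta> d by simp
qed

lemma nn_integral_lborel_prod_le_fst:
  fixes F :: "'a::euclidean_space \<times> 'b::euclidean_space \<Rightarrow> ennreal" and G :: "'b \<Rightarrow> ennreal"
  assumes F: "F \<in> borel_measurable borel" and [measurable]: "G \<in> borel_measurable borel"
    and inner: "\<And>y. (\<integral>\<^sup>+x. F (x, y) \<partial>lborel) \<le> C"
  shows "(\<integral>\<^sup>+p. F p * G (snd p) \<partial>lborel) \<le> C * (\<integral>\<^sup>+y. G y \<partial>lborel)"
proof -
  have [measurable]: "F \<in> borel_measurable (lborel \<Otimes>\<^sub>M lborel)"
    using F by (simp add: lborel_prod)
  have "(\<lambda>p. F p * G (snd p)) \<in> borel_measurable (lborel \<Otimes>\<^sub>M lborel)"
    by measurable
  then have "(\<integral>\<^sup>+p. F p * G (snd p) \<partial>lborel) = (\<integral>\<^sup>+y. (\<integral>\<^sup>+x. F (x, y) * G y \<partial>lborel) \<partial>lborel)"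
    by (subst lborel_prod[symmetric], subst lborel_pair.nn_integral_snd[symmetric]) simp_all
  also have "\<dots> = (\<integral>\<^sup>+y. (\<integral>\<^sup>+x. F (x, y) \<partial>lborel) * G y \<partial>lborel)"
    by (intro nn_integral_cong nn_integral_multc) measurable
  also have "\<dots> \<le> (\<integral>\<^sup>+y. C * G y \<partial>lborel)"
    by (intro nn_integral_mono mult_right_mono inner) simp
  also have "\<dots> = C * (\<integral>\<^sup>+y. G y \<partial>lborel)"
    by (simp add: nn_integral_cmult)
  finally show ?thesis .
qed

lemma nn_integral_lborel_prod_le_snd:
  fixes F :: "'a::euclidean_space \<times> 'b::euclidean_space \<Rightarrow> ennreal" and G :: "'a \<Rightarrow> ennreal"
  assumes F: "F \<in> borel_measurable borel" and [measurable]: "G \<in> borel_measurable borel"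
    and inner: "\<And>x. (\<integral>\<^sup>+y. F (x, y) \<partial>lborel) \<le> C"
  shows "(\<integral>\<^sup>+p. F p * G (fst p) \<partial>lborel) \<le> C * (\<integral>\<^sup>+x. G x \<partial>lborel)"
proof -
  have [measurable]: "F \<in> borel_measurable (lborel \<Otimes>\<^sub>M lborel)"
    using F by (simp add: lborel_prod)
  have "(\<lambda>p. F p * G (fst p)) \<in> borel_measurable (lborel \<Otimes>\<^sub>M lborel)"
    by measurable
  then have "(\<integral>\<^sup>+p. F p * G (fst p) \<partial>lborel) = (\<integral>\<^sup>+x. (\<integral>\<^sup>+y. F (x, y) * G x \<partial>lborel) \<partial>lborel)"
    by (subst lborel_prod[symmetric], subst lborel.nn_integral_fst[symmetric]) simp_all
  also have "\<dots> = (\<integral>\<^sup>+x. (\<integral>\<^sup>+y. F (x, y) \<partial>lborel) * G x \<partial>lborel)"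
    by (intro nn_integral_cong nn_integral_multc) measurable
  also have "\<dots> \<le> (\<integral>\<^sup>+x. C * G x \<partial>lborel)"
    by (intro nn_integral_mono mult_right_mono inner) simp
  also have "\<dots> = C * (\<integral>\<^sup>+x. G x \<partial>lborel)"
    by (simp add: nn_integral_cmult)
  finally show ?thesis .
qed

lemma borel_measurable_ennreal_fejer:
  "continuous_on UNIV f \<Longrightarrow> (\<lambda>p. ennreal (fejer (f p))) \<in> borel_measurable borel"
  by (intro measurable_compose[OF _ measurable_ennreal] borel_measurable_continuous_onI continuous_intros)

lemma nn_integral_packet_le:
  assumes "0 < \<tau>" "0 < h" "0 < g"
  shows "(\<integral>\<^sup>+p. ennreal (norm (packet \<delta> v h r g y c p) * weight \<tau> p) \<partial>lborel) \<le> ennreal (2197 / (h * g * \<tau>))"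
proof -
  let ?u = "of_int (snd c) * \<delta> + y * (of_int (fst c) * \<delta>)" and ?w = "of_int (fst c) * \<delta>"
  let ?ray = "\<lambda>p. ennreal (fejer (h * ray_offset \<delta> y c p))"
  let ?tangent = "\<lambda>q. ennreal (fejer (g * (y * fst q + snd q - ?w)))"
  let ?slope = "\<lambda>C. ennreal (fejer (\<tau> * C))"
  have "ennreal (norm (packet \<delta> v h r g y c p) * weight \<tau> p) \<le> ?ray p * (?tangent (snd p) * ?slope (fst (snd p)))" for p
  proof -
    have "weight \<tau> p \<le> fejer (\<tau> * fst (snd p))"
      using weight_le_fejer[of "(0, 1, 0)" \<tau> p] by (simp add: Basis_prod_def inner_prod_def)
    moreover have "tangent_offset \<delta> y c p = y * fst (snd p) + snd (snd p) - ?w"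
      by (simp add: tangent_offset_def cone_tangent_def inner_prod_def)
    ultimately show ?thesis
      by (simp add: packet_def norm_mult norm_modulated_fejer ennreal_mult[symmetric] mult.assoc
          mult_left_mono ennreal_leI)
  qed
  then have "(\<integral>\<^sup>+p. ennreal (norm (packet \<delta> v h r g y c p) * weight \<tau> p) \<partial>lborel)
      \<le> (\<integral>\<^sup>+p. ?ray p * (?tangent (snd p) * ?slope (fst (snd p))) \<partial>lborel)"
    by (intro nn_integral_mono)
  also have "\<dots> \<le> ennreal (13 / h) * (\<integral>\<^sup>+q. ?tangent q * ?slope (fst q) \<partial>(lborel :: (real \<times> real) measure))"
  proof (rule nn_integral_lborel_prod_le_fst)
    show "(\<integral>\<^sup>+B. ?ray (B, q) \<partial>lborel) \<le> ennreal (13 / h)" for q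
      using nn_integral_fejer_affine_le[of "- h" "h * (y\<^sup>2 * fst q + 2 * y * snd q - ?u)"] assms
      by (simp add: ray_offset_def cone_ray_def inner_prod_def algebra_simps)
  qed (unfold ray_offset_def,
      (intro borel_measurable_times_ennreal borel_measurable_ennreal_fejer continuous_intros)+)
  also have "\<dots> \<le> ennreal (13 / h) * (ennreal (13 / g) * (\<integral>\<^sup>+C. ?slope C \<partial>lborel))"
  proof (intro mult_left_mono nn_integral_lborel_prod_le_snd)
    show "(\<integral>\<^sup>+W. ?tangent (C, W) \<partial>lborel) \<le> ennreal (13 / g)" for C
      using nn_integral_fejer_affine_le[of g "g * (y * C - ?w)"] assms by (simp add: algebra_simps)
  qed (intro borel_measurable_ennreal_fejer continuous_intros | simp)+
  also have "\<dots> \<le> ennreal (13 / h) * (ennreal (13 / g) * ennreal (13 / \<tau>))"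
    using nn_integral_fejer_affine_le[of \<tau> 0] assms by (intro mult_left_mono) auto
  also have "\<dots> = ennreal (2197 / (h * g * \<tau>))"
    using assms by (simp add: ennreal_mult[symmetric] mult_ac)
  finally show ?thesis .
qed

lemma weighted_integral_norm_packet_le:
  assumes "0 < \<tau>" "0 < h" "0 < g"
  shows "weighted_integral \<tau> (\<lambda>p. norm (packet \<delta> v h r g y c p)) \<le> 2197 / (h * g * \<tau>)"
proof -
  have "packet \<delta> v h r g y c \<in> bcontfun"
    using assms by (intro band_limited_bcontfun[OF band_limited_packet]) auto
  then have "integrable lborel (\<lambda>p. norm (packet \<delta> v h r g y c p) * weight \<tau> p)"
    using integrable_mult_weight[OF assms(1) bcontfun_norm_power[where n=1]] by simp
  then have "ennreal (weighted_integral \<tau> (\<lambda>p. norm (packet \<delta> v h r g y c p))) \<le> ennreal (2197 / (h * g * \<tau>))"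
    unfolding weighted_integral_def using nn_integral_packet_le[OF assms]
    by (subst nn_integral_eq_integral[symmetric]) auto
  then show ?thesis using assms by (subst (asm) ennreal_le_iff) auto
qed

lemma weighted_integral_norm_layer_le:
  assumes "0 < \<tau>" "0 < h" "0 < g" "0 < \<delta>"
  shows "weighted_integral \<tau> (\<lambda>p. norm (layer \<delta> v h r g y S p)) \<le> 2197 / \<tau> * \<delta> ^ 3 * real (card S)"
proof -
  have "packet \<delta> v h r g y c \<in> bcontfun" for c
    using assms by (intro band_limited_bcontfun[OF band_limited_packet]) auto
  then have "weighted_integral \<tau> (\<lambda>p. norm (\<Sum>c\<in>S. packet \<delta> v h r g y c p))
      \<le> (\<Sum>c\<in>S. weighted_integral \<tau> (\<lambda>p. norm (packet \<delta> v h r g y c p)))"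
    using weighted_integral_norm_sum_power_le[OF assms(1), of S "packet \<delta> v h r g y" 0] by simp
  also have "\<dots> \<le> (\<Sum>c\<in>S. 2197 / (h * g * \<tau>))"
    using assms by (intro sum_mono weighted_integral_norm_packet_le)
  finally have "\<delta> ^ 3 * h * g * weighted_integral \<tau> (\<lambda>p. norm (\<Sum>c\<in>S. packet \<delta> v h r g y c p))
      \<le> \<delta> ^ 3 * h * g * (\<Sum>c\<in>S. 2197 / (h * g * \<tau>))"
    using assms by (intro mult_left_mono) auto
  moreover have "norm (layer \<delta> v h r g y S p) = \<delta> ^ 3 * h * g * norm (\<Sum>c\<in>S. packet \<delta> v h r g y c p)" for p
    unfolding layer_def norm_mult norm_of_real using assms by simp
  ultimately show ?thesis
    using assms by (simp add: weighted_integral_cmult field_simps)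
qed

section \<open>Decoupling for the cone\<close>

lemma
  fixes A :: "int set"
  assumes A: "\<And>i. i \<in> A \<Longrightarrow> a \<le> of_int i \<and> of_int i \<le> b"
  shows finite_ints_in_interval: "finite A"
    and card_ints_in_interval_le: "a \<le> b \<Longrightarrow> real (card A) \<le> b - a + 1"
proof -
  have sub: "A \<subseteq> {\<lceil>a\<rceil>..\<lfloor>b\<rfloor>}"
    using A by (auto simp: ceiling_le_iff le_floor_iff)
  show "finite A" by (rule finite_subset[OF sub]) simp
  assume "a \<le> b"
  have "card A \<le> card {\<lceil>a\<rceil>..\<lfloor>b\<rfloor>}" by (rule card_mono[OF _ sub]) simp
  also have "\<dots> = nat (\<lfloor>b\<rfloor> - \<lceil>a\<rceil> + 1)" by simp
  finally have "real (card A) \<le> real (nat (\<lfloor>b\<rfloor> - \<lceil>a\<rceil> + 1))" by simp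
  also have "\<dots> \<le> b - a + 1"
    using \<open>a \<le> b\<close> by linarith
  finally show "real (card A) \<le> b - a + 1" .
qed

lemma abs_diff_abs_square_le: "(\<bar>x\<bar> - \<bar>y\<bar>)\<^sup>2 \<le> \<bar>x\<^sup>2 - y\<^sup>2\<bar>" for x y :: real
proof -
  have "(\<bar>x\<bar> - \<bar>y\<bar>)\<^sup>2 = \<bar>\<bar>x\<bar> - \<bar>y\<bar>\<bar> * \<bar>\<bar>x\<bar> - \<bar>y\<bar>\<bar>" by (simp add: power2_eq_square)
  also have "\<dots> \<le> \<bar>\<bar>x\<bar> + \<bar>y\<bar>\<bar> * \<bar>\<bar>x\<bar> - \<bar>y\<bar>\<bar>" by (intro mult_right_mono) auto
  also have "\<dots> = \<bar>\<bar>x\<bar>\<^sup>2 - \<bar>y\<bar>\<^sup>2\<bar>"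
    by (simp only: power2_eq_square square_diff_square_factored abs_mult)
  finally show ?thesis by simp
qed

text \<open>Two numbers are determined by their sum and their sum of squares; this is the only place where
  the curvature of the cone enters.\<close>
lemma close_pairs_of_close_power_sums:
  fixes z1 z2 z3 z4 :: real
  assumes z: "\<bar>z1\<bar> \<le> \<sigma>" "\<bar>z2\<bar> \<le> \<sigma>" "\<bar>z3\<bar> \<le> \<sigma>" "\<bar>z4\<bar> \<le> \<sigma>"
    and sums: "\<bar>z1 + z2 - z3 - z4\<bar> \<le> a" and squares: "\<bar>z1\<^sup>2 + z2\<^sup>2 - z3\<^sup>2 - z4\<^sup>2\<bar> \<le> d"
    and T: "0 \<le> T" "a \<le> T" "2 * d + 4 * \<sigma> * a \<le> T\<^sup>2"
  shows "(\<bar>z1 - z3\<bar> \<le> T \<and> \<bar>z2 - z4\<bar> \<le> T) \<or> (\<bar>z1 - z4\<bar> \<le> T \<and> \<bar>z2 - z3\<bar> \<le> T)"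
proof -
  have "\<bar>(z1 + z2 - z3 - z4) * (z1 + z2 + z3 + z4)\<bar> \<le> a * (4 * \<sigma>)"
    unfolding abs_mult using z sums by (intro mult_mono) auto
  moreover have "(z1 - z2)\<^sup>2 - (z3 - z4)\<^sup>2
      = 2 * (z1\<^sup>2 + z2\<^sup>2 - z3\<^sup>2 - z4\<^sup>2) - (z1 + z2 - z3 - z4) * (z1 + z2 + z3 + z4)"
    by (simp add: power2_eq_square algebra_simps)
  ultimately have "\<bar>(z1 - z2)\<^sup>2 - (z3 - z4)\<^sup>2\<bar> \<le> T\<^sup>2"
    using squares T(3) unfolding abs_le_iff by (simp add: mult_ac)
  then have "(\<bar>z1 - z2\<bar> - \<bar>z3 - z4\<bar>)\<^sup>2 \<le> T\<^sup>2"
    using abs_diff_abs_square_le[of "z1 - z2" "z3 - z4"] by linarith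
  then have "\<bar>\<bar>z1 - z2\<bar> - \<bar>z3 - z4\<bar>\<bar> \<le> T"
    using T(1) power2_le_iff_abs_le by blast
  moreover have "\<bar>z1 + z2 - z3 - z4\<bar> \<le> T" using sums T(2) by simp
  ultimately show ?thesis by arith
qed

lemma abs_mult_sum_perturbed_le:
  fixes \<epsilon> s x u :: "'i \<Rightarrow> real"
  assumes "\<And>i. i \<in> I \<Longrightarrow> \<bar>\<epsilon> i\<bar> \<le> 1" "\<And>i. i \<in> I \<Longrightarrow> \<bar>s i - v\<bar> \<le> d"
    and "\<And>i. i \<in> I \<Longrightarrow> \<bar>x i\<bar> \<le> X" "\<And>i. i \<in> I \<Longrightarrow> \<bar>u i\<bar> \<le> U"
  shows "\<bar>v * (\<Sum>i\<in>I. \<epsilon> i * x i)\<bar> \<le> \<bar>\<Sum>i\<in>I. \<epsilon> i * (s i * x i + u i)\<bar> + real (card I) * (d * X + U)"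
proof -
  have "\<bar>\<epsilon> i * ((s i - v) * x i + u i)\<bar> \<le> d * X + U" if "i \<in> I" for i
  proof -
    have "\<bar>(s i - v) * x i\<bar> \<le> d * X"
      unfolding abs_mult using assms(2,3)[OF that] by (intro mult_mono) auto
    then have "\<bar>(s i - v) * x i + u i\<bar> \<le> d * X + U"
      using assms(4)[OF that] by linarith
    then show ?thesis
      unfolding abs_mult using assms(1)[OF that]
      by (meson abs_ge_zero mult_left_le_one_le order_trans)
  qed
  then have "\<bar>\<Sum>i\<in>I. \<epsilon> i * ((s i - v) * x i + u i)\<bar> \<le> (\<Sum>i\<in>I. d * X + U)"
    by (intro order_trans[OF sum_abs] sum_mono)
  moreover have "v * (\<Sum>i\<in>I. \<epsilon> i * x i)
      = (\<Sum>i\<in>I. \<epsilon> i * (s i * x i + u i)) - (\<Sum>i\<in>I. \<epsilon> i * ((s i - v) * x i + u i))"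
    by (simp add: sum_distrib_left sum_subtractf[symmetric] algebra_simps)
  ultimately show ?thesis by simp
qed

definition pair_sign :: "nat \<Rightarrow> real" where
  "pair_sign i = (if i < 2 then 1 else - 1)"

lemma abs_pair_sign [simp]: "\<bar>pair_sign i\<bar> = 1"
  by (simp add: pair_sign_def)

lemma sum_pair_sign_scaleR:
  "(\<Sum>i<4. pair_sign i *\<^sub>R f i) = f 0 + f 1 - (f 2 + f 3)" for f :: "nat \<Rightarrow> 'a::real_vector"
  by (simp add: eval_nat_numeral pair_sign_def)

lemma sum_pair_sign: "(\<Sum>i<4. pair_sign i * f i) = f 0 + f 1 - f 2 - f 3"
  using sum_pair_sign_scaleR[of f] by simp

lemma close_pairs_of_perturbed_power_sums:
  fixes z s t :: "nat \<Rightarrow> real"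
  assumes z: "\<And>i. i < 4 \<Longrightarrow> z i \<in> {0..\<sigma>}" and \<sigma>: "0 < \<sigma>" "\<sigma> \<le> 1" and \<kappa>: "1 \<le> \<kappa>" and v: "v \<noteq> 0"
    and s: "\<And>i. i < 4 \<Longrightarrow> \<bar>s i - v\<bar> \<le> \<bar>v\<bar> / \<kappa>\<^sup>2" and t: "\<And>i. i < 4 \<Longrightarrow> \<bar>t i\<bar> \<le> \<rho>"
    and \<rho>: "\<rho> \<le> \<sigma> * \<bar>v\<bar> / \<kappa>\<^sup>2" and q: "q \<le> \<sigma>\<^sup>2 * \<bar>v\<bar> / \<kappa>\<^sup>2"
    and linear: "\<bar>\<Sum>i<4. pair_sign i * (2 * s i * z i + t i)\<bar> \<le> q"
    and quadratic: "\<bar>\<Sum>i<4. pair_sign i * (s i * (z i)\<^sup>2 + t i * z i)\<bar> \<le> q"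
  shows "(\<bar>z 0 - z 2\<bar> \<le> 7 * \<sigma> / \<kappa> \<and> \<bar>z 1 - z 3\<bar> \<le> 7 * \<sigma> / \<kappa>) \<or>
    (\<bar>z 0 - z 3\<bar> \<le> 7 * \<sigma> / \<kappa> \<and> \<bar>z 1 - z 2\<bar> \<le> 7 * \<sigma> / \<kappa>)"
proof -
  define \<nu> where "\<nu> = \<bar>v\<bar> / \<kappa>\<^sup>2"
  have \<nu>: "0 < \<nu>" using \<kappa> v by (simp add: \<nu>_def)
  have bounds: "\<rho> \<le> \<sigma> * \<nu>" "q \<le> \<sigma>\<^sup>2 * \<nu>" using \<rho> q by (simp_all add: \<nu>_def)
  have "\<sigma>\<^sup>2 \<le> \<sigma>" using \<sigma> by (simp add: power2_eq_square mult_left_le)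
  then have "\<sigma>\<^sup>2 * \<nu> \<le> \<sigma> * \<nu>" using \<nu> by (intro mult_right_mono) auto
  have z_abs: "\<bar>z i\<bar> \<le> \<sigma>" "\<bar>(z i)\<^sup>2\<bar> \<le> \<sigma>\<^sup>2" if "i < 4" for i
    using z[OF that] by (auto intro: power_mono)
  have t_half: "\<bar>t i / 2\<bar> \<le> \<rho> / 2" if "i < 4" for i using t[OF that] by simp
  have t_mult_z: "\<bar>t i * z i\<bar> \<le> \<rho> * \<sigma>" if "i < 4" for i
    unfolding abs_mult using t[OF that] z_abs(1)[OF that] by (intro mult_mono) auto
  have "(\<Sum>i<4. pair_sign i * (s i * z i + t i / 2)) = (\<Sum>i<4. pair_sign i * (2 * s i * z i + t i)) / 2"
    unfolding sum_pair_sign by simp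
  then have "\<bar>v * (\<Sum>i<4. pair_sign i * z i)\<bar> \<le> q / 2 + 4 * (\<nu> * \<sigma> + \<rho> / 2)"
    using abs_mult_sum_perturbed_le[of "{..<4}" pair_sign s v \<nu> z \<sigma> "\<lambda>i. t i / 2" "\<rho> / 2"]
      s z_abs t_half linear by (simp add: \<nu>_def)
  also have "\<dots> \<le> 7 * (\<sigma> * \<nu>)"
    using bounds \<open>\<sigma>\<^sup>2 * \<nu> \<le> \<sigma> * \<nu>\<close> mult_pos_pos[OF \<sigma>(1) \<nu>] by (simp add: mult.commute[of \<nu>])
  also have "\<dots> = \<bar>v\<bar> * (7 * \<sigma> / \<kappa>\<^sup>2)" by (simp add: \<nu>_def)
  finally have sums: "\<bar>z 0 + z 1 - z 2 - z 3\<bar> \<le> 7 * \<sigma> / \<kappa>\<^sup>2"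
    unfolding abs_mult sum_pair_sign by (rule mult_left_le_imp_le) (use v in simp)
  have "\<bar>v * (\<Sum>i<4. pair_sign i * (z i)\<^sup>2)\<bar> \<le> q + 4 * (\<nu> * \<sigma>\<^sup>2 + \<rho> * \<sigma>)"
    using abs_mult_sum_perturbed_le[of "{..<4}" pair_sign s v \<nu> "\<lambda>i. (z i)\<^sup>2" "\<sigma>\<^sup>2" "\<lambda>i. t i * z i" "\<rho> * \<sigma>"]
      s z_abs t_mult_z quadratic by (simp add: \<nu>_def)
  also have "\<dots> \<le> 9 * (\<sigma>\<^sup>2 * \<nu>)"
  proof -
    have "\<rho> * \<sigma> \<le> \<sigma>\<^sup>2 * \<nu>"
      using mult_right_mono[OF bounds(1), of \<sigma>] \<sigma> by (simp add: power2_eq_square mult_ac)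
    then show ?thesis using bounds(2) by (simp add: mult.commute[of \<nu>])
  qed
  also have "\<dots> = \<bar>v\<bar> * (9 * \<sigma>\<^sup>2 / \<kappa>\<^sup>2)" by (simp add: \<nu>_def)
  finally have squares: "\<bar>(z 0)\<^sup>2 + (z 1)\<^sup>2 - (z 2)\<^sup>2 - (z 3)\<^sup>2\<bar> \<le> 9 * \<sigma>\<^sup>2 / \<kappa>\<^sup>2"
    unfolding abs_mult sum_pair_sign by (rule mult_left_le_imp_le) (use v in simp)
  show ?thesis
  proof (rule close_pairs_of_close_power_sums[OF _ _ _ _ sums squares])
    show "7 * \<sigma> / \<kappa>\<^sup>2 \<le> 7 * \<sigma> / \<kappa>"
      using \<sigma> \<kappa> self_le_power[of \<kappa> 2] by (intro divide_left_mono) auto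
    show "2 * (9 * \<sigma>\<^sup>2 / \<kappa>\<^sup>2) + 4 * \<sigma> * (7 * \<sigma> / \<kappa>\<^sup>2) \<le> (7 * \<sigma> / \<kappa>)\<^sup>2"
      using \<kappa> by (simp add: field_simps power2_eq_square)
  qed (use z_abs \<sigma> \<kappa> in auto)
qed

lemma near_tripleD: "near \<tau> (z1, z2, z3) \<Longrightarrow> \<tau> \<le> 1/2 \<Longrightarrow> \<bar>z1\<bar> < 1 \<and> \<bar>z2\<bar> < 1 \<and> \<bar>z3\<bar> < 1"
  for z1 z2 z3 :: real
  by (auto simp: near_def Basis_prod_def)

text \<open>The cone is invariant under the shears that translate the parameter \<open>y\<close>, so an approximate
  linear relation among frequencies can be recentred at any \<open>y\<^sub>0\<close>.\<close>
lemma
  fixes \<epsilon> s t z :: "'i \<Rightarrow> real"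
  assumes near: "near \<tau> (\<Sum>i\<in>I. \<epsilon> i *\<^sub>R (s i *\<^sub>R cone_ray (y0 + z i) + t i *\<^sub>R cone_tangent (y0 + z i)))"
    and \<tau>: "\<tau> \<le> 1/2" and y0: "\<bar>y0\<bar> \<le> Y" and Y: "1 \<le> Y"
  shows recentred_linear_relation: "\<bar>\<Sum>i\<in>I. \<epsilon> i * (2 * s i * z i + t i)\<bar> \<le> 5 * Y\<^sup>2"
    and recentred_quadratic_relation: "\<bar>\<Sum>i\<in>I. \<epsilon> i * (s i * (z i)\<^sup>2 + t i * z i)\<bar> \<le> 5 * Y\<^sup>2"
proof -
  define e1 where "e1 = (\<Sum>i\<in>I. - (\<epsilon> i * s i))"
  define e2 where "e2 = (\<Sum>i\<in>I. \<epsilon> i * (s i * (y0 + z i)\<^sup>2 + t i * (y0 + z i)))"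
  define e3 where "e3 = (\<Sum>i\<in>I. \<epsilon> i * (2 * s i * (y0 + z i) + t i))"
  have "(\<Sum>i\<in>I. \<epsilon> i *\<^sub>R (s i *\<^sub>R cone_ray (y0 + z i) + t i *\<^sub>R cone_tangent (y0 + z i))) = (e1, e2, e3)"
    by (simp add: e1_def e2_def e3_def cone_ray_def cone_tangent_def sum_prod mult_ac)
  then have e: "\<bar>e1\<bar> < 1" "\<bar>e2\<bar> < 1" "\<bar>e3\<bar> < 1"
    using near_tripleD[of \<tau> e1 e2 e3] near \<tau> by auto
  have Y_le_square: "1 \<le> Y\<^sup>2" "Y \<le> Y\<^sup>2" using Y self_le_power[of Y 2] by auto
  have "\<bar>y0 * e1\<bar> \<le> Y * 1" "\<bar>y0 * e3\<bar> \<le> Y * 1" "\<bar>y0\<^sup>2 * e1\<bar> \<le> Y\<^sup>2 * 1"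
    unfolding abs_mult using e y0 power_mono[OF y0, of 2] by (intro mult_mono; simp)+
  note shifts = this
  have "(\<Sum>i\<in>I. \<epsilon> i * (2 * s i * z i + t i)) = e3 + 2 * (y0 * e1)"
    unfolding e1_def e3_def sum_distrib_left sum.distrib[symmetric]
    by (intro sum.cong refl) (simp add: algebra_simps)
  then show "\<bar>\<Sum>i\<in>I. \<epsilon> i * (2 * s i * z i + t i)\<bar> \<le> 5 * Y\<^sup>2"
    using e shifts Y_le_square by linarith
  have "(\<Sum>i\<in>I. \<epsilon> i * (s i * (z i)\<^sup>2 + t i * z i)) = e2 - y0 * e3 - y0\<^sup>2 * e1"
    unfolding e1_def e2_def e3_def sum_distrib_left sum_subtractf[symmetric]
    by (intro sum.cong refl) (simp add: power2_eq_square algebra_simps)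
  then show "\<bar>\<Sum>i\<in>I. \<epsilon> i * (s i * (z i)\<^sup>2 + t i * z i)\<bar> \<le> 5 * Y\<^sup>2"
    using e shifts Y_le_square by linarith
qed

text \<open>The layers \<open>F j\<close> are indexed by the \<open>\<delta>\<close>-net \<open>y = j \<delta>\<close>, and \<open>\<mu> j\<close> bounds the \<open>L\<^sup>1\<close> mass of \<open>F j\<close>.\<close>
locale cone_layers =
  fixes \<delta> \<tau> Y :: real and k :: nat and v h r g :: real and J :: "int set"
    and F :: "int \<Rightarrow> pt \<Rightarrow> complex" and \<mu> :: "int \<Rightarrow> real" and C1 C2 :: real
  assumes \<delta>: "0 < \<delta>" "\<delta> \<le> 1/8" and \<tau>: "0 < \<tau>" "\<tau> \<le> 1/2" and Y: "1 \<le> Y" and k: "8 \<le> k"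
    and J: "finite J" "\<And>j. j \<in> J \<Longrightarrow> \<bar>of_int j * \<delta>\<bar> \<le> Y - 1"
    and F_band: "\<And>j. j \<in> J \<Longrightarrow> band_limited (plank v h r g (of_int j * \<delta>)) (F j)"
    and F_sup: "\<And>j p. j \<in> J \<Longrightarrow> norm (F j p) \<le> C1 * \<delta>"
    and F_mass: "\<And>j. j \<in> J \<Longrightarrow> weighted_integral \<tau> (\<lambda>p. norm (F j p)) \<le> C2 * \<mu> j"
    and \<mu>: "\<And>j. 0 \<le> \<mu> j" and C1: "1 \<le> C1" and C2: "0 \<le> C2"
begin

definition layer_sum :: "int set \<Rightarrow> pt \<Rightarrow> complex" where
  "layer_sum A p = (\<Sum>j\<in>A. F j p)"

definition cap_of :: "nat \<Rightarrow> int \<Rightarrow> int" where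
  "cap_of l j = \<lfloor>of_int j * \<delta> * real k ^ l\<rfloor>"

definition cap :: "nat \<Rightarrow> int \<Rightarrow> int set" where
  "cap l a = {j\<in>J. cap_of l j = a}"

definition caps :: "nat \<Rightarrow> int set" where
  "caps l = cap_of l ` J"

definition child_caps :: "nat \<Rightarrow> int \<Rightarrow> int set" where
  "child_caps l a = {b\<in>caps (Suc l). b div int k = a}"

definition cap_energy :: "nat \<Rightarrow> nat \<Rightarrow> real" where
  "cap_energy q l = (\<Sum>a\<in>caps l. weighted_integral \<tau> (\<lambda>p. norm (layer_sum (cap l a) p) ^ q))"

definition mass :: real where
  "mass = (\<Sum>j\<in>J. \<mu> j)"

lemma k_pos: "0 < k" "0 < real k" "0 < real k ^ l"
  using k by auto

lemma one_le_Y_square: "1 \<le> Y\<^sup>2"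
  using Y by simp

lemma mass_nonneg: "0 \<le> mass"
  unfolding mass_def by (intro sum_nonneg \<mu>)

lemma cap_subset: "cap l a \<subseteq> J"
  by (auto simp: cap_def)

lemma finite_cap: "finite (cap l a)"
  using finite_subset[OF cap_subset J(1)] .

lemma finite_caps: "finite (caps l)"
  using J(1) by (simp add: caps_def)

lemma finite_child_caps: "finite (child_caps l a)"
  using finite_caps by (simp add: child_caps_def)

lemma F_bcontfun: "j \<in> J \<Longrightarrow> F j \<in> bcontfun"
  using band_limited_bcontfun[OF F_band] .

lemma layer_sum_bcontfun: "A \<subseteq> J \<Longrightarrow> layer_sum A \<in> bcontfun"
  unfolding layer_sum_def[abs_def] by (intro bcontfun_sum F_bcontfun) auto

lemma layer_sum_cap_bcontfun: "layer_sum (cap l a) \<in> bcontfun"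
  by (intro layer_sum_bcontfun cap_subset)

lemma cap_bounds:
  assumes "j \<in> cap l a"
  shows "of_int a / real k ^ l \<le> of_int j * \<delta>" "of_int j * \<delta> \<le> of_int a / real k ^ l + 1 / real k ^ l"
proof -
  have "of_int a \<le> of_int j * \<delta> * real k ^ l" "of_int j * \<delta> * real k ^ l < of_int a + 1"
    using assms by (auto simp: cap_def cap_of_def)
  then show "of_int a / real k ^ l \<le> of_int j * \<delta>" "of_int j * \<delta> \<le> of_int a / real k ^ l + 1 / real k ^ l"
    using k_pos by (auto simp: field_simps)
qed

lemma cap_of_Suc_div: "cap_of (Suc l) j div int k = cap_of l j"
proof -
  have "\<lfloor>(of_int j * \<delta> * real k ^ Suc l) / real_of_int (int k)\<rfloor> = \<lfloor>of_int j * \<delta> * real k ^ Suc l\<rfloor> div int k"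
    by (rule floor_divide_real_eq_div) simp
  moreover have "of_int j * \<delta> * real k ^ Suc l / real_of_int (int k) = of_int j * \<delta> * real k ^ l"
    using k_pos by simp
  ultimately show ?thesis by (simp only: cap_of_def)
qed

lemma cap_Suc_subset: "b div int k = a \<Longrightarrow> cap (Suc l) b \<subseteq> cap l a"
  by (auto simp: cap_def cap_of_Suc_div)

lemma layer_sum_cap_eq: "layer_sum (cap l a) p = (\<Sum>b\<in>child_caps l a. layer_sum (cap (Suc l) b) p)"
proof -
  have "layer_sum (cap l a) p = (\<Sum>b\<in>child_caps l a. \<Sum>j\<in>{j. j \<in> cap l a \<and> cap_of (Suc l) j = b}. F j p)"
    unfolding layer_sum_def
    by (rule sum.group[OF finite_cap finite_child_caps, symmetric])
      (auto simp: child_caps_def cap_def caps_def cap_of_Suc_div)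
  also have "\<dots> = (\<Sum>b\<in>child_caps l a. layer_sum (cap (Suc l) b) p)"
    unfolding layer_sum_def
    by (intro sum.cong refl) (auto simp: child_caps_def cap_def cap_of_Suc_div)
  finally show ?thesis .
qed

lemma layer_sum_eq_sum_caps: "layer_sum J p = (\<Sum>a\<in>caps l. layer_sum (cap l a) p)"
  unfolding layer_sum_def cap_def
  by (rule sum.group[OF J(1) finite_caps, symmetric]) (simp add: caps_def)

lemma card_child_caps_le: "card (child_caps l a) \<le> k"
proof -
  have "child_caps l a \<subseteq> {a * int k..<a * int k + int k}"
  proof
    fix b assume "b \<in> child_caps l a"
    then have "b = a * int k + b mod int k"
      using div_mult_mod_eq[of b "int k"] by (auto simp: child_caps_def)
    then show "b \<in> {a * int k..<a * int k + int k}"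
      unfolding atLeastLessThan_iff
      using k_pos pos_mod_bound[of "int k" b] pos_mod_sign[of "int k" b] by linarith
  qed
  from card_mono[OF _ this] show ?thesis by simp
qed

lemma sum_child_caps: "(\<Sum>a\<in>caps l. \<Sum>b\<in>child_caps l a. f b) = (\<Sum>b\<in>caps (Suc l). f b)"
  for f :: "int \<Rightarrow> real"
proof -
  have "(\<lambda>b. b div int k) ` caps (Suc l) = caps l"
    by (simp add: caps_def image_image cap_of_Suc_div)
  then show ?thesis
    unfolding child_caps_def
    using sum.group[OF finite_caps finite_caps, of "\<lambda>b. b div int k" "Suc l" l f] by simp
qed

lemma cap_energy_nonneg: "0 \<le> cap_energy q l"
  unfolding cap_energy_def by (intro sum_nonneg weighted_integral_nonneg) simp

lemma cap_energy_2_Suc: "cap_energy 2 l \<le> real k * cap_energy 2 (Suc l)"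
proof -
  let ?W = "\<lambda>b. weighted_integral \<tau> (\<lambda>p. norm (layer_sum (cap (Suc l) b) p) ^ 2)"
  have "cap_energy 2 l \<le> (\<Sum>a\<in>caps l. real k * (\<Sum>b\<in>child_caps l a. ?W b))"
    unfolding cap_energy_def
  proof (rule sum_mono)
    fix a
    have "weighted_integral \<tau> (\<lambda>p. norm (layer_sum (cap l a) p) ^ 2)
        \<le> real (card (child_caps l a)) * (\<Sum>b\<in>child_caps l a. ?W b)"
      unfolding layer_sum_cap_eq[of l a]
      using weighted_integral_norm_sum_power_le[where I="child_caps l a"
          and u="\<lambda>b. layer_sum (cap (Suc l) b)" and n=1, OF \<tau>(1) layer_sum_cap_bcontfun]
      by (simp add: power2_eq_square)
    also have "\<dots> \<le> real k * (\<Sum>b\<in>child_caps l a. ?W b)"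
      using card_child_caps_le by (intro mult_right_mono sum_nonneg weighted_integral_nonneg) auto
    finally show "weighted_integral \<tau> (\<lambda>p. norm (layer_sum (cap l a) p) ^ 2)
        \<le> real k * (\<Sum>b\<in>child_caps l a. ?W b)" .
  qed
  also have "\<dots> = real k * cap_energy 2 (Suc l)"
    unfolding cap_energy_def sum_distrib_left[symmetric] by (simp only: sum_child_caps)
  finally show ?thesis .
qed

lemma cap_energy_2_add: "cap_energy 2 l \<le> real k ^ i * cap_energy 2 (l + i)"
proof (induction i)
  case (Suc i)
  have "real k ^ i * cap_energy 2 (l + i) \<le> real k ^ i * (real k * cap_energy 2 (Suc (l + i)))"
    by (intro mult_left_mono cap_energy_2_Suc) simp
  with Suc show ?case by (simp add: mult_ac)
qed simp

lemma card_caps_0_le: "real (card (caps 0)) \<le> 3 * Y"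
proof -
  have "- Y \<le> of_int a \<and> of_int a \<le> Y" if a: "a \<in> caps 0" for a
  proof -
    obtain j where "j \<in> J" "a = \<lfloor>of_int j * \<delta>\<rfloor>" using a by (auto simp: caps_def cap_of_def)
    moreover from this have "\<bar>of_int j * \<delta>\<bar> \<le> Y - 1" by (intro J(2))
    ultimately show ?thesis by linarith
  qed
  from card_ints_in_interval_le[of "caps 0", OF this] show ?thesis using Y by simp
qed

lemma weighted_integral_power4_le_cap_energy:
  "weighted_integral \<tau> (\<lambda>p. norm (layer_sum J p) ^ 4) \<le> 27 * Y ^ 3 * cap_energy 4 0"
proof -
  have "weighted_integral \<tau> (\<lambda>p. norm (layer_sum J p) ^ 4) \<le> real (card (caps 0)) ^ 3 * cap_energy 4 0"
    unfolding layer_sum_eq_sum_caps[of _ 0] cap_energy_def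
    using weighted_integral_norm_sum_power_le[where I="caps 0" and u="\<lambda>a. layer_sum (cap 0 a)" and n=3,
        OF \<tau>(1) layer_sum_cap_bcontfun]
    by simp
  also have "\<dots> \<le> (3 * Y) ^ 3 * cap_energy 4 0"
    by (intro mult_right_mono power_mono card_caps_0_le cap_energy_nonneg) simp
  finally show ?thesis by (simp add: power_mult_distrib)
qed

lemma card_cap_le: "real (card (cap l a)) \<le> 1 / (real k ^ l * \<delta>) + 1"
proof -
  let ?a = "of_int a / real k ^ l"
  have "real (card (cap l a)) \<le> (?a + 1 / real k ^ l) / \<delta> - ?a / \<delta> + 1"
  proof (rule card_ints_in_interval_le)
    show "?a / \<delta> \<le> of_int j \<and> of_int j \<le> (?a + 1 / real k ^ l) / \<delta>" if "j \<in> cap l a" for j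
      using cap_bounds[OF that] \<delta> by (simp only: pos_divide_le_eq pos_le_divide_eq)
    show "?a / \<delta> \<le> (?a + 1 / real k ^ l) / \<delta>"
      using \<delta> by (intro divide_right_mono) auto
  qed
  also have "\<dots> = 1 / (real k ^ l * \<delta>) + 1"
    by (simp add: add_divide_distrib)
  finally show ?thesis .
qed

lemma norm_layer_sum_cap_le:
  assumes "\<delta> \<le> 1 / real k ^ l"
  shows "norm (layer_sum (cap l a) p) \<le> 2 * C1 / real k ^ l"
proof -
  have "norm (layer_sum (cap l a) p) \<le> (\<Sum>j\<in>cap l a. C1 * \<delta>)"
    unfolding layer_sum_def using cap_subset by (intro order_trans[OF norm_sum] sum_mono F_sup) auto
  also have "\<dots> = C1 * (\<delta> * real (card (cap l a)))" by simp
  also have "\<dots> \<le> C1 * (\<delta> * (1 / (real k ^ l * \<delta>) + 1))"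
    using C1 \<delta> by (intro mult_left_mono card_cap_le) auto
  also have "\<delta> * (1 / (real k ^ l * \<delta>) + 1) = 1 / real k ^ l + \<delta>"
    using \<delta> by (simp add: field_simps)
  also have "C1 * (1 / real k ^ l + \<delta>) \<le> C1 * (2 / real k ^ l)"
    using C1 assms by (intro mult_left_mono) auto
  finally show ?thesis by (simp add: mult.commute)
qed

lemma cap_energy_4_le_2:
  assumes "\<delta> \<le> 1 / real k ^ l"
  shows "cap_energy 4 l \<le> (2 * C1 / real k ^ l)\<^sup>2 * cap_energy 2 l"
  unfolding cap_energy_def sum_distrib_left weighted_integral_cmult[symmetric]
proof (intro sum_mono weighted_integral_mono \<tau> bcontfun_intros layer_sum_cap_bcontfun)
  fix a p
  have "norm (layer_sum (cap l a) p) ^ 4 = (norm (layer_sum (cap l a) p))\<^sup>2 * (norm (layer_sum (cap l a) p))\<^sup>2"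
    by (simp add: power_add[symmetric])
  also have "\<dots> \<le> (2 * C1 / real k ^ l)\<^sup>2 * (norm (layer_sum (cap l a) p))\<^sup>2"
    by (intro mult_right_mono power_mono norm_layer_sum_cap_le assms) auto
  finally show "norm (layer_sum (cap l a) p) ^ 4 \<le> (2 * C1 / real k ^ l)\<^sup>2 * (norm (layer_sum (cap l a) p))\<^sup>2" .
qed

lemma weighted_integral_F_square_le:
  assumes j: "j \<in> J"
  shows "weighted_integral \<tau> (\<lambda>p. (norm (F j p))\<^sup>2) \<le> C1 * C2 * \<delta> * \<mu> j"
proof -
  have "weighted_integral \<tau> (\<lambda>p. norm (F j p) ^ 2) \<le> weighted_integral \<tau> (\<lambda>p. C1 * \<delta> * norm (F j p) ^ 1)"
    using F_sup[OF j]
    by (intro weighted_integral_mono \<tau> bcontfun_intros F_bcontfun j)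
      (auto simp: power2_eq_square intro!: mult_right_mono)
  also have "\<dots> \<le> C1 * \<delta> * (C2 * \<mu> j)"
    unfolding weighted_integral_cmult using F_mass[OF j] C1 \<delta> by (intro mult_left_mono) auto
  finally show ?thesis by (simp add: mult_ac)
qed

lemma cap_energy_2_le_overlap:
  assumes "\<And>a j. j \<in> cap l a \<Longrightarrow> real (card {i\<in>cap l a. weighted_inner \<tau> (F j) (F i) \<noteq> 0}) \<le> N" "0 \<le> N"
  shows "cap_energy 2 l \<le> N * (C1 * C2 * \<delta> * mass)"
proof -
  have "cap_energy 2 l \<le> (\<Sum>a\<in>caps l. N * (\<Sum>j\<in>cap l a. C1 * C2 * \<delta> * \<mu> j))"
    unfolding cap_energy_def
  proof (rule sum_mono)
    fix a
    have "weighted_integral \<tau> (\<lambda>p. (norm (layer_sum (cap l a) p))\<^sup>2)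
        \<le> N * (\<Sum>j\<in>cap l a. weighted_integral \<tau> (\<lambda>p. (norm (F j p))\<^sup>2))"
      unfolding layer_sum_def using cap_subset
      by (intro almost_orthogonality \<tau> finite_cap assms(1) F_bcontfun) auto
    also have "\<dots> \<le> N * (\<Sum>j\<in>cap l a. C1 * C2 * \<delta> * \<mu> j)"
      using assms(2) cap_subset by (intro mult_left_mono sum_mono weighted_integral_F_square_le) auto
    finally show "weighted_integral \<tau> (\<lambda>p. (norm (layer_sum (cap l a) p))\<^sup>2)
        \<le> N * (\<Sum>j\<in>cap l a. C1 * C2 * \<delta> * \<mu> j)" .
  qed
  also have "\<dots> = N * (C1 * C2 * \<delta> * (\<Sum>a\<in>caps l. \<Sum>j\<in>cap l a. \<mu> j))"
    by (simp add: sum_distrib_left)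
  also have "(\<Sum>a\<in>caps l. \<Sum>j\<in>cap l a. \<mu> j) = mass"
    unfolding mass_def cap_def by (rule sum.group[OF J(1) finite_caps]) (simp add: caps_def)
  finally show ?thesis .
qed

lemma cap_energy_2_trivial:
  assumes "\<delta> \<le> 1 / real k ^ l"
  shows "cap_energy 2 l \<le> 2 * (C1 * C2 * mass) / real k ^ l"
proof -
  let ?N = "2 / (real k ^ l * \<delta>)"
  have "1 \<le> 1 / (real k ^ l * \<delta>)" using assms \<delta> k_pos by (simp add: field_simps)
  then have N: "1 / (real k ^ l * \<delta>) + 1 \<le> ?N"
    using add_left_mono[of 1 "1 / (real k ^ l * \<delta>)" "1 / (real k ^ l * \<delta>)"] by (simp add: mult.commute)
  have "real (card {i\<in>cap l a. weighted_inner \<tau> (F j) (F i) \<noteq> 0}) \<le> ?N" for a j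
  proof -
    have "real (card {i\<in>cap l a. weighted_inner \<tau> (F j) (F i) \<noteq> 0}) \<le> real (card (cap l a))"
      by (intro of_nat_mono card_mono finite_cap) auto
    also have "\<dots> \<le> ?N" by (rule order_trans[OF card_cap_le N])
    finally show ?thesis .
  qed
  then have "cap_energy 2 l \<le> ?N * (C1 * C2 * \<delta> * mass)"
    using \<delta> by (intro cap_energy_2_le_overlap) auto
  then show ?thesis using \<delta> by simp
qed

text \<open>A frequency of the layer \<open>y\<close> reappears in the layer \<open>y + d\<close> only for \<open>d \<approx> 0\<close> and for
  \<open>d \<approx> - t / s\<close>; short caps exclude the second possibility.\<close>
lemma interacting_layers_frequency:
  assumes "weighted_inner \<tau> (F j) (F i) \<noteq> 0" "j \<in> J" "i \<in> J"
  obtains s t where "\<bar>s - v\<bar> \<le> 2 * h" "\<bar>t - r\<bar> \<le> 2 * g"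
    "\<bar>(of_int i - of_int j) * \<delta> * (s * ((of_int i - of_int j) * \<delta>) + t)\<bar> \<le> 5 * Y\<^sup>2"
proof -
  define y where "y = of_int j * \<delta>"
  define d where "d = (of_int i - of_int j) * \<delta>"
  have layer_i: "of_int i * \<delta> = y + d" by (simp add: y_def d_def algebra_simps)
  obtain \<xi> \<eta> where "\<xi> \<in> plank v h r g y" "\<eta> \<in> plank v h r g (y + d)" and near: "near \<tau> (\<xi> - \<eta>)"
    using weighted_inner_eq_0_if_far[OF \<tau>(1) F_band[OF assms(2)] F_band[OF assms(3)]] assms(1)
    unfolding layer_i y_def by blast
  then obtain s t s' t' where in_window: "\<bar>s' - v\<bar> \<le> 2 * h" "\<bar>t' - r\<bar> \<le> 2 * g"
    and \<xi>: "\<xi> = s *\<^sub>R cone_ray y + t *\<^sub>R cone_tangent y"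
    and \<eta>: "\<eta> = s' *\<^sub>R cone_ray (y + d) + t' *\<^sub>R cone_tangent (y + d)"
    unfolding plank_def by blast
  have "\<bar>y\<bar> \<le> Y" using J(2)[OF assms(2)] by (simp add: y_def)
  from recentred_quadratic_relation[where I="{..<2::nat}" and \<epsilon>="\<lambda>i. if i = 0 then 1 else - 1"
      and s="\<lambda>i. if i = 0 then s else s'" and t="\<lambda>i. if i = 0 then t else t'"
      and z="\<lambda>i. if i = 0 then 0 else d", OF _ \<tau>(2) this Y]
  have "\<bar>- (s' * d\<^sup>2 + t' * d)\<bar> \<le> 5 * Y\<^sup>2"
    using near by (simp add: \<xi> \<eta> numeral_2_eq_2 algebra_simps)
  also have "- (s' * d\<^sup>2 + t' * d) = - (d * (s' * d + t'))"
    by (simp add: power2_eq_square algebra_simps)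
  finally show ?thesis
    using that[OF in_window] by (simp add: d_def)
qed

lemma interacting_layers_close:
  assumes inner: "weighted_inner \<tau> (F j) (F i) \<noteq> 0" and in_cap: "i \<in> cap l a" "j \<in> cap l a"
    and \<rho>: "0 < \<rho>" and t: "\<And>t. \<bar>t - r\<bar> \<le> 2 * g \<Longrightarrow> \<rho> / 2 \<le> \<bar>t\<bar>"
    and short: "(\<bar>v\<bar> + 2 * h) / real k ^ l \<le> \<rho> / 4"
  shows "\<bar>of_int i - of_int j\<bar> \<le> 20 * Y\<^sup>2 / (\<rho> * \<delta>)"
proof -
  define d where "d = (of_int i - of_int j) * \<delta>"
  have "j \<in> J" "i \<in> J" using in_cap cap_subset by auto
  from interacting_layers_frequency[OF inner this] obtain s u
    where in_window: "\<bar>s - v\<bar> \<le> 2 * h" "\<bar>u - r\<bar> \<le> 2 * g" and resonance: "\<bar>d * (s * d + u)\<bar> \<le> 5 * Y\<^sup>2"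
    unfolding d_def by blast
  have "\<bar>d\<bar> \<le> 1 / real k ^ l"
    using cap_bounds[OF in_cap(1)] cap_bounds[OF in_cap(2)] by (auto simp: d_def left_diff_distrib)
  then have "\<bar>s * d\<bar> \<le> (\<bar>v\<bar> + 2 * h) * (1 / real k ^ l)"
    unfolding abs_mult using in_window(1) by (intro mult_mono) auto
  then have "\<bar>s * d\<bar> \<le> \<rho> / 4" using short by (simp only: times_divide_eq_right mult_1_right)
  with t[OF in_window(2)] have "\<rho> / 4 \<le> \<bar>s * d + u\<bar>" by linarith
  then have "\<bar>d\<bar> * (\<rho> / 4) \<le> \<bar>d\<bar> * \<bar>s * d + u\<bar>" by (intro mult_left_mono) auto
  also have "\<dots> \<le> 5 * Y\<^sup>2" using resonance by (simp add: abs_mult)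
  also have "\<bar>d\<bar> = \<bar>of_int i - of_int j\<bar> * \<delta>" using \<delta> by (simp add: d_def abs_mult)
  finally show ?thesis using \<rho> \<delta> by (simp add: pos_le_divide_eq mult_ac)
qed

lemma cap_energy_2_transversal:
  assumes \<rho>: "0 < \<rho>" "\<rho> \<le> 8 / \<delta>" and t: "\<And>t. \<bar>t - r\<bar> \<le> 2 * g \<Longrightarrow> \<rho> / 2 \<le> \<bar>t\<bar>"
    and short: "(\<bar>v\<bar> + 2 * h) / real k ^ l \<le> \<rho> / 4"
  shows "cap_energy 2 l \<le> 48 * Y\<^sup>2 / \<rho> * (C1 * C2 * mass)"
proof -
  define D where "D = 20 * Y\<^sup>2 / (\<rho> * \<delta>)"
  have D: "1 \<le> 8 * Y\<^sup>2 / (\<rho> * \<delta>)" "0 \<le> D"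
    using \<rho> \<delta> one_le_Y_square by (auto simp: field_simps D_def)
  have "cap_energy 2 l \<le> (48 * Y\<^sup>2 / (\<rho> * \<delta>)) * (C1 * C2 * \<delta> * mass)"
  proof (rule cap_energy_2_le_overlap)
    fix a j assume j: "j \<in> cap l a"
    let ?S = "{i\<in>cap l a. weighted_inner \<tau> (F j) (F i) \<noteq> 0}"
    have "real (card ?S) \<le> (of_int j + D) - (of_int j - D) + 1"
    proof (rule card_ints_in_interval_le)
      show "of_int j - D \<le> of_int i \<and> of_int i \<le> of_int j + D" if "i \<in> ?S" for i
        using interacting_layers_close[of j i l a \<rho>] that j \<rho>(1) t short by (auto simp: D_def abs_le_iff)
    qed (use D in simp)
    also have "\<dots> \<le> 2 * D + 8 * Y\<^sup>2 / (\<rho> * \<delta>)" using D by simp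
    also have "\<dots> = 48 * Y\<^sup>2 / (\<rho> * \<delta>)"
      by (simp add: D_def flip: add_divide_distrib)
    finally show "real (card ?S) \<le> 48 * Y\<^sup>2 / (\<rho> * \<delta>)" .
  qed (use \<rho> \<delta> in simp)
  then show ?thesis using \<delta> by simp
qed

lemma band_limited_layer_sum_cap:
  "band_limited (\<Union>j\<in>cap l a. plank v h r g (of_int j * \<delta>)) (layer_sum (cap l a))"
  unfolding layer_sum_def[abs_def] using cap_subset
  by (intro band_limited_sum band_limited_mono[OF F_band]) auto

lemma interacting_cap_pairs_frequencies:
  fixes b :: "nat \<Rightarrow> int"
  assumes "weighted_inner \<tau> (\<lambda>p. layer_sum (cap l (b 0)) p * layer_sum (cap l (b 1)) p)
    (\<lambda>p. layer_sum (cap l (b 2)) p * layer_sum (cap l (b 3)) p) \<noteq> 0"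
  obtains j :: "nat \<Rightarrow> int" and s t :: "nat \<Rightarrow> real" where
    "\<And>i. i < 4 \<Longrightarrow> j i \<in> cap l (b i)" "\<And>i. i < 4 \<Longrightarrow> \<bar>s i - v\<bar> \<le> 2 * h" "\<And>i. i < 4 \<Longrightarrow> \<bar>t i - r\<bar> \<le> 2 * g"
    "near \<tau> (\<Sum>i<4. pair_sign i *\<^sub>R
      (s i *\<^sub>R cone_ray (of_int (j i) * \<delta>) + t i *\<^sub>R cone_tangent (of_int (j i) * \<delta>)))"
proof -
  define P where "P a = (\<Union>j\<in>cap l a. plank v h r g (of_int j * \<delta>))" for a
  have "band_limited (P a + P c) (\<lambda>p. layer_sum (cap l a) p * layer_sum (cap l c) p)" for a c
    unfolding P_def by (intro band_limited_mult band_limited_layer_sum_cap)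
  then obtain \<xi> \<eta> where "\<xi> \<in> P (b 0) + P (b 1)" "\<eta> \<in> P (b 2) + P (b 3)" and near: "near \<tau> (\<xi> - \<eta>)"
    using weighted_inner_eq_0_if_far[OF \<tau>(1)] assms by meson
  then obtain x0 x1 x2 x3 where x: "x0 \<in> P (b 0)" "x1 \<in> P (b 1)" "x2 \<in> P (b 2)" "x3 \<in> P (b 3)"
    and sums: "\<xi> = x0 + x1" "\<eta> = x2 + x3"
    by (auto simp: set_plus_def)
  define \<zeta> where "\<zeta> = (!) [x0, x1, x2, x3]"
  have "\<zeta> i \<in> P (b i)" if "i < 4" for i
    using that x by (auto simp: \<zeta>_def less_Suc_eq eval_nat_numeral)
  then have "\<forall>i. \<exists>j s t. i < 4 \<longrightarrow> j \<in> cap l (b i) \<and> \<bar>s - v\<bar> \<le> 2 * h \<and> \<bar>t - r\<bar> \<le> 2 * g \<and>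
      \<zeta> i = s *\<^sub>R cone_ray (of_int j * \<delta>) + t *\<^sub>R cone_tangent (of_int j * \<delta>)"
    unfolding P_def plank_def by blast
  then obtain j s t where coordinates: "\<forall>i<4. j i \<in> cap l (b i) \<and> \<bar>s i - v\<bar> \<le> 2 * h \<and> \<bar>t i - r\<bar> \<le> 2 * g \<and>
      \<zeta> i = s i *\<^sub>R cone_ray (of_int (j i) * \<delta>) + t i *\<^sub>R cone_tangent (of_int (j i) * \<delta>)"
    by metis
  have "\<xi> - \<eta> = (\<Sum>i<4. pair_sign i *\<^sub>R \<zeta> i)"
    unfolding sum_pair_sign_scaleR sums by (simp add: \<zeta>_def)
  also have "\<dots> = (\<Sum>i<4. pair_sign i *\<^sub>R
      (s i *\<^sub>R cone_ray (of_int (j i) * \<delta>) + t i *\<^sub>R cone_tangent (of_int (j i) * \<delta>)))"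
    using coordinates by (intro sum.cong refl) auto
  finally show ?thesis
    using near by (intro that[of j s t]) (use coordinates in simp_all)
qed

lemma cap_index_close:
  assumes "j \<in> cap (Suc l) b" "j' \<in> cap (Suc l) b'"
    and "\<bar>of_int j * \<delta> - of_int j' * \<delta>\<bar> \<le> 7 * (1 / real k ^ l) / real k"
  shows "\<bar>b - b'\<bar> \<le> 8"
proof -
  have b: "b = \<lfloor>of_int j * \<delta> * real k ^ Suc l\<rfloor>" "b' = \<lfloor>of_int j' * \<delta> * real k ^ Suc l\<rfloor>"
    using assms(1,2) by (auto simp: cap_def cap_of_def)
  have "\<bar>of_int j * \<delta> * real k ^ Suc l - of_int j' * \<delta> * real k ^ Suc l\<bar>
      = \<bar>of_int j * \<delta> - of_int j' * \<delta>\<bar> * real k ^ Suc l"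
    by (simp add: abs_mult flip: left_diff_distrib)
  also have "\<dots> \<le> 7 * (1 / real k ^ l) / real k * real k ^ Suc l"
    using assms(3) by (intro mult_right_mono) auto
  also have "\<dots> = 7" using k_pos by simp
  finally show ?thesis unfolding b by linarith
qed

lemma interacting_cap_pairs_close:
  fixes b :: "nat \<Rightarrow> int"
  assumes inner: "weighted_inner \<tau> (\<lambda>p. layer_sum (cap (Suc l) (b 0)) p * layer_sum (cap (Suc l) (b 1)) p)
      (\<lambda>p. layer_sum (cap (Suc l) (b 2)) p * layer_sum (cap (Suc l) (b 3)) p) \<noteq> 0"
    and parent: "\<And>i. i < 4 \<Longrightarrow> b i div int k = a"
    and v: "v \<noteq> 0" "2 * h \<le> \<bar>v\<bar> / (real k)\<^sup>2" and t_le: "\<And>t. \<bar>t - r\<bar> \<le> 2 * g \<Longrightarrow> \<bar>t\<bar> \<le> \<rho>"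
    and \<rho>: "\<rho> \<le> (1 / real k ^ l) * \<bar>v\<bar> / (real k)\<^sup>2" and Q: "5 * Y\<^sup>2 \<le> (1 / real k ^ l)\<^sup>2 * \<bar>v\<bar> / (real k)\<^sup>2"
  shows "(\<bar>b 0 - b 2\<bar> \<le> 8 \<and> \<bar>b 1 - b 3\<bar> \<le> 8) \<or> (\<bar>b 0 - b 3\<bar> \<le> 8 \<and> \<bar>b 1 - b 2\<bar> \<le> 8)"
proof -
  obtain j s t where j: "\<And>i. i < 4 \<Longrightarrow> j i \<in> cap (Suc l) (b i)"
    and s: "\<And>i. i < 4 \<Longrightarrow> \<bar>s i - v\<bar> \<le> 2 * h" and t: "\<And>i. i < 4 \<Longrightarrow> \<bar>t i - r\<bar> \<le> 2 * g"
    and near: "near \<tau> (\<Sum>i<4. pair_sign i *\<^sub>R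
      (s i *\<^sub>R cone_ray (of_int (j i) * \<delta>) + t i *\<^sub>R cone_tangent (of_int (j i) * \<delta>)))"
    using interacting_cap_pairs_frequencies[where b=b, OF inner] by blast
  define \<sigma> where "\<sigma> = 1 / real k ^ l"
  define y0 where "y0 = of_int a / real k ^ l"
  define z where "z i = of_int (j i) * \<delta> - y0" for i
  have \<sigma>: "0 < \<sigma>" "\<sigma> \<le> 1" using k_pos k by (auto simp: \<sigma>_def)
  have z: "z i \<in> {0..\<sigma>}" if "i < 4" for i
    using cap_bounds[of "j i" l a] cap_Suc_subset[OF parent[OF that], of l] j[OF that]
    by (auto simp: z_def y0_def \<sigma>_def)
  have "j 0 \<in> J" using j[of 0] cap_subset by auto
  then have y0: "\<bar>y0\<bar> \<le> Y" using J(2)[of "j 0"] z[of 0] \<sigma> by (auto simp: z_def abs_le_iff)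
  have "of_int (j i) * \<delta> = y0 + z i" for i by (simp add: z_def)
  note relation = near[unfolded this] \<tau>(2) y0 Y
  have s_close: "\<bar>s i - v\<bar> \<le> \<bar>v\<bar> / (real k)\<^sup>2" if "i < 4" for i using s[OF that] v(2) by linarith
  have "1 \<le> real k" using k by simp
  from close_pairs_of_perturbed_power_sums[OF z \<sigma> this v(1) s_close t_le[OF t] \<rho>[folded \<sigma>_def] Q[folded \<sigma>_def]
      recentred_linear_relation[OF relation] recentred_quadratic_relation[OF relation]]
  have "(\<bar>z 0 - z 2\<bar> \<le> 7 * \<sigma> / k \<and> \<bar>z 1 - z 3\<bar> \<le> 7 * \<sigma> / k) \<or>
      (\<bar>z 0 - z 3\<bar> \<le> 7 * \<sigma> / k \<and> \<bar>z 1 - z 2\<bar> \<le> 7 * \<sigma> / k)"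
    by simp
  moreover have "\<bar>b i - b i'\<bar> \<le> 8" if "i < 4" "i' < 4" "\<bar>z i - z i'\<bar> \<le> 7 * \<sigma> / k" for i i'
    using that(3) by (intro cap_index_close[OF j[OF that(1)] j[OF that(2)]]) (simp add: z_def \<sigma>_def)
  ultimately show ?thesis by auto
qed

text \<open>One step of \<open>L\<^sup>4\<close> decoupling: at this angular scale the truncated cone is
  indistinguishable from a parabolic cylinder, so products of pairs of caps are almost orthogonal.\<close>
lemma cap_energy_4_Suc:
  assumes v: "v \<noteq> 0" "2 * h \<le> \<bar>v\<bar> / (real k)\<^sup>2" and t: "\<And>t. \<bar>t - r\<bar> \<le> 2 * g \<Longrightarrow> \<bar>t\<bar> \<le> \<rho>"
    and \<rho>: "\<rho> \<le> (1 / real k ^ l) * \<bar>v\<bar> / (real k)\<^sup>2" and Q: "5 * Y\<^sup>2 \<le> (1 / real k ^ l)\<^sup>2 * \<bar>v\<bar> / (real k)\<^sup>2"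
  shows "cap_energy 4 l \<le> 578 * real k * cap_energy 4 (Suc l)"
proof -
  define x where "x b = layer_sum (cap (Suc l) b)" for b
  define W where "W b = weighted_integral \<tau> (\<lambda>p. norm (x b p) ^ 4)" for b
  have W_nonneg: "0 \<le> W b" for b unfolding W_def by (rule weighted_integral_nonneg) simp
  have overlap: "real (card {q \<in> child_caps l a \<times> child_caps l a.
      weighted_inner \<tau> (\<lambda>p. x b p * x c p) (\<lambda>p. x (fst q) p * x (snd q) p) \<noteq> 0}) \<le> 578"
    (is "real (card ?S) \<le> _") if in_parent: "b \<in> child_caps l a" "c \<in> child_caps l a" for a b c
  proof -
    let ?I = "\<lambda>b. {b - 8..b + 8}"
    have "?S \<subseteq> (?I b \<times> ?I c) \<union> (?I c \<times> ?I b)"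
    proof
      fix q assume q: "q \<in> ?S"
      define bs where "bs = (!) [b, c, fst q, snd q]"
      have "bs i div int k = a" if "i < 4" for i
        using that in_parent q by (auto simp: bs_def child_caps_def less_Suc_eq eval_nat_numeral)
      then have "(\<bar>bs 0 - bs 2\<bar> \<le> 8 \<and> \<bar>bs 1 - bs 3\<bar> \<le> 8) \<or> (\<bar>bs 0 - bs 3\<bar> \<le> 8 \<and> \<bar>bs 1 - bs 2\<bar> \<le> 8)"
        using q by (intro interacting_cap_pairs_close[OF _ _ v t \<rho> Q]) (auto simp: bs_def x_def)
      then show "q \<in> (?I b \<times> ?I c) \<union> (?I c \<times> ?I b)"
        by (cases q) (auto simp: bs_def)
    qed
    then have "card ?S \<le> card (?I b \<times> ?I c) + card (?I c \<times> ?I b)"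
      by (intro order_trans[OF card_mono card_Un_le]) auto
    then show ?thesis by (simp add: card_cartesian_product)
  qed
  have "weighted_integral \<tau> (\<lambda>p. norm (layer_sum (cap l a) p) ^ 4) \<le> 578 * (real k * (\<Sum>b\<in>child_caps l a. W b))" for a
  proof -
    have "weighted_integral \<tau> (\<lambda>p. norm (layer_sum (cap l a) p) ^ 4)
        \<le> 578 * (real (card (child_caps l a)) * (\<Sum>b\<in>child_caps l a. W b))"
      unfolding layer_sum_cap_eq W_def x_def[symmetric]
      by (intro bilinear_L4_orthogonality \<tau> overlap)
        (auto simp: finite_child_caps x_def layer_sum_cap_bcontfun)
    also have "\<dots> \<le> 578 * (real k * (\<Sum>b\<in>child_caps l a. W b))"
      using card_child_caps_le W_nonneg by (intro mult_left_mono mult_right_mono sum_nonneg) auto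
    finally show ?thesis .
  qed
  then have "cap_energy 4 l \<le> (\<Sum>a\<in>caps l. 578 * (real k * (\<Sum>b\<in>child_caps l a. W b)))"
    unfolding cap_energy_def by (intro sum_mono)
  also have "\<dots> = 578 * real k * cap_energy 4 (Suc l)"
    unfolding sum_distrib_left[symmetric] sum_child_caps by (simp add: cap_energy_def W_def x_def)
  finally show ?thesis .
qed

lemma cap_energy_4_decoupling:
  assumes v: "v \<noteq> 0" "2 * h \<le> \<bar>v\<bar> / (real k)\<^sup>2" and t: "\<And>t. \<bar>t - r\<bar> \<le> 2 * g \<Longrightarrow> \<bar>t\<bar> \<le> \<rho>"
    and scales: "\<And>i. i < l \<Longrightarrow>
      \<rho> \<le> (1 / real k ^ i) * \<bar>v\<bar> / (real k)\<^sup>2 \<and> 5 * Y\<^sup>2 \<le> (1 / real k ^ i)\<^sup>2 * \<bar>v\<bar> / (real k)\<^sup>2"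
  shows "cap_energy 4 0 \<le> (578 * real k) ^ l * cap_energy 4 l"
  using scales
proof (induction l)
  case (Suc l)
  have "cap_energy 4 0 \<le> (578 * real k) ^ l * cap_energy 4 l" using Suc by simp
  also have "\<dots> \<le> (578 * real k) ^ l * (578 * real k * cap_energy 4 (Suc l))"
    using Suc.prems[of l] by (intro mult_left_mono cap_energy_4_Suc[OF v t]) auto
  finally show ?case by (simp add: mult_ac)
qed simp

lemma cap_energy_4_trivial:
  assumes "\<delta> \<le> 1 / real k ^ l"
  shows "cap_energy 4 l \<le> 8 * (C1 ^ 3 * C2 * mass) / real k ^ (3 * l)"
proof -
  have "cap_energy 4 l \<le> (2 * C1 / real k ^ l)\<^sup>2 * (2 * (C1 * C2 * mass) / real k ^ l)"
    using cap_energy_4_le_2[OF assms] cap_energy_2_trivial[OF assms]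
    by (meson mult_left_mono order_trans zero_le_power2)
  also have "\<dots> = 8 * (C1 ^ 3 * C2 * mass) / (real k ^ l) ^ 3"
    by (simp add: power_divide power2_eq_square power3_eq_cube mult_ac)
  finally show ?thesis by (simp add: power_mult mult.commute[of 3] flip: power_mult)
qed

end

text \<open>The windows are much narrower than their distance from the origin unless that distance is
  \<open>O(k\<^sup>2)\<close>; \<open>L\<close> bounds the number of angular scales.\<close>
locale cone_windows = cone_layers +
  fixes L :: nat
  assumes widths: "0 < h" "0 < g"
    and v_window: "2 * h * (real k)\<^sup>2 \<le> \<bar>v\<bar> \<or> \<bar>v\<bar> + 2 * h \<le> 4 * (real k)\<^sup>2"
    and r_window: "2 * g * (real k)\<^sup>2 \<le> \<bar>r\<bar> \<or> \<bar>r\<bar> + 2 * g \<le> 4 * (real k)\<^sup>2"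
    and v_size: "\<bar>v\<bar> + 2 * h \<le> 8 / \<delta>" and r_size: "\<bar>r\<bar> + 2 * g \<le> 8 / \<delta>"
    and v_le: "\<bar>v\<bar> \<le> real k ^ (2 * L)"
begin

definition \<rho> :: real where
  "\<rho> = \<bar>r\<bar> + 2 * g"

definition X :: real where
  "X = \<bar>v\<bar> + 2 * h + \<rho>"

definition C0 :: real where
  "C0 = C1 ^ 3 * C2 * mass"

text \<open>Decoupling is possible up to the angular scale at which the caps resolve either the tangential
  frequencies or the uncertainty principle.\<close>
definition decouplable :: "nat \<Rightarrow> bool" where
  "decouplable i \<longleftrightarrow> \<rho> * real k ^ (i + 2) < \<bar>v\<bar> \<and> 5 * Y\<^sup>2 * real k ^ (2 * i + 2) \<le> \<bar>v\<bar>"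

definition final_scale :: nat where
  "final_scale = (LEAST l. \<not> decouplable l)"

lemma positivity: "0 < \<rho>" "0 < X" "0 \<le> C0"
  using widths C1 C2 mass_nonneg by (auto simp: \<rho>_def X_def C0_def)

lemma k_power_mono: "m \<le> n \<Longrightarrow> real k ^ m \<le> real k ^ n"
  using k by (intro power_increasing) auto

lemma k_square: "64 \<le> (real k)\<^sup>2" "(real k)\<^sup>2 \<le> real k ^ 8"
  using power_mono[of 8 "real k" 2] k k_power_mono[of 2 8] by auto

lemma not_decouplable_final_scale: "\<not> decouplable final_scale"
proof -
  obtain l where "\<bar>v\<bar> / \<rho> < real k ^ l" using real_arch_pow[of "real k" "\<bar>v\<bar> / \<rho>"] k by auto
  also have "real k ^ l \<le> real k ^ (l + 2)" by (rule k_power_mono) simp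
  finally have "\<not> decouplable l"
    using positivity by (auto simp: decouplable_def pos_divide_less_eq mult.commute)
  then show ?thesis unfolding final_scale_def by (rule LeastI)
qed

lemma decouplable_before_final_scale: "i < final_scale \<Longrightarrow> decouplable i"
  using not_less_Least unfolding final_scale_def by blast

lemma k_power_final_scale_le:
  assumes "0 < final_scale"
  shows "real k ^ (2 * final_scale) \<le> \<bar>v\<bar>"
proof -
  obtain i where i: "final_scale = Suc i" using assms gr0_implies_Suc by blast
  have "1 * real k ^ (2 * i + 2) \<le> 5 * Y\<^sup>2 * real k ^ (2 * i + 2)"
    using one_le_Y_square by (intro mult_right_mono) auto
  also have "\<dots> \<le> \<bar>v\<bar>"
    using decouplable_before_final_scale[of i] i by (simp add: decouplable_def)
  finally show ?thesis by (simp add: i)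
qed

lemma final_scale_le: "final_scale \<le> L"
proof (cases "final_scale = 0")
  case False
  then have "real k ^ (2 * final_scale) \<le> real k ^ (2 * L)"
    using k_power_final_scale_le v_le by simp
  then show ?thesis using k by (simp add: power_increasing_iff)
qed simp

lemma \<delta>_le_final_scale: "\<delta> \<le> 1 / real k ^ final_scale"
proof (cases "final_scale = 0")
  case False
  then have "(real k ^ final_scale)\<^sup>2 \<le> 8 / \<delta>"
    using k_power_final_scale_le v_size widths by (simp add: power_mult mult.commute flip: power_mult)
  also have "\<dots> \<le> (1 / \<delta>)\<^sup>2" using \<delta> by (simp add: power2_eq_square field_simps)
  finally have "real k ^ final_scale \<le> 1 / \<delta>" by (rule power2_le_imp_le) (use \<delta> in simp)
  then show ?thesis using \<delta> k_pos by (simp add: field_simps)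
qed (use \<delta> in simp)

lemma cap_energy_4_transversal:
  assumes "\<delta> \<le> 1 / real k ^ l" and r: "2 * g * (real k)\<^sup>2 \<le> \<bar>r\<bar>"
    and short: "(\<bar>v\<bar> + 2 * h) / real k ^ (l + 3) \<le> \<rho> / 4"
  shows "cap_energy 4 l \<le> 192 * Y\<^sup>2 * C0 * real k ^ 3 / (\<rho> * real k ^ (2 * l))"
proof -
  have "2 * g * 64 \<le> 2 * g * (real k)\<^sup>2" using k_square widths by (intro mult_left_mono) auto
  then have "6 * g \<le> \<bar>r\<bar>" using r widths by linarith
  then have t_ge: "\<rho> / 2 \<le> \<bar>t\<bar>" if "\<bar>t - r\<bar> \<le> 2 * g" for t
    using that by (simp add: \<rho>_def)
  have "cap_energy 2 l \<le> real k ^ 3 * cap_energy 2 (l + 3)" by (rule cap_energy_2_add)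
  also have "\<dots> \<le> real k ^ 3 * (48 * Y\<^sup>2 / \<rho> * (C1 * C2 * mass))"
    using positivity r_size t_ge short
    by (intro mult_left_mono cap_energy_2_transversal) (auto simp: \<rho>_def)
  finally have energy_2: "cap_energy 2 l \<le> real k ^ 3 * (48 * Y\<^sup>2 / \<rho> * (C1 * C2 * mass))" .
  have "cap_energy 4 l \<le> (2 * C1 / real k ^ l)\<^sup>2 * cap_energy 2 l"
    by (rule cap_energy_4_le_2) fact
  also have "\<dots> \<le> (2 * C1 / real k ^ l)\<^sup>2 * (real k ^ 3 * (48 * Y\<^sup>2 / \<rho> * (C1 * C2 * mass)))"
    by (intro mult_left_mono energy_2) simp
  also have "\<dots> = 192 * Y\<^sup>2 * C0 * real k ^ 3 / (\<rho> * (real k ^ l)\<^sup>2)"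
    unfolding C0_def
    by (simp add: power_divide power_mult_distrib power3_eq_cube[of C1] power2_eq_square[of C1] mult_ac)
  finally show ?thesis by (simp add: power_mult mult.commute[of 2] flip: power_mult)
qed

lemma v_wide_if_large:
  assumes large: "100 * real k ^ 8 < X" and "\<rho> \<le> \<bar>v\<bar>"
  shows "2 * h * (real k)\<^sup>2 \<le> \<bar>v\<bar>"
proof (rule ccontr)
  assume "\<not> 2 * h * (real k)\<^sup>2 \<le> \<bar>v\<bar>"
  then have "\<bar>v\<bar> + 2 * h \<le> 4 * (real k)\<^sup>2" using v_window by simp
  then have "X \<le> 8 * (real k)\<^sup>2" using assms(2) widths by (simp add: X_def)
  then show False using large k_power_mono[of 2 8] k_square by simp
qed

lemma decoupling_to_final_scale:
  assumes large: "100 * real k ^ 8 < X"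
  shows "cap_energy 4 0 \<le> (578 * real k) ^ final_scale * cap_energy 4 final_scale"
proof (cases "final_scale = 0")
  case False
  then have "\<rho> * (real k)\<^sup>2 < \<bar>v\<bar>"
    using decouplable_before_final_scale[of 0] by (simp add: decouplable_def power2_eq_square)
  moreover have "\<rho> * 1 \<le> \<rho> * (real k)\<^sup>2" using positivity k_square by (intro mult_left_mono) auto
  ultimately have "\<rho> \<le> \<bar>v\<bar>" by linarith
  from v_wide_if_large[OF large this] have h: "2 * h \<le> \<bar>v\<bar> / (real k)\<^sup>2"
    using k_pos by (simp add: pos_le_divide_eq)
  have scale: "x \<le> 1 / P * \<bar>v\<bar> / q" if "x * (P * q) \<le> \<bar>v\<bar>" "0 < P" "0 < q" for x P q
    using that by (simp add: field_simps)
  show ?thesis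
  proof (rule cap_energy_4_decoupling[where \<rho>=\<rho>, OF _ h])
    show "v \<noteq> 0" using \<open>\<rho> \<le> \<bar>v\<bar>\<close> positivity by auto
    show "\<bar>t\<bar> \<le> \<rho>" if "\<bar>t - r\<bar> \<le> 2 * g" for t using that unfolding \<rho>_def by linarith
    fix i assume i: "i < final_scale"
    have "real k ^ (i + 2) = real k ^ i * (real k)\<^sup>2" "real k ^ (2 * i + 2) = (real k ^ i)\<^sup>2 * (real k)\<^sup>2"
      by (simp_all only: power_add power_even_eq)
    from decouplable_before_final_scale[OF i, unfolded decouplable_def this]
    have "\<rho> * (real k ^ i * (real k)\<^sup>2) \<le> \<bar>v\<bar>" "5 * Y\<^sup>2 * ((real k ^ i)\<^sup>2 * (real k)\<^sup>2) \<le> \<bar>v\<bar>"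
      by linarith+
    then show "\<rho> \<le> 1 / real k ^ i * \<bar>v\<bar> / (real k)\<^sup>2 \<and> 5 * Y\<^sup>2 \<le> (1 / real k ^ i)\<^sup>2 * \<bar>v\<bar> / (real k)\<^sup>2"
      unfolding power_one_over[of "real k ^ i"] using k_pos by (intro conjI scale) (auto simp: power_one_over)
  qed
qed simp

lemma final_energy_uncertain:
  assumes large: "100 * real k ^ 8 < X" and \<rho>_less: "\<rho> * real k ^ (final_scale + 2) < \<bar>v\<bar>"
  shows "real k ^ final_scale * cap_energy 4 final_scale \<le> 800 * Y\<^sup>2 * C0 * (real k ^ 8 / X)"
proof -
  define l where "l = final_scale"
  have "\<rho> * 1 \<le> \<rho> * real k ^ (l + 2)" using positivity k by (intro mult_left_mono one_le_power) auto
  then have "\<rho> \<le> \<bar>v\<bar>" using \<rho>_less by (simp add: l_def)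
  moreover have "2 * h * 1 \<le> 2 * h * (real k)\<^sup>2" using widths k_square by (intro mult_left_mono) auto
  ultimately have "X \<le> 3 * \<bar>v\<bar>"
    using v_wide_if_large[OF large] unfolding X_def by linarith
  also have "\<dots> \<le> 3 * (5 * Y\<^sup>2 * real k ^ (2 * l + 2))"
    using not_decouplable_final_scale \<rho>_less unfolding decouplable_def l_def by argo
  also have "\<dots> = 15 * Y\<^sup>2 * (real k)\<^sup>2 * real k ^ (2 * l)"
    by (simp add: power_add power2_eq_square mult_ac)
  finally have X_le: "1 / real k ^ (2 * l) \<le> 15 * Y\<^sup>2 * (real k)\<^sup>2 / X"
    using positivity k_pos by (simp add: field_simps)
  have "real k ^ l * cap_energy 4 l \<le> real k ^ l * (8 * C0 / real k ^ (3 * l))"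
    unfolding l_def C0_def by (intro mult_left_mono cap_energy_4_trivial \<delta>_le_final_scale) simp
  also have "\<dots> = 8 * C0 * (1 / real k ^ (2 * l))"
    using k_pos by (simp add: numeral_3_eq_3 numeral_2_eq_2 power_add)
  also have "\<dots> \<le> 8 * C0 * (15 * Y\<^sup>2 * (real k)\<^sup>2 / X)"
    using positivity X_le by (intro mult_left_mono) auto
  also have "\<dots> = 120 * Y\<^sup>2 * C0 * ((real k)\<^sup>2 / X)" by simp
  also have "\<dots> \<le> 800 * Y\<^sup>2 * C0 * (real k ^ 8 / X)"
    using positivity k_power_mono[of 2 8] by (intro mult_mono divide_right_mono) auto
  finally show ?thesis by (simp add: l_def)
qed

lemma
  assumes large: "100 * real k ^ 8 < X" and \<rho>_ge: "\<bar>v\<bar> \<le> \<rho> * real k ^ (l + 2)"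
  shows v_le_if_tangential: "\<bar>v\<bar> + 2 * h \<le> 2 * (\<rho> * real k ^ (l + 2))"
    and X_le_if_tangential: "X \<le> 3 * (\<rho> * real k ^ (l + 2))"
proof -
  have \<rho>_le: "\<rho> * 1 \<le> \<rho> * real k ^ (l + 2)" using positivity k by (intro mult_left_mono one_le_power) auto
  have "2 * h * 1 \<le> 2 * h * (real k)\<^sup>2" using widths k_square by (intro mult_left_mono) auto
  then consider (away) "2 * h \<le> \<bar>v\<bar>" | (central) "\<bar>v\<bar> + 2 * h \<le> 4 * (real k)\<^sup>2"
    using v_window by linarith
  then have "2 * h \<le> \<rho> * real k ^ (l + 2)"
  proof cases
    case central
    then have "2 * h \<le> \<rho>"
      using large k_square unfolding X_def by linarith
    then show ?thesis using \<rho>_le by simp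
  qed (use \<rho>_ge in simp)
  then show "\<bar>v\<bar> + 2 * h \<le> 2 * (\<rho> * real k ^ (l + 2))" "X \<le> 3 * (\<rho> * real k ^ (l + 2))"
    using \<rho>_ge \<rho>_le unfolding X_def by auto
qed

lemma r_wide_if_tangential:
  assumes large: "100 * real k ^ 8 < X" and \<rho>_ge: "\<bar>v\<bar> \<le> \<rho> * real k ^ (final_scale + 2)"
  shows "2 * g * (real k)\<^sup>2 \<le> \<bar>r\<bar>"
proof (rule ccontr)
  assume "\<not> 2 * g * (real k)\<^sup>2 \<le> \<bar>r\<bar>"
  then have \<rho>_le: "\<rho> \<le> 4 * (real k)\<^sup>2" using r_window by (simp add: \<rho>_def)
  then have "\<rho> * real k ^ (final_scale + 2) \<le> 4 * (real k)\<^sup>2 * real k ^ (final_scale + 2)"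
    by (intro mult_right_mono) auto
  then have v_upper: "\<bar>v\<bar> \<le> 4 * real k ^ 4 * real k ^ final_scale"
    using \<rho>_ge by (simp add: power_add numeral_eq_Suc)
  have "\<bar>v\<bar> \<le> 16 * real k ^ 8"
  proof (cases "final_scale = 0")
    case True
    then show ?thesis using v_upper k_power_mono[of 4 8] by simp
  next
    case False
    have "\<bar>v\<bar> * \<bar>v\<bar> \<le> (4 * real k ^ 4 * real k ^ final_scale) * (4 * real k ^ 4 * real k ^ final_scale)"
      using v_upper by (intro mult_mono) auto
    also have "\<dots> = 16 * (real k ^ 4 * real k ^ 4) * (real k ^ final_scale * real k ^ final_scale)"
      by simp
    also have "\<dots> = 16 * real k ^ 8 * real k ^ (2 * final_scale)"
      by (simp flip: power_add mult_2)
    also have "\<dots> \<le> 16 * real k ^ 8 * \<bar>v\<bar>"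
      using False k_power_final_scale_le by (intro mult_left_mono) auto
    finally have "\<bar>v\<bar> * \<bar>v\<bar> \<le> 16 * real k ^ 8 * \<bar>v\<bar>" .
    moreover have "0 < \<bar>v\<bar>"
      using k_power_final_scale_le k_pos(3)[of "2 * final_scale"] False by linarith
    ultimately show ?thesis by (rule mult_right_le_imp_le)
  qed
  moreover have "2 * h * 1 \<le> 2 * h * (real k)\<^sup>2" using widths k_square by (intro mult_left_mono) auto
  ultimately show False
    using v_window \<rho>_le large k_square unfolding X_def by linarith
qed

lemma final_energy_tangential:
  assumes large: "100 * real k ^ 8 < X" and \<rho>_ge: "\<bar>v\<bar> \<le> \<rho> * real k ^ (final_scale + 2)"
  shows "real k ^ final_scale * cap_energy 4 final_scale \<le> 800 * Y\<^sup>2 * C0 * (real k ^ 8 / X)"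
proof -
  define l where "l = final_scale"
  note tangential = large \<rho>_ge[folded l_def]
  have "(\<bar>v\<bar> + 2 * h) / real k ^ (l + 3) \<le> 2 * (\<rho> * real k ^ (l + 2)) / real k ^ (l + 3)"
    using v_le_if_tangential[OF tangential] by (intro divide_right_mono) auto
  also have "\<dots> = 2 * \<rho> / real k" using k_pos by (simp add: power_add numeral_eq_Suc)
  also have "\<dots> \<le> 2 * \<rho> / 8" using k positivity by (intro divide_left_mono) auto
  finally have short: "(\<bar>v\<bar> + 2 * h) / real k ^ (l + 3) \<le> \<rho> / 4" by simp
  have "X \<le> 3 * (real k)\<^sup>2 * (\<rho> * real k ^ l)"
    using X_le_if_tangential[OF tangential] by (simp add: power_add power2_eq_square mult_ac)
  then have X_le: "1 / (\<rho> * real k ^ l) \<le> 3 * (real k)\<^sup>2 / X"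
    using positivity k_pos by (simp add: field_simps)
  have "real k ^ l * cap_energy 4 l
      \<le> real k ^ l * (192 * Y\<^sup>2 * C0 * real k ^ 3 / (\<rho> * real k ^ (2 * l)))"
    using \<delta>_le_final_scale r_wide_if_tangential[OF large \<rho>_ge] short
    by (intro mult_left_mono cap_energy_4_transversal) (auto simp: l_def)
  also have "\<dots> = 192 * Y\<^sup>2 * C0 * real k ^ 3 * (1 / (\<rho> * real k ^ l))"
    using k_pos by (simp add: mult_2 power_add)
  also have "\<dots> \<le> 192 * Y\<^sup>2 * C0 * real k ^ 3 * (3 * (real k)\<^sup>2 / X)"
    using positivity X_le by (intro mult_left_mono) auto
  also have "\<dots> = 576 * Y\<^sup>2 * C0 * (real k ^ 5 / X)" by (simp add: numeral_eq_Suc mult_ac)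
  also have "\<dots> \<le> 800 * Y\<^sup>2 * C0 * (real k ^ 8 / X)"
    using positivity k_power_mono[of 5 8] by (intro mult_mono divide_right_mono) auto
  finally show ?thesis by (simp add: l_def)
qed

lemma exists_decoupling_scale:
  obtains l where "l \<le> L" "cap_energy 4 0 \<le> (578 * real k) ^ l * cap_energy 4 l"
    "real k ^ l * cap_energy 4 l \<le> 800 * Y\<^sup>2 * C0 * (real k ^ 8 / X)"
proof (cases "X \<le> 100 * real k ^ 8")
  case True
  have "cap_energy 4 0 \<le> 8 * C0 * 1"
    using cap_energy_4_trivial[of 0] \<delta> by (simp add: C0_def)
  also have "\<dots> \<le> 8 * C0 * (Y\<^sup>2 * (100 * real k ^ 8 / X))"
    using True positivity one_le_Y_square mult_mono[of 1 "Y\<^sup>2" 1 "100 * real k ^ 8 / X"]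
    by (intro mult_left_mono) auto
  finally show ?thesis using that[of 0] by (simp add: mult_ac)
next
  case False
  then have large: "100 * real k ^ 8 < X" by simp
  show ?thesis
    using that[OF final_scale_le decoupling_to_final_scale[OF large]]
      final_energy_uncertain[OF large] final_energy_tangential[OF large] by linarith
qed

theorem weighted_integral_power4_le:
  "weighted_integral \<tau> (\<lambda>p. norm (layer_sum J p) ^ 4) \<le> 21600 * Y ^ 5 * 578 ^ L * C0 * (real k ^ 8 / X)"
proof -
  obtain l where l: "l \<le> L" "cap_energy 4 0 \<le> (578 * real k) ^ l * cap_energy 4 l"
    "real k ^ l * cap_energy 4 l \<le> 800 * Y\<^sup>2 * C0 * (real k ^ 8 / X)"
    by (rule exists_decoupling_scale)
  have "weighted_integral \<tau> (\<lambda>p. norm (layer_sum J p) ^ 4) \<le> 27 * Y ^ 3 * ((578 * real k) ^ l * cap_energy 4 l)"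
    using weighted_integral_power4_le_cap_energy l(2) Y
    by (meson mult_left_mono order_trans mult_nonneg_nonneg zero_le_numeral zero_le_power zero_le_one)
  also have "\<dots> = 27 * Y ^ 3 * 578 ^ l * (real k ^ l * cap_energy 4 l)"
    by (simp add: power_mult_distrib mult_ac)
  also have "\<dots> \<le> 27 * Y ^ 3 * 578 ^ l * (800 * Y\<^sup>2 * C0 * (real k ^ 8 / X))"
    using l(3) Y by (intro mult_left_mono) auto
  also have "\<dots> \<le> 27 * Y ^ 3 * 578 ^ L * (800 * Y\<^sup>2 * C0 * (real k ^ 8 / X))"
    using l(1) Y positivity by (intro mult_right_mono mult_left_mono power_increasing) auto
  also have "\<dots> = 21600 * Y ^ 5 * 578 ^ L * C0 * (real k ^ 8 / X)"
    by (simp add: numeral_eq_Suc mult_ac)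
  finally show ?thesis .
qed

end

section \<open>Frequency windows\<close>

lemma modulated_fejer_refine:
  assumes "K > 0"
  shows "of_nat K * modulated_fejer v (real K * h) z =
    (\<Sum>j<K. \<Sum>i<K. modulated_fejer (v + 2 * (real j + real i + 1 - real K) * h) h z) / of_nat K"
proof -
  let ?D = "\<Sum>j<K. cis ((2 * real j + 1 - real K) * (h * z))"
  let ?s = "complex_of_real (sinc_fun (h * z))"
  have sinc: "complex_of_real (sinc_fun (real K * h * z)) = ?D * ?s / of_nat K"
    using sinc_fun_mult_nat[OF assms, of "h * z"] by (simp add: mult.assoc)
  have "of_nat K * modulated_fejer v (real K * h) z = of_nat K * (cis (v * z) * (?D * ?s / of_nat K) * (?D * ?s / of_nat K))"
    unfolding modulated_fejer_def fejer_def power2_eq_square of_real_mult sinc by (simp only: mult.assoc)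
  also have "\<dots> = cis (v * z) * (?D * ?D) * (?s * ?s) / of_nat K"
    using assms by (simp add: field_simps)
  also have "cis (v * z) * (?D * ?D) = (\<Sum>j<K. \<Sum>i<K. cis ((v + 2 * (real j + real i + 1 - real K) * h) * z))"
  proof -
    have "cis (v * z) * (cis ((2 * real j + 1 - real K) * (h * z)) * cis ((2 * real i + 1 - real K) * (h * z)))
        = cis ((v + 2 * (real j + real i + 1 - real K) * h) * z)" for i j
      by (simp add: cis_mult) (rule arg_cong[where f=cis], simp add: algebra_simps)
    then show ?thesis
      by (simp only: sum_product) (simp only: sum_distrib_left)
  qed
  finally show ?thesis
    unfolding modulated_fejer_def fejer_def power2_eq_square of_real_mult by (simp only: sum_distrib_right)
qed

definition freq_window :: "nat \<Rightarrow> nat \<Rightarrow> int \<Rightarrow> real \<Rightarrow> complex" where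
  "freq_window K e i z = of_nat (K ^ e) * modulated_fejer (2 * of_int i * real (K ^ e)) (real (K ^ e)) z"

definition low_indices :: "nat \<Rightarrow> int set" where
  "low_indices K = {i. \<bar>i\<bar> < int K}"

definition high_indices :: "nat \<Rightarrow> int set" where
  "high_indices K = {i. int K \<le> \<bar>i\<bar> \<and> \<bar>i\<bar> < int K ^ 2}"

definition refinements :: "nat \<Rightarrow> (int \<times> nat \<times> nat) set" where
  "refinements K = low_indices K \<times> {..<K} \<times> {..<K}"

definition refined_index :: "nat \<Rightarrow> int \<times> nat \<times> nat \<Rightarrow> int" where
  "refined_index K = (\<lambda>(i, j, l). i * int K + int j + int l + 1 - int K)"

lemma finite_abs_less: "finite {i::int. \<bar>i\<bar> < n}"
  by (rule finite_subset[of _ "{-n..n}"]) auto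

lemma finite_low_indices: "finite (low_indices K)"
  unfolding low_indices_def by (rule finite_abs_less)

lemma finite_high_indices: "finite (high_indices K)"
  unfolding high_indices_def by (rule finite_subset[OF _ finite_abs_less[of "int K ^ 2"]]) auto

lemma low_Un_high_indices:
  assumes "K > 0"
  shows "low_indices K \<union> high_indices K = {i. \<bar>i\<bar> < int K ^ 2}"
proof -
  have "int K \<le> int K ^ 2" using assms self_le_power[of "int K" 2] by simp
  then have "\<bar>i\<bar> < int K ^ 2" if "\<bar>i\<bar> < int K" for i using that by linarith
  then show ?thesis by (auto simp: low_indices_def high_indices_def)
qed

lemma low_Int_high_indices: "low_indices K \<inter> high_indices K = {}"
  by (auto simp: low_indices_def high_indices_def)

lemma freq_window_refine:
  assumes "K > 0"
  shows "freq_window K (Suc e) i z =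
    (\<Sum>j<K. \<Sum>l<K. freq_window K e (refined_index K (i, j, l)) z) / of_nat K"
proof -
  let ?h = "real (K ^ e)"
  have index: "2 * of_int i * real (K ^ Suc e) + 2 * (real j + real l + 1 - real K) * ?h
      = 2 * of_int (refined_index K (i, j, l)) * ?h" for j l
    by (simp add: refined_index_def algebra_simps)
  have "freq_window K (Suc e) i z
      = of_nat (K ^ e) * (of_nat K * modulated_fejer (2 * of_int i * real (K ^ Suc e)) (real K * ?h) z)"
    by (simp add: freq_window_def mult_ac)
  also have "\<dots> = of_nat (K ^ e) *
      ((\<Sum>j<K. \<Sum>l<K. modulated_fejer (2 * of_int (refined_index K (i, j, l)) * ?h) ?h z) / of_nat K)"
    by (simp only: modulated_fejer_refine[OF assms] index)
  finally show ?thesis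
    by (simp add: freq_window_def sum_distrib_left)
qed

lemma refined_index_less:
  assumes "x \<in> refinements K"
  shows "\<bar>refined_index K x\<bar> < int K ^ 2"
proof -
  obtain i j l where x: "x = (i, j, l)" "\<bar>i\<bar> < int K" "j < K" "l < K"
    using assms by (auto simp: refinements_def low_indices_def)
  have "\<bar>i * int K\<bar> \<le> (int K - 1) * int K" using x by (simp add: abs_mult mult_right_mono)
  then show ?thesis using x by (auto simp: refined_index_def power2_eq_square left_diff_distrib)
qed

lemma card_refinements_of_index_le:
  assumes "K > 0"
  shows "card {x \<in> refinements K. refined_index K x = m} \<le> K"
proof -
  let ?A = "{x \<in> refinements K. refined_index K x = m}"
  have "inj_on (\<lambda>x. fst (snd x)) ?A"
  proof (rule inj_onI)
    fix x y assume xy: "x \<in> ?A" "y \<in> ?A" "fst (snd x) = fst (snd y)"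
    obtain i j l i' j' l' where triples: "x = (i, j, l)" "y = (i', j', l')" by (cases x; cases y)
    have l: "i * int K + int l = i' * int K + int l'" "l < K" "l' < K"
      using xy by (auto simp: triples refinements_def refined_index_def)
    then have "(i * int K + int l) div int K = (i' * int K + int l') div int K" by simp
    then have "i = i'" using l(2,3) assms by simp
    then show "x = y" using xy l by (simp add: triples)
  qed
  moreover have "(\<lambda>x. fst (snd x)) ` ?A \<subseteq> {..<K}" by (auto simp: refinements_def)
  ultimately have "card ?A \<le> card {..<K}" by (rule card_inj_on_le) simp
  then show ?thesis by simp
qed

lemma refine_low_windows:
  fixes c :: "int \<Rightarrow> real"
  assumes K: "K > 0" and c: "\<And>i. 0 \<le> c i \<and> c i \<le> 1"
  obtains c' :: "int \<Rightarrow> real" where "\<And>i. 0 \<le> c' i \<and> c' i \<le> 1"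
    "\<And>z. (\<Sum>i\<in>low_indices K. of_real (c i) * freq_window K (Suc e) i z)
      = (\<Sum>m\<in>low_indices K \<union> high_indices K. of_real (c' m) * freq_window K e m z)"
proof
  define fibre where "fibre m = {x \<in> refinements K. refined_index K x = m}" for m
  define c' where "c' m = (\<Sum>x\<in>fibre m. c (fst x)) / real K" for m
  show "0 \<le> c' m \<and> c' m \<le> 1" for m
  proof
    show "0 \<le> c' m" unfolding c'_def using c by (intro divide_nonneg_nonneg sum_nonneg) auto
    have "(\<Sum>x\<in>fibre m. c (fst x)) \<le> (\<Sum>x\<in>fibre m. 1)" using c by (intro sum_mono) auto
    also have "\<dots> \<le> real K" using card_refinements_of_index_le[OF K] by (simp add: fibre_def)
    finally show "c' m \<le> 1" unfolding c'_def using K by simp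
  qed
  let ?M = "low_indices K \<union> high_indices K"
  have finite: "finite (refinements K)" "finite ?M"
    by (auto simp: refinements_def finite_low_indices finite_high_indices)
  have image: "refined_index K ` refinements K \<subseteq> ?M"
    using refined_index_less by (auto simp: low_Un_high_indices[OF K])
  fix z
  have "(\<Sum>i\<in>low_indices K. of_real (c i) * freq_window K (Suc e) i z)
     = (\<Sum>i\<in>low_indices K. \<Sum>j<K. \<Sum>l<K. of_real (c i) * freq_window K e (refined_index K (i, j, l)) z / of_nat K)"
    by (simp add: freq_window_refine[OF K] sum_distrib_left sum_divide_distrib)
  also have "\<dots> = (\<Sum>x\<in>refinements K. of_real (c (fst x)) * freq_window K e (refined_index K x) z / of_nat K)"
    unfolding refinements_def by (simp add: sum.cartesian_product case_prod_beta)
  also have "\<dots> = (\<Sum>m\<in>?M. \<Sum>x\<in>fibre m. of_real (c (fst x)) * freq_window K e (refined_index K x) z / of_nat K)"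
    unfolding fibre_def by (rule sum.group[OF finite image, symmetric])
  also have "\<dots> = (\<Sum>m\<in>?M. (\<Sum>x\<in>fibre m. of_real (c (fst x))) * (freq_window K e m z / of_nat K))"
    unfolding sum_distrib_right by (intro sum.cong refl) (simp add: fibre_def)
  finally show "(\<Sum>i\<in>low_indices K. of_real (c i) * freq_window K (Suc e) i z)
      = (\<Sum>m\<in>?M. of_real (c' m) * freq_window K e m z)"
    by (simp add: c'_def)
qed

text \<open>The windows \<open>(e, i)\<close> have width \<open>K ^ e\<close> and distance \<open>2 \<bar>i\<bar> K ^ e\<close> from the origin, so they are narrow
  except for the bounded frequencies at level \<open>0\<close>.\<close>
primrec window_indices :: "nat \<Rightarrow> nat \<Rightarrow> (nat \<times> int) set" where
  "window_indices K 0 = Pair 0 ` low_indices K"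
| "window_indices K (Suc n) = window_indices K n \<union> Pair n ` high_indices K"

lemma window_indices_cases:
  "(e, i) \<in> window_indices K n \<Longrightarrow> e = 0 \<and> i \<in> low_indices K \<or> e < n \<and> i \<in> high_indices K"
  by (induction n) auto

lemma finite_window_indices: "finite (window_indices K n)"
  by (induction n) (auto simp: finite_low_indices finite_high_indices)

lemma card_window_indices_le:
  assumes "K > 0"
  shows "card (window_indices K n) \<le> 2 * (n + 1) * K\<^sup>2"
proof (induction n)
  case 0
  have "low_indices K = {- int K<..<int K}" by (auto simp: low_indices_def)
  then have "card (window_indices K 0) \<le> 2 * K" by (simp add: card_image inj_on_def)
  also have "\<dots> \<le> 2 * K\<^sup>2" using assms self_le_power[of K 2] by simp
  finally show ?case by simp
next
  case (Suc n)
  have "card (window_indices K (Suc n)) \<le> card (window_indices K n) + card (Pair n ` high_indices K)"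
    by (simp add: card_Un_le)
  also have "card (Pair n ` high_indices K) = card (high_indices K)"
    by (simp add: card_image inj_on_def)
  also have "\<dots> \<le> card {- (int K ^ 2)<..<int K ^ 2}"
    by (intro card_mono) (auto simp: high_indices_def)
  also have "\<dots> \<le> 2 * K\<^sup>2" by (simp add: nat_le_iff)
  finally show ?case using Suc by simp
qed

lemma low_windows_decomposition:
  fixes c :: "int \<Rightarrow> real"
  assumes K: "K > 0" and c: "\<And>i. 0 \<le> c i \<and> c i \<le> 1"
  shows "\<exists>d :: nat \<times> int \<Rightarrow> real. (\<forall>w. 0 \<le> d w \<and> d w \<le> 1) \<and>
    (\<forall>z. (\<Sum>i\<in>low_indices K. of_real (c i) * freq_window K n i z)
      = (\<Sum>w\<in>window_indices K n. of_real (d w) * freq_window K (fst w) (snd w) z))"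
  using c
proof (induction n arbitrary: c)
  case 0
  have "(\<Sum>w\<in>window_indices K 0. of_real (c (snd w)) * freq_window K (fst w) (snd w) z)
      = (\<Sum>i\<in>low_indices K. of_real (c i) * freq_window K 0 i z)" for z
    by (simp add: sum.reindex inj_on_def)
  then show ?case using 0 by (intro exI[of _ "c \<circ> snd"]) auto
next
  case (Suc n)
  obtain c' where c': "\<And>i. 0 \<le> c' i \<and> c' i \<le> 1"
    and refine: "\<And>z. (\<Sum>i\<in>low_indices K. of_real (c i) * freq_window K (Suc n) i z)
      = (\<Sum>m\<in>low_indices K \<union> high_indices K. of_real (c' m) * freq_window K n m z)"
    using refine_low_windows[where c=c and e=n, OF K Suc.prems] by blast
  obtain d where d: "\<forall>w. 0 \<le> d w \<and> d w \<le> 1"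
    and low: "\<And>z. (\<Sum>i\<in>low_indices K. of_real (c' i) * freq_window K n i z)
      = (\<Sum>w\<in>window_indices K n. of_real (d w) * freq_window K (fst w) (snd w) z)"
    using Suc.IH[of c'] c' by blast
  let ?new = "Pair n ` high_indices K"
  define d' where "d' w = (if w \<in> ?new then c' (snd w) else d w)" for w
  have disjoint: "window_indices K n \<inter> ?new = {}"
    using window_indices_cases low_Int_high_indices by fastforce
  have "(\<Sum>i\<in>low_indices K. of_real (c i) * freq_window K (Suc n) i z)
      = (\<Sum>w\<in>window_indices K (Suc n). of_real (d' w) * freq_window K (fst w) (snd w) z)" for z
  proof -
    have "(\<Sum>i\<in>low_indices K. of_real (c i) * freq_window K (Suc n) i z)
        = (\<Sum>i\<in>low_indices K. of_real (c' i) * freq_window K n i z)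
          + (\<Sum>i\<in>high_indices K. of_real (c' i) * freq_window K n i z)"
      unfolding refine
      by (intro sum.union_disjoint finite_low_indices finite_high_indices low_Int_high_indices)
    also have "(\<Sum>i\<in>high_indices K. of_real (c' i) * freq_window K n i z)
        = (\<Sum>w\<in>?new. of_real (d' w) * freq_window K (fst w) (snd w) z)"
      by (simp add: d'_def sum.reindex inj_on_def)
    also have "(\<Sum>i\<in>low_indices K. of_real (c' i) * freq_window K n i z)
        = (\<Sum>w\<in>window_indices K n. of_real (d' w) * freq_window K (fst w) (snd w) z)"
      unfolding low using disjoint by (intro sum.cong refl) (auto simp: d'_def)
    finally show ?thesis
      using disjoint by (simp add: sum.union_disjoint finite_window_indices finite_high_indices)
  qed
  moreover have "\<forall>w. 0 \<le> d' w \<and> d' w \<le> 1" using d c' by (simp add: d'_def)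
  ultimately show ?case by blast
qed

lemma window_decomposition:
  assumes K: "K > 0"
  shows "\<exists>d :: nat \<times> int \<Rightarrow> real. (\<forall>w. 0 \<le> d w \<and> d w \<le> 1) \<and>
    (\<forall>z. complex_of_real (real K ^ n * fejer (real K ^ n * z))
      = (\<Sum>w\<in>window_indices K n. of_real (d w) * freq_window K (fst w) (snd w) z))"
proof -
  define c :: "int \<Rightarrow> real" where "c i = (if i = 0 then 1 else 0)" for i
  have c: "0 \<le> c i \<and> c i \<le> 1" for i by (simp add: c_def)
  obtain d where d: "\<And>w. 0 \<le> d w \<and> d w \<le> 1"
    and decomposition: "\<And>z. (\<Sum>i\<in>low_indices K. of_real (c i) * freq_window K n i z)
      = (\<Sum>w\<in>window_indices K n. of_real (d w) * freq_window K (fst w) (snd w) z)"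
    using low_windows_decomposition[OF K, of c n] c by blast
  have "(\<Sum>i\<in>low_indices K. of_real (c i) * freq_window K n i z)
      = (\<Sum>i\<in>low_indices K. if i = 0 then freq_window K n 0 z else 0)" for z
    by (intro sum.cong refl) (auto simp: c_def)
  also have "(\<Sum>i\<in>low_indices K. if i = 0 then freq_window K n 0 z else 0) = freq_window K n 0 z" for z
    using K finite_low_indices by (simp add: low_indices_def)
  finally have "complex_of_real (real K ^ n * fejer (real K ^ n * z))
      = (\<Sum>w\<in>window_indices K n. of_real (d w) * freq_window K (fst w) (snd w) z)" for z
    using decomposition by (simp add: freq_window_def modulated_fejer_def)
  with d show ?thesis by blast
qed

section \<open>The discretised estimate\<close>

definition lipschitz_const :: "real \<Rightarrow> real" where
  "lipschitz_const Q = 480000 * Q * (Q + 1)\<^sup>2"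

definition L4_const :: "real \<Rightarrow> nat \<Rightarrow> real" where
  "L4_const Q n = 21600 * (Q + 1) ^ 5 * 578 ^ (n + 3) * (1600 ^ 3 * (8788 * (Q + 2)))"

definition threshold_const :: "real \<Rightarrow> nat \<Rightarrow> real" where
  "threshold_const Q n = 1 / (32 * (8 * Q\<^sup>2 * 4 ^ (n + 2))\<^sup>2 * (real n + 1)\<^sup>2)"

definition kakeya_const :: "real \<Rightarrow> nat \<Rightarrow> real" where
  "kakeya_const Q n = 512 * (real n + 1)\<^sup>2 * lipschitz_const Q ^ 3 * Q * L4_const Q n / threshold_const Q n ^ 7"

lemma
  assumes "1 \<le> Q"
  shows lipschitz_const_pos: "0 < lipschitz_const Q" and L4_const_nonneg: "0 \<le> L4_const Q n"
    and threshold_const_pos: "0 < threshold_const Q n" and kakeya_const_nonneg: "0 \<le> kakeya_const Q n"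
  using assms by (auto simp: lipschitz_const_def L4_const_def threshold_const_def kakeya_const_def)

definition incident :: "real \<Rightarrow> real \<Rightarrow> pt \<Rightarrow> int \<times> int \<times> int \<Rightarrow> bool" where
  "incident \<delta> Q = (\<lambda>(B, C, W) (j, m, l).
     \<bar>W + C * (of_int j * \<delta>) - of_int m * \<delta>\<bar> \<le> Q * \<delta> \<and> \<bar>W * (of_int j * \<delta>) - B - of_int l * \<delta>\<bar> \<le> Q * \<delta>)"

lemma incident_imp_offsets_le:
  assumes "incident \<delta> Q p (j, c)" "\<bar>of_int j * \<delta>\<bar> \<le> Q" "1 \<le> Q" "0 \<le> \<delta>"
  shows "\<bar>ray_offset \<delta> (of_int j * \<delta>) c p\<bar> \<le> 2 * Q\<^sup>2 * \<delta>"
    and "\<bar>tangent_offset \<delta> (of_int j * \<delta>) c p\<bar> \<le> 2 * Q\<^sup>2 * \<delta>"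
proof -
  obtain B C W m l where p: "p = (B, C, W)" and c: "c = (m, l)" by (cases p; cases c)
  define y where "y = of_int j * \<delta>"
  have x_close: "\<bar>W + C * y - of_int m * \<delta>\<bar> \<le> Q * \<delta>" and t_close: "\<bar>W * y - B - of_int l * \<delta>\<bar> \<le> Q * \<delta>"
    using assms(1) by (auto simp: incident_def p c y_def)
  have "Q \<le> Q\<^sup>2" using assms(3) self_le_power[of Q 2] by simp
  then have square_term: "Q * \<delta> \<le> Q\<^sup>2 * \<delta>" using assms(4) by (intro mult_right_mono) auto
  have "tangent_offset \<delta> y c p = W + C * y - of_int m * \<delta>"
    by (simp add: tangent_offset_def cone_tangent_def p c mult.commute)
  moreover have "0 \<le> Q\<^sup>2 * \<delta>" using assms(4) by simp
  ultimately show "\<bar>tangent_offset \<delta> (of_int j * \<delta>) c p\<bar> \<le> 2 * Q\<^sup>2 * \<delta>"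
    using x_close square_term unfolding y_def by linarith
  have "\<bar>y * (W + C * y - of_int m * \<delta>)\<bar> \<le> Q * (Q * \<delta>)"
    unfolding abs_mult[of y] using x_close assms(2,3) by (intro mult_mono) (auto simp: y_def)
  moreover have "ray_offset \<delta> y c p = (W * y - B - of_int l * \<delta>) + y * (W + C * y - of_int m * \<delta>)"
    by (simp add: ray_offset_def cone_ray_def p c power2_eq_square algebra_simps)
  ultimately have "\<bar>ray_offset \<delta> y c p\<bar> \<le> Q * \<delta> + Q * (Q * \<delta>)"
    using t_close by linarith
  then show "\<bar>ray_offset \<delta> (of_int j * \<delta>) c p\<bar> \<le> 2 * Q\<^sup>2 * \<delta>"
    using square_term by (simp add: y_def power2_eq_square mult_ac)
qed

locale discrete_kakeya =
  fixes \<delta> Q lam :: real and k n :: nat and P :: "pt set" and E :: "(int \<times> int \<times> int) set"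
  assumes Q: "1 \<le> Q" and \<delta>: "0 < \<delta>" "\<delta> \<le> 1/8" and k: "8 \<le> k" and lam: "0 < lam"
    and k_le: "8 * Q\<^sup>2 * \<delta> * real k ^ (2 * (n + 2)) \<le> 1"
    and k_ge: "1 \<le> 8 * Q\<^sup>2 * \<delta> * (2 * real k) ^ (2 * (n + 2))"
    and P: "finite P" "P \<subseteq> cube 0 Q"
    and E: "finite E" "\<And>j c. (j, c) \<in> E \<Longrightarrow> \<bar>of_int j * \<delta>\<bar> \<le> Q"
    and rich: "\<And>p. p \<in> P \<Longrightarrow> lam / \<delta> \<le> real (card {j. \<exists>c. (j, c) \<in> E \<and> incident \<delta> Q p (j, c)})"
    and spacing: "\<And>a \<rho>. \<delta> \<le> \<rho> \<Longrightarrow> real (card (P \<inter> cube a \<rho>)) \<le> Q * (\<rho> / \<delta>)\<^sup>2"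
begin

definition J :: "int set" where
  "J = fst ` E"

definition S :: "int \<Rightarrow> (int \<times> int) set" where
  "S j = {c. (j, c) \<in> E}"

definition \<tau> :: real where
  "\<tau> = 1 / (4 * (Q + 2))"

definition windows :: "(nat \<times> int) set" where
  "windows = window_indices (k\<^sup>2) n"

definition freq :: "nat \<times> int \<Rightarrow> real" where
  "freq w = 2 * of_int (snd w) * real ((k\<^sup>2) ^ fst w)"

definition width :: "nat \<times> int \<Rightarrow> real" where
  "width w = real ((k\<^sup>2) ^ fst w)"

definition F :: "nat \<times> int \<Rightarrow> nat \<times> int \<Rightarrow> int \<Rightarrow> pt \<Rightarrow> complex" where
  "F w w' j = layer \<delta> (freq w) (width w) (freq w') (width w') (of_int j * \<delta>) (S j)"

definition window_sum :: "nat \<times> int \<Rightarrow> nat \<times> int \<Rightarrow> pt \<Rightarrow> complex" where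
  "window_sum w w' p = (\<Sum>j\<in>J. F w w' j p)"

definition bandwidth :: "nat \<times> int \<Rightarrow> nat \<times> int \<Rightarrow> real" where
  "bandwidth w w' = \<bar>freq w\<bar> + 2 * width w + (\<bar>freq w'\<bar> + 2 * width w')"

lemma finite_J: "finite J"
  using E by (simp add: J_def)

lemma finite_S: "finite (S j)"
proof -
  have "S j \<subseteq> snd ` E" by (force simp: S_def)
  then show ?thesis using E(1) finite_subset by blast
qed

lemma J_bound: "j \<in> J \<Longrightarrow> \<bar>of_int j * \<delta>\<bar> \<le> Q"
  using E(2) by (auto simp: J_def)

lemma card_E: "real (card E) = (\<Sum>j\<in>J. real (card (S j)))"
proof -
  have "E = Sigma J S" by (force simp: J_def S_def)
  then have "card E = (\<Sum>j\<in>J. card (S j))"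
    using card_SigmaI[OF finite_J, of S] finite_S by simp
  then show ?thesis by simp
qed

lemma \<tau>: "0 < \<tau>" "\<tau> \<le> 1/2" "\<tau> * (Q + 2) \<le> 1/4"
  using Q by (auto simp: \<tau>_def divide_simps)

lemma card_J: "\<delta> * real (card J) \<le> 3 * Q"
proof -
  have "real (card J) \<le> Q / \<delta> - (- Q / \<delta>) + 1"
  proof (rule card_ints_in_interval_le)
    fix j assume "j \<in> J"
    then have "- Q \<le> of_int j * \<delta>" "of_int j * \<delta> \<le> Q" using J_bound[of j] by linarith+
    then show "- Q / \<delta> \<le> of_int j \<and> of_int j \<le> Q / \<delta>"
      using \<delta>(1) by (simp only: pos_le_divide_eq pos_divide_le_eq)
  qed (use Q \<delta> in \<open>simp add: divide_right_mono\<close>)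
  then have "\<delta> * real (card J) \<le> \<delta> * (Q / \<delta> - (- Q / \<delta>) + 1)"
    using \<delta>(1) by (intro mult_left_mono) auto
  also have "\<dots> = 2 * Q + \<delta>" using \<delta>(1) by (simp add: field_simps)
  finally show ?thesis using Q \<delta>(2) by simp
qed

lemma k_power_mult_\<delta>: "real k ^ (2 * (n + 2)) * \<delta> \<le> 1/8"
proof -
  have "1 * (real k ^ (2 * (n + 2)) * \<delta>) \<le> Q\<^sup>2 * (real k ^ (2 * (n + 2)) * \<delta>)"
    using Q \<delta> by (intro mult_right_mono) auto
  then show ?thesis using k_le by (simp add: mult_ac)
qed

lemma finite_windows: "finite windows"
  by (simp add: windows_def finite_window_indices)

lemma card_windows_le: "real (card windows) \<le> 2 * (real n + 1) * real k ^ 4"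
proof -
  have "card windows \<le> 2 * (n + 1) * (k\<^sup>2)\<^sup>2"
    unfolding windows_def using k by (intro card_window_indices_le) simp
  also have "\<dots> = 2 * (n + 1) * k ^ 4" by (simp flip: power_mult)
  finally have "real (card windows) \<le> real (2 * (n + 1) * k ^ 4)" by (simp only: of_nat_le_iff)
  then show ?thesis by (simp add: algebra_simps)
qed

lemma windows_cases:
  assumes "w \<in> windows"
  obtains e i where "w = (e, i)" "e \<le> n" "real_of_int \<bar>i\<bar> + 1 \<le> real k ^ 4"
    "e = 0 \<and> real_of_int \<bar>i\<bar> + 1 \<le> (real k)\<^sup>2 \<or> (real k)\<^sup>2 \<le> real_of_int \<bar>i\<bar>"
proof -
  obtain e i where w: "w = (e, i)" by (cases w)
  have real_less: "real_of_int \<bar>i\<bar> + 1 \<le> real m" if "\<bar>i\<bar> < int m" for m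
    using that by linarith
  have "k\<^sup>2 \<le> k ^ 4" using k by (intro power_increasing) auto
  consider (low) "e = 0" "\<bar>i\<bar> < int (k\<^sup>2)" | (high) "e < n" "int (k\<^sup>2) \<le> \<bar>i\<bar>" "\<bar>i\<bar> < int (k ^ 4)"
    using assms window_indices_cases[of e i "k\<^sup>2" n]
    by (auto simp: w windows_def low_indices_def high_indices_def simp flip: power_mult)
  then show ?thesis
  proof cases
    case low
    then show ?thesis
      using that[OF w] real_less[of "k\<^sup>2"] \<open>k\<^sup>2 \<le> k ^ 4\<close> of_nat_mono[OF \<open>k\<^sup>2 \<le> k ^ 4\<close>, where 'a=real] by simp
  next
    case high
    have "real_of_int (int (k\<^sup>2)) \<le> real_of_int \<bar>i\<bar>" using high(2) by (simp only: of_int_le_iff)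
    then show ?thesis using that[OF w] high real_less[of "k ^ 4"] by simp
  qed
qed

lemma width_ge_1: "1 \<le> width w"
  using k by (simp add: width_def)

lemma abs_freq: "\<bar>freq w\<bar> = 2 * real_of_int \<bar>snd w\<bar> * width w"
  by (simp add: freq_def width_def abs_mult)

lemma window_narrow:
  assumes "w \<in> windows"
  shows "2 * width w * (real k)\<^sup>2 \<le> \<bar>freq w\<bar> \<or> \<bar>freq w\<bar> + 2 * width w \<le> 4 * (real k)\<^sup>2"
proof -
  obtain e i where w: "w = (e, i)"
    and "e = 0 \<and> real_of_int \<bar>i\<bar> + 1 \<le> (real k)\<^sup>2 \<or> (real k)\<^sup>2 \<le> real_of_int \<bar>i\<bar>"
    using windows_cases[OF assms] by metis
  then consider (low) "e = 0" "real_of_int \<bar>i\<bar> + 1 \<le> (real k)\<^sup>2" | (high) "(real k)\<^sup>2 \<le> real_of_int \<bar>i\<bar>" by blast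
  then show ?thesis
  proof cases
    case low
    then show ?thesis by (simp add: abs_freq width_def w)
  next
    case high
    from mult_right_mono[OF this, of "width w"] width_ge_1[of w]
    show ?thesis by (simp add: abs_freq w mult_ac)
  qed
qed

lemma window_size_le_power:
  assumes "w \<in> windows"
  shows "\<bar>freq w\<bar> + 2 * width w \<le> 2 * real k ^ (2 * (n + 2))"
proof -
  obtain e i where w: "w = (e, i)" "e \<le> n" "real_of_int \<bar>i\<bar> + 1 \<le> real k ^ 4"
    using windows_cases[OF assms] by metis
  have "\<bar>freq w\<bar> + 2 * width w = 2 * ((real_of_int \<bar>i\<bar> + 1) * ((real k)\<^sup>2) ^ e)"
    by (simp add: abs_freq width_def w algebra_simps)
  also have "\<dots> \<le> 2 * (real k ^ 4 * ((real k)\<^sup>2) ^ n)"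
    using w k by (intro mult_left_mono mult_mono power_increasing) auto
  also have "real k ^ 4 * ((real k)\<^sup>2) ^ n = real k ^ (2 * (n + 2))"
    unfolding power_mult[symmetric] power_add[symmetric] by (rule arg_cong[where f = "power (real k)"]) simp
  finally show ?thesis .
qed

lemma window_size_le:
  assumes "w \<in> windows"
  shows "\<bar>freq w\<bar> + 2 * width w \<le> 1 / (4 * \<delta>)"
proof -
  have "2 * real k ^ (2 * (n + 2)) \<le> 1 / (4 * \<delta>)"
    using k_power_mult_\<delta> \<delta> by (simp add: field_simps)
  then show ?thesis using window_size_le_power[OF assms] by linarith
qed

lemma width_mult_\<delta>_le_1: "w \<in> windows \<Longrightarrow> width w * \<delta> \<le> 1"
proof -
  assume "w \<in> windows"
  then have "width w \<le> 1 / (4 * \<delta>)" using window_size_le[of w] width_ge_1[of w] by linarith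
  then show ?thesis using \<delta> width_ge_1[of w] by (simp add: field_simps)
qed

lemma abs_freq_le_power:
  assumes "w \<in> windows"
  shows "\<bar>freq w\<bar> \<le> real k ^ (2 * (n + 3))"
proof -
  have "\<bar>freq w\<bar> \<le> 2 * real k ^ (2 * (n + 2))"
    using window_size_le_power[OF assms] width_ge_1[of w] by linarith
  also have "\<dots> \<le> (real k)\<^sup>2 * real k ^ (2 * (n + 2))"
    using power_mono[of 8 "real k" 2] k by (intro mult_right_mono) auto
  also have "\<dots> = real k ^ (2 * (n + 3))"
    unfolding power_add[symmetric] by (rule arg_cong[where f = "power (real k)"]) simp
  finally show ?thesis .
qed

lemma bandwidth_bounds:
  assumes "w \<in> windows" "w' \<in> windows"
  shows "4 \<le> bandwidth w w'" "bandwidth w w' \<le> 1 / (2 * \<delta>)"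
proof -
  show "4 \<le> bandwidth w w'"
    using width_ge_1[of w] width_ge_1[of w'] by (simp add: bandwidth_def)
  have "bandwidth w w' \<le> 1 / (4 * \<delta>) + 1 / (4 * \<delta>)"
    unfolding bandwidth_def by (intro add_mono window_size_le assms)
  then show "bandwidth w w' \<le> 1 / (2 * \<delta>)" by simp
qed

lemma norm_F_le:
  assumes "w \<in> windows" "w' \<in> windows"
  shows "norm (F w w' j p) \<le> 1600 * \<delta>"
  unfolding F_def using assms width_ge_1[of w] width_ge_1[of w'] width_mult_\<delta>_le_1 \<delta> finite_S
  by (intro norm_layer_le) auto

lemma cone_windows_F:
  assumes w: "w \<in> windows" "w' \<in> windows"
  shows "cone_windows \<delta> \<tau> (Q + 1) k (freq w) (width w) (freq w') (width w') J (F w w')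
    (\<lambda>j. \<delta> ^ 3 * real (card (S j))) 1600 (2197 / \<tau>) (n + 3)"
proof unfold_locales
  have widths: "0 < width w" "0 < width w'" using width_ge_1[of w] width_ge_1[of w'] by auto
  show "band_limited (plank (freq w) (width w) (freq w') (width w') (of_int j * \<delta>)) (F w w' j)" for j
    unfolding F_def using widths by (intro band_limited_layer) auto
  show "norm (F w w' j p) \<le> 1600 * \<delta>" for j p by (rule norm_F_le[OF w])
  show "weighted_integral \<tau> (\<lambda>p. norm (F w w' j p)) \<le> 2197 / \<tau> * (\<delta> ^ 3 * real (card (S j)))" for j
    unfolding F_def using weighted_integral_norm_layer_le[OF \<tau>(1) widths \<delta>(1)] by (simp add: mult_ac)
  show "\<bar>of_int j * \<delta>\<bar> \<le> Q + 1 - 1" if "j \<in> J" for j using J_bound[OF that] by simp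
  show "0 < width w" "0 < width w'" by fact+
  have "1 / (4 * \<delta>) \<le> 8 / \<delta>" using \<delta> by (simp add: field_simps)
  then show "\<bar>freq w\<bar> + 2 * width w \<le> 8 / \<delta>" "\<bar>freq w'\<bar> + 2 * width w' \<le> 8 / \<delta>"
    using order_trans[OF window_size_le] w by blast+
qed (use \<delta> \<tau> Q k finite_J window_narrow w abs_freq_le_power in auto)

lemma window_sum_bcontfun:
  assumes "w \<in> windows" "w' \<in> windows"
  shows "window_sum w w' \<in> bcontfun"
proof -
  interpret cone_windows \<delta> \<tau> "Q + 1" k "freq w" "width w" "freq w'" "width w'" J "F w w'"
    "\<lambda>j. \<delta> ^ 3 * real (card (S j))" 1600 "2197 / \<tau>" "n + 3"
    by (rule cone_windows_F[OF assms])
  show ?thesis unfolding window_sum_def[abs_def] by (rule bcontfun_sum) (rule F_bcontfun)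
qed

lemma weighted_integral_window_sum_power4_le:
  assumes "w \<in> windows" "w' \<in> windows"
  shows "weighted_integral \<tau> (\<lambda>p. norm (window_sum w w' p) ^ 4)
    \<le> L4_const Q n * (real k ^ 8 * (\<delta> ^ 3 * real (card E))) / bandwidth w w'"
proof -
  interpret cone_windows \<delta> \<tau> "Q + 1" k "freq w" "width w" "freq w'" "width w'" J "F w w'"
    "\<lambda>j. \<delta> ^ 3 * real (card (S j))" 1600 "2197 / \<tau>" "n + 3"
    by (rule cone_windows_F[OF assms])
  have mass: "mass = \<delta> ^ 3 * real (card E)"
    unfolding mass_def card_E sum_distrib_left ..
  have "2197 / \<tau> = 8788 * (Q + 2)" by (simp add: \<tau>_def)
  then have "C0 = 1600 ^ 3 * (8788 * (Q + 2)) * (\<delta> ^ 3 * real (card E))"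
    unfolding C0_def mass by simp
  moreover have "X = bandwidth w w'" by (simp add: X_def \<rho>_def bandwidth_def)
  moreover have "window_sum w w' = layer_sum J" by (simp add: fun_eq_iff window_sum_def layer_sum_def)
  ultimately show ?thesis
    using weighted_integral_power4_le by (simp only: L4_const_def mult_ac times_divide_eq_right times_divide_eq_left)
qed

lemma norm_window_sum_le:
  assumes "w \<in> windows" "w' \<in> windows"
  shows "norm (window_sum w w' p) \<le> 4800 * Q"
proof -
  have "norm (window_sum w w' p) \<le> (\<Sum>j\<in>J. 1600 * \<delta>)"
    unfolding window_sum_def by (intro order_trans[OF norm_sum] sum_mono norm_F_le assms)
  also have "\<dots> = 1600 * (\<delta> * real (card J))" by simp
  also have "\<dots> \<le> 1600 * (3 * Q)" using card_J by (intro mult_left_mono) auto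
  finally show ?thesis by simp
qed

lemma norm_window_sum_diff_le:
  assumes w: "w \<in> windows" "w' \<in> windows" and close: "p' \<in> cube p \<eta>"
    and small: "bandwidth w w' * (4 * (Q + 1)\<^sup>2 * \<eta>) \<le> 1" and \<eta>: "0 \<le> \<eta>"
  shows "norm (window_sum w w' p - window_sum w w' p') \<le> lipschitz_const Q * bandwidth w w' * \<eta>"
proof -
  let ?X = "bandwidth w w'" and ?e = "4 * (Q + 1)\<^sup>2 * \<eta>"
  have layer: "norm (F w w' j p - F w w' j p') \<le> 40000 * \<delta> * ?X * ?e" if "j \<in> J" for j
    unfolding F_def
  proof (rule layer_lipschitz[OF finite_S _ _ \<delta>(1) _ _ _ _ _ small])
    show "\<bar>cone_ray (of_int j * \<delta>) \<bullet> p - cone_ray (of_int j * \<delta>) \<bullet> p'\<bar> \<le> ?e"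
      "\<bar>cone_tangent (of_int j * \<delta>) \<bullet> p - cone_tangent (of_int j * \<delta>) \<bullet> p'\<bar> \<le> ?e"
      using J_bound[OF that] Q close by (auto intro!: abs_cone_ray_diff_le abs_cone_tangent_diff_le)
    show "\<bar>freq w\<bar> + width w + \<bar>freq w'\<bar> + width w' \<le> ?X"
      using width_ge_1[of w] width_ge_1[of w'] by (simp add: bandwidth_def)
  qed (use width_ge_1[of w] width_ge_1[of w'] width_mult_\<delta>_le_1 w in auto)
  have "norm (window_sum w w' p - window_sum w w' p') \<le> (\<Sum>j\<in>J. 40000 * \<delta> * ?X * ?e)"
    unfolding window_sum_def sum_subtractf[symmetric] by (intro order_trans[OF norm_sum] sum_mono layer)
  also have "\<dots> = 160000 * ?X * (Q + 1)\<^sup>2 * \<eta> * (\<delta> * real (card J))" by simp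
  also have "\<dots> \<le> 160000 * ?X * (Q + 1)\<^sup>2 * \<eta> * (3 * Q)"
    using card_J \<eta> bandwidth_bounds[OF w] by (intro mult_left_mono) auto
  also have "\<dots> = lipschitz_const Q * ?X * \<eta>" by (simp add: lipschitz_const_def)
  finally show ?thesis .
qed

definition large :: "real \<Rightarrow> nat \<times> int \<Rightarrow> nat \<times> int \<Rightarrow> pt set" where
  "large t w w' = {p\<in>P. t \<le> norm (window_sum w w' p)}"

text \<open>The scale at which \<open>window_sum w w'\<close> varies by at most \<open>t / 2\<close>.\<close>
definition stable_scale :: "real \<Rightarrow> nat \<times> int \<Rightarrow> nat \<times> int \<Rightarrow> real" where
  "stable_scale t w w' = t / (2 * lipschitz_const Q * bandwidth w w')"

lemma stable_scale_bounds:
  assumes w: "w \<in> windows" "w' \<in> windows" and t: "0 < t" "t \<le> 4800 * Q"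
  shows "0 < stable_scale t w w'" "bandwidth w w' * (4 * (Q + 1)\<^sup>2 * stable_scale t w w') \<le> 1"
    "stable_scale t w w' \<le> 1 / bandwidth w w'"
proof -
  let ?X = "bandwidth w w'" and ?A = "lipschitz_const Q" and ?\<eta> = "stable_scale t w w'"
  have X: "4 \<le> ?X" by (rule bandwidth_bounds[OF w])
  have A: "0 < ?A" by (rule lipschitz_const_pos[OF Q])
  show \<eta>: "0 < ?\<eta>" using t X A by (simp add: stable_scale_def)
  have "?X * (4 * (Q + 1)\<^sup>2 * ?\<eta>) = 2 * (Q + 1)\<^sup>2 * t / ?A" using X by (simp add: stable_scale_def)
  also have "\<dots> \<le> 1"
    using mult_left_mono[OF t(2), of "2 * (Q + 1)\<^sup>2"] A Q by (simp add: lipschitz_const_def mult_ac)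
  finally show small: "?X * (4 * (Q + 1)\<^sup>2 * ?\<eta>) \<le> 1" .
  have "1 \<le> (Q + 1)\<^sup>2" using Q by (intro one_le_power) simp
  then have "?X * ?\<eta> * 1 \<le> ?X * ?\<eta> * (4 * (Q + 1)\<^sup>2)"
    using X \<eta> by (intro mult_left_mono) auto
  then have "?X * ?\<eta> \<le> 1" using small by (simp add: mult_ac)
  then show "?\<eta> \<le> 1 / ?X" using X by (simp add: pos_le_divide_eq mult.commute)
qed

lemma card_large_mult_scale_le:
  assumes w: "w \<in> windows" "w' \<in> windows" and t: "0 < t" "t \<le> 4800 * Q"
  shows "real (card (large t w w')) * (stable_scale t w w' ^ 3 * (t / 2) ^ 4)
    \<le> Q * (1 / bandwidth w w' / \<delta>)\<^sup>2 * (L4_const Q n * (real k ^ 8 * (\<delta> ^ 3 * real (card E))) / bandwidth w w')"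
proof -
  define X where "X = bandwidth w w'"
  define \<eta> where "\<eta> = stable_scale t w w'"
  have X: "4 \<le> X" "X \<le> 1 / (2 * \<delta>)" using bandwidth_bounds[OF w] by (auto simp: X_def)
  have \<eta>: "0 < \<eta>" "X * (4 * (Q + 1)\<^sup>2 * \<eta>) \<le> 1" "\<eta> \<le> 1 / X"
    using stable_scale_bounds[OF w t] by (auto simp: \<eta>_def X_def)
  have dim: "DIM(pt) = 3" by simp
  have "real (card (large t w w')) * (\<eta> ^ 3 * (t / 2) ^ 4)
      \<le> Q * (1 / X / \<delta>)\<^sup>2 * weighted_integral \<tau> (\<lambda>p. norm (window_sum w w' p) ^ 4)"
  proof (rule card_large_values_le[where 'a = pt, unfolded dim])
    show "large t w w' \<subseteq> cube 0 Q" using P(2) by (auto simp: large_def)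
    have "1 / X \<le> 1" using X by simp
    then have "\<tau> * (Q + \<eta>) \<le> \<tau> * (Q + 2)" using \<eta>(3) \<tau>(1) by (intro mult_left_mono) auto
    then show "\<tau> * (Q + \<eta>) \<le> 1/4" using \<tau>(3) by linarith
    show "t / 2 \<le> norm (window_sum w w' x)" if "p \<in> large t w w'" "x \<in> cube p \<eta>" for p x
    proof -
      have "norm (window_sum w w' p - window_sum w w' x) \<le> lipschitz_const Q * X * \<eta>"
        unfolding X_def using \<eta> by (intro norm_window_sum_diff_le w that(2)) (auto simp: X_def)
      also have "\<dots> = t / 2" using X lipschitz_const_pos[OF Q] by (simp add: \<eta>_def stable_scale_def X_def)
      finally show ?thesis
        using that(1) norm_triangle_sub[of "window_sum w w' p" "window_sum w w' x"] by (simp add: large_def)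
    qed
    show "real (card (large t w w' \<inter> cube x \<eta>)) \<le> Q * (1 / X / \<delta>)\<^sup>2" for x
    proof -
      have "card (large t w w' \<inter> cube x \<eta>) \<le> card (P \<inter> cube x (1 / X))"
        using P(1) cube_mono[OF \<eta>(3)] by (intro card_mono) (auto simp: large_def)
      moreover have "\<delta> \<le> 1 / X" using X \<delta> by (simp add: field_simps)
      ultimately show ?thesis using spacing[of "1 / X" x] by linarith
    qed
  qed (use P \<tau> \<eta> t window_sum_bcontfun[OF w] in \<open>auto simp: large_def\<close>)
  also have "\<dots> \<le> Q * (1 / X / \<delta>)\<^sup>2 * (L4_const Q n * (real k ^ 8 * (\<delta> ^ 3 * real (card E))) / X)"
    using weighted_integral_window_sum_power4_le[OF w] Q unfolding X_def by (intro mult_left_mono) auto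
  finally show ?thesis unfolding \<eta>_def X_def .
qed

definition large_bound :: real where
  "large_bound = 128 * lipschitz_const Q ^ 3 * Q * L4_const Q n * (real k ^ 8 * (\<delta> ^ 3 * real (card E)))"

lemma large_bound_nonneg: "0 \<le> large_bound"
  unfolding large_bound_def using Q \<delta> lipschitz_const_pos[OF Q] L4_const_nonneg[OF Q]
  by (intro mult_nonneg_nonneg) auto

lemma card_large_le:
  assumes w: "w \<in> windows" "w' \<in> windows" and t: "0 < t"
  shows "real (card (large t w w')) * (\<delta>\<^sup>2 * t ^ 7) \<le> large_bound"
proof (cases "t \<le> 4800 * Q")
  case False
  then have "norm (window_sum w w' p) < t" for p using norm_window_sum_le[OF w, of p] by linarith
  then have "large t w w' = {}" by (auto simp: large_def not_le)
  then show ?thesis using large_bound_nonneg by simp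
next
  case True
  define X where "X = bandwidth w w'"
  define \<eta> where "\<eta> = stable_scale t w w'"
  let ?A = "lipschitz_const Q" and ?m = "real k ^ 8 * (\<delta> ^ 3 * real (card E))"
  have X: "4 \<le> X" using bandwidth_bounds[OF w] by (simp add: X_def)
  have A: "0 < ?A" by (rule lipschitz_const_pos[OF Q])
  have "t = 2 * ?A * X * \<eta>" using X A by (simp add: \<eta>_def stable_scale_def X_def)
  then have "t ^ 3 = 8 * ?A ^ 3 * X ^ 3 * \<eta> ^ 3" by (simp only: power_mult_distrib) simp
  moreover have "t ^ 7 = t ^ 3 * (16 * (t / 2) ^ 4)" by (simp add: power_divide flip: power_add)
  ultimately have "real (card (large t w w')) * (\<delta>\<^sup>2 * t ^ 7)
      = 128 * ?A ^ 3 * X ^ 3 * \<delta>\<^sup>2 * (real (card (large t w w')) * (\<eta> ^ 3 * (t / 2) ^ 4))"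
    by (simp only: mult_ac)
  also have "\<dots> \<le> 128 * ?A ^ 3 * X ^ 3 * \<delta>\<^sup>2 * (Q * (1 / X / \<delta>)\<^sup>2 * (L4_const Q n * ?m / X))"
    using X A unfolding X_def \<eta>_def by (intro mult_left_mono card_large_mult_scale_le w t True) auto
  also have "\<dots> = 128 * ?A ^ 3 * Q * L4_const Q n * ?m * (X ^ 3 * \<delta>\<^sup>2 * ((1 / X / \<delta>)\<^sup>2 / X))"
    by simp
  also have "X ^ 3 * \<delta>\<^sup>2 * ((1 / X / \<delta>)\<^sup>2 / X) = 1"
    using X \<delta> by (simp add: power2_eq_square power3_eq_cube)
  finally show ?thesis by (simp add: large_bound_def)
qed

definition N :: real where
  "N = real (k\<^sup>2) ^ n"

text \<open>The superposition of all windows: a smoothed indicator of the event that the line \<open>p\<close> meets a cell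
  of the layer \<open>j\<close>.\<close>
definition smoothed :: "int \<Rightarrow> pt \<Rightarrow> real" where
  "smoothed j p = \<delta> ^ 3 * (\<Sum>c\<in>S j. (N * fejer (N * ray_offset \<delta> (of_int j * \<delta>) c p))
     * (N * fejer (N * tangent_offset \<delta> (of_int j * \<delta>) c p)))"

lemma N_pos: "0 < N"
  using k by (simp add: N_def)

lemma smoothed_nonneg: "0 \<le> smoothed j p"
  unfolding smoothed_def using \<delta> N_pos by (intro mult_nonneg_nonneg sum_nonneg) auto

lemma smoothed_superposition:
  obtains d where "\<And>w. 0 \<le> d w \<and> d w \<le> 1"
    "\<And>j p. complex_of_real (smoothed j p) = (\<Sum>w\<in>windows. \<Sum>w'\<in>windows. of_real (d w * d w') * F w w' j p)"
proof -
  have "k\<^sup>2 > 0" using k by simp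
  from window_decomposition[OF this, of n, folded N_def windows_def] obtain d
    where d: "\<forall>w. 0 \<le> d w \<and> d w \<le> 1"
    and decomposition: "\<forall>z. complex_of_real (N * fejer (N * z))
      = (\<Sum>w\<in>windows. of_real (d w) * freq_window (k\<^sup>2) (fst w) (snd w) z)"
    by (elim exE conjE)
  have window: "freq_window (k\<^sup>2) (fst w) (snd w) z = of_real (width w) * modulated_fejer (freq w) (width w) z" for w z
    by (simp add: freq_window_def width_def freq_def)
  have "complex_of_real (smoothed j p) = (\<Sum>w\<in>windows. \<Sum>w'\<in>windows. of_real (d w * d w') * F w w' j p)" for j p
  proof -
    let ?u = "\<lambda>w c. of_real (d w) * freq_window (k\<^sup>2) (fst w) (snd w) (ray_offset \<delta> (of_int j * \<delta>) c p)"
    let ?v = "\<lambda>w c. of_real (d w) * freq_window (k\<^sup>2) (fst w) (snd w) (tangent_offset \<delta> (of_int j * \<delta>) c p)"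
    have "complex_of_real (smoothed j p) = (\<Sum>c\<in>S j. of_real (\<delta> ^ 3) * ((\<Sum>w\<in>windows. ?u w c) * (\<Sum>w'\<in>windows. ?v w' c)))"
      unfolding smoothed_def decomposition[rule_format, symmetric] by (simp add: sum_distrib_left)
    also have "\<dots> = (\<Sum>c\<in>S j. \<Sum>w\<in>windows. \<Sum>w'\<in>windows. of_real (\<delta> ^ 3) * (?u w c * ?v w' c))"
      by (simp only: sum_product) (simp only: sum_distrib_left)
    also have "\<dots> = (\<Sum>w\<in>windows. \<Sum>w'\<in>windows. \<Sum>c\<in>S j. of_real (\<delta> ^ 3) * (?u w c * ?v w' c))"
      by (subst sum.swap[of _ "S j" windows], subst sum.swap[of _ windows "S j"]) (rule refl)
    also have "\<dots> = (\<Sum>w\<in>windows. \<Sum>w'\<in>windows. of_real (d w * d w') * F w w' j p)"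
      unfolding F_def layer_def packet_def window
      by (intro sum.cong refl) (simp add: sum_distrib_left mult_ac)
    finally show ?thesis .
  qed
  then show ?thesis by (rule that[OF spec[OF d]])
qed

lemma N_upper: "N * (2 * Q\<^sup>2 * \<delta>) \<le> 1/4"
proof -
  have "N = real k ^ (2 * n)" by (simp add: N_def power_mult)
  also have "\<dots> \<le> real k ^ (2 * (n + 2))" using k by (intro power_increasing) auto
  finally have "8 * Q\<^sup>2 * \<delta> * N \<le> 8 * Q\<^sup>2 * \<delta> * real k ^ (2 * (n + 2))"
    using \<delta> by (intro mult_left_mono) auto
  then show ?thesis using k_le by (simp add: mult_ac)
qed

lemma N_lower: "1 / (8 * Q\<^sup>2 * 4 ^ (n + 2) * real k ^ 4) \<le> \<delta> * N"
proof -
  have "(2 * real k) ^ (2 * (n + 2)) = 4 ^ (n + 2) * (real k ^ 4 * N)"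
  proof -
    have "(2 * real k) ^ (2 * (n + 2)) = (2\<^sup>2) ^ (n + 2) * ((real k)\<^sup>2) ^ (n + 2)"
      by (simp only: power_mult power_mult_distrib)
    also have "((real k)\<^sup>2) ^ (n + 2) = real k ^ 4 * N"
      by (simp add: N_def power_add mult.commute flip: power_mult)
    finally show ?thesis by simp
  qed
  then have "1 \<le> (\<delta> * N) * (8 * Q\<^sup>2 * 4 ^ (n + 2) * real k ^ 4)"
    using k_ge by (simp only: mult_ac)
  then show ?thesis using Q k by (subst pos_divide_le_eq) auto
qed

lemma smoothed_ge:
  assumes "(j, c) \<in> E" "incident \<delta> Q p (j, c)"
  shows "\<delta> ^ 3 * (N\<^sup>2 / 4) \<le> smoothed j p"
proof -
  have half: "1/2 \<le> fejer (N * x)" if "\<bar>x\<bar> \<le> 2 * Q\<^sup>2 * \<delta>" for x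
  proof (rule fejer_ge_half)
    have "N * \<bar>x\<bar> \<le> N * (2 * Q\<^sup>2 * \<delta>)" using that N_pos by (intro mult_left_mono) auto
    also have "\<dots> \<le> 1/4" by (rule N_upper)
    finally show "\<bar>N * x\<bar> \<le> 1/4" using N_pos by (simp add: abs_mult)
  qed
  note offsets = incident_imp_offsets_le[OF assms(2) E(2)[OF assms(1)] Q less_imp_le[OF \<delta>(1)]]
  let ?term = "\<lambda>c. (N * fejer (N * ray_offset \<delta> (of_int j * \<delta>) c p)) * (N * fejer (N * tangent_offset \<delta> (of_int j * \<delta>) c p))"
  have "N * (1/2) * (N * (1/2)) \<le> ?term c"
    using half[OF offsets(1)] half[OF offsets(2)] N_pos by (intro mult_mono) auto
  also have "\<dots> \<le> (\<Sum>c\<in>S j. ?term c)"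
    using N_pos assms(1) by (intro member_le_sum finite_S) (auto simp: S_def)
  finally show ?thesis
    unfolding smoothed_def using \<delta> by (intro mult_left_mono) (auto simp: power2_eq_square)
qed

lemma sum_smoothed_ge:
  assumes "p \<in> P"
  shows "lam / (4 * (8 * Q\<^sup>2 * 4 ^ (n + 2))\<^sup>2 * real k ^ 8) \<le> (\<Sum>j\<in>J. smoothed j p)"
proof -
  let ?q = "8 * Q\<^sup>2 * 4 ^ (n + 2)" and ?H = "{j. \<exists>c. (j, c) \<in> E \<and> incident \<delta> Q p (j, c)}"
  have layers: "?H \<subseteq> J" by (force simp: J_def)
  have "lam / (4 * ?q\<^sup>2 * real k ^ 8) = (1 / (?q * real k ^ 4))\<^sup>2 * (lam / 4)"
    by (simp add: power_divide power_mult_distrib flip: power_mult)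
  also have "\<dots> \<le> (\<delta> * N)\<^sup>2 * (lam / 4)"
    using N_lower Q lam by (intro mult_right_mono power_mono) auto
  also have "\<dots> = (lam / \<delta>) * (\<delta> ^ 3 * (N\<^sup>2 / 4))"
    using \<delta> by (simp add: power2_eq_square power3_eq_cube)
  also have "\<dots> \<le> real (card ?H) * (\<delta> ^ 3 * (N\<^sup>2 / 4))"
    using rich[OF assms] \<delta> by (intro mult_right_mono) auto
  also have "\<dots> = (\<Sum>j\<in>?H. \<delta> ^ 3 * (N\<^sup>2 / 4))" by simp
  also have "\<dots> \<le> (\<Sum>j\<in>?H. smoothed j p)" by (rule sum_mono) (use smoothed_ge in blast)
  also have "\<dots> \<le> (\<Sum>j\<in>J. smoothed j p)"
    using layers finite_J smoothed_nonneg by (intro sum_mono2) auto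
  finally show ?thesis .
qed

lemma sum_smoothed_le:
  assumes "\<And>w w'. w \<in> windows \<Longrightarrow> w' \<in> windows \<Longrightarrow> norm (window_sum w w' p) \<le> t" "0 \<le> t"
  shows "(\<Sum>j\<in>J. smoothed j p) \<le> (2 * (real n + 1) * real k ^ 4)\<^sup>2 * t"
proof -
  obtain d where d: "\<And>w. 0 \<le> d w \<and> d w \<le> 1"
    and superposition: "\<And>j p. complex_of_real (smoothed j p) = (\<Sum>w\<in>windows. \<Sum>w'\<in>windows. of_real (d w * d w') * F w w' j p)"
    using smoothed_superposition by blast
  have "complex_of_real (\<Sum>j\<in>J. smoothed j p) = (\<Sum>w\<in>windows. \<Sum>w'\<in>windows. of_real (d w * d w') * window_sum w w' p)"
    unfolding of_real_sum superposition window_sum_def sum_distrib_left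
    by (subst sum.swap[of _ windows J], intro sum.cong refl, subst sum.swap) (rule refl)
  then have "(\<Sum>j\<in>J. smoothed j p) \<le> norm (\<Sum>w\<in>windows. \<Sum>w'\<in>windows. of_real (d w * d w') * window_sum w w' p)"
    by (metis abs_ge_self norm_of_real)
  also have "\<dots> \<le> (\<Sum>w\<in>windows. \<Sum>w'\<in>windows. 1 * t)"
  proof (rule order_trans[OF norm_sum], rule sum_mono, rule order_trans[OF norm_sum], rule sum_mono)
    fix w w' assume w: "w \<in> windows" "w' \<in> windows"
    have "\<bar>d w * d w'\<bar> \<le> 1"
      unfolding abs_mult using d[of w] d[of w'] by (simp add: mult_le_one)
    then show "norm (of_real (d w * d w') * window_sum w w' p) \<le> 1 * t"
      unfolding norm_mult norm_of_real using assms(1)[OF w] by (intro mult_mono) auto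
  qed
  also have "\<dots> = (real (card windows))\<^sup>2 * t" by (simp add: power2_eq_square)
  also have "\<dots> \<le> (2 * (real n + 1) * real k ^ 4)\<^sup>2 * t"
    using card_windows_le assms(2) by (intro mult_right_mono power_mono) auto
  finally show ?thesis .
qed

lemma exists_large_window_sum:
  assumes "p \<in> P"
  shows "\<exists>w\<in>windows. \<exists>w'\<in>windows. lam * threshold_const Q n / real k ^ 16 \<le> norm (window_sum w w' p)"
proof (rule ccontr)
  let ?q = "8 * Q\<^sup>2 * 4 ^ (n + 2)" and ?t = "lam * threshold_const Q n / real k ^ 16"
  define s where "s = lam / (4 * ?q\<^sup>2 * real k ^ 8)"
  have "0 < s"
    unfolding s_def using lam Q k by (intro divide_pos_pos mult_pos_pos) auto
  assume "\<not> ?thesis"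
  then have "norm (window_sum w w' p) \<le> ?t" if "w \<in> windows" "w' \<in> windows" for w w'
    using that by (meson linear)
  moreover have "0 \<le> ?t" using lam threshold_const_pos[OF Q, of n] by simp
  ultimately have "(\<Sum>j\<in>J. smoothed j p) \<le> (2 * (real n + 1) * real k ^ 4)\<^sup>2 * ?t"
    by (rule sum_smoothed_le)
  also have "\<dots> = s / 2"
  proof -
    have "(real k ^ 4)\<^sup>2 = real k ^ 8" "real k ^ 16 = real k ^ 8 * real k ^ 8"
      by (simp_all flip: power_mult power_add)
    then show ?thesis
      unfolding threshold_const_def s_def using k Q
      by (simp add: power_mult_distrib field_simps) (simp add: power2_eq_square algebra_simps)
  qed
  also have "\<dots> < s" using \<open>0 < s\<close> by simp
  finally show False using sum_smoothed_ge[OF assms] unfolding s_def by linarith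
qed

lemma card_P_mult_le:
  assumes t: "0 < t" "t \<le> lam * threshold_const Q n / real k ^ 16"
  shows "real (card P) * (\<delta>\<^sup>2 * t ^ 7) \<le> 4 * (real n + 1)\<^sup>2 * real k ^ 8 * large_bound"
proof -
  have "P \<subseteq> (\<Union>w\<in>windows. \<Union>w'\<in>windows. large t w w')"
    using exists_large_window_sum order_trans[OF t(2)] unfolding large_def by blast
  then have "card P \<le> card (\<Union>w\<in>windows. \<Union>w'\<in>windows. large t w w')"
    using finite_windows P(1) by (intro card_mono) (auto simp: large_def)
  also have "\<dots> \<le> (\<Sum>w\<in>windows. \<Sum>w'\<in>windows. card (large t w w'))"
    by (intro order_trans[OF card_UN_le] sum_mono card_UN_le finite_windows)
  finally have "real (card P) \<le> (\<Sum>w\<in>windows. \<Sum>w'\<in>windows. real (card (large t w w')))"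
    by (simp flip: of_nat_sum)
  then have "real (card P) * (\<delta>\<^sup>2 * t ^ 7) \<le> (\<Sum>w\<in>windows. \<Sum>w'\<in>windows. real (card (large t w w'))) * (\<delta>\<^sup>2 * t ^ 7)"
    using t by (intro mult_right_mono) auto
  also have "\<dots> = (\<Sum>w\<in>windows. \<Sum>w'\<in>windows. real (card (large t w w')) * (\<delta>\<^sup>2 * t ^ 7))"
    by (simp only: sum_distrib_right)
  also have "\<dots> \<le> (\<Sum>w\<in>windows. \<Sum>w'\<in>windows. large_bound)"
    by (intro sum_mono card_large_le t)
  also have "\<dots> = (real (card windows))\<^sup>2 * large_bound" by (simp add: power2_eq_square)
  also have "\<dots> \<le> (2 * (real n + 1) * real k ^ 4)\<^sup>2 * large_bound"
    using card_windows_le large_bound_nonneg by (intro mult_right_mono power_mono) auto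
  also have "(2 * (real n + 1) * real k ^ 4)\<^sup>2 = 4 * (real n + 1)\<^sup>2 * real k ^ 8"
    unfolding power_mult_distrib by (simp flip: power_mult)
  finally show ?thesis .
qed

theorem discrete_bound:
  "lam ^ 7 * (\<delta>\<^sup>2 * real (card P)) \<le> kakeya_const Q n * real k ^ 128 * (\<delta> ^ 3 * real (card E))"
proof -
  define t where "t = lam * threshold_const Q n / real k ^ 16"
  have threshold_pos: "0 < threshold_const Q n" by (rule threshold_const_pos[OF Q])
  have "0 < t" using lam threshold_pos k by (simp add: t_def)
  have "t ^ 7 = lam ^ 7 * (threshold_const Q n ^ 7 / real k ^ 112)"
    by (simp add: t_def power_divide power_mult_distrib flip: power_mult)
  then have "lam ^ 7 * (\<delta>\<^sup>2 * real (card P)) = real (card P) * (\<delta>\<^sup>2 * t ^ 7) * (real k ^ 112 / threshold_const Q n ^ 7)"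
    using k threshold_pos by simp
  also have "\<dots> \<le> 4 * (real n + 1)\<^sup>2 * real k ^ 8 * large_bound * (real k ^ 112 / threshold_const Q n ^ 7)"
    using card_P_mult_le[OF \<open>0 < t\<close>] threshold_pos by (intro mult_right_mono) (auto simp: t_def)
  also have "\<dots> = kakeya_const Q n * (real k ^ 8 * real k ^ 8 * real k ^ 112) * (\<delta> ^ 3 * real (card E))"
    by (simp add: large_bound_def kakeya_const_def mult_ac)
  also have "real k ^ 8 * real k ^ 8 * real k ^ 112 = real k ^ 128"
    by (simp flip: power_add)
  finally show ?thesis .
qed

end

section \<open>From lines to the discretised estimate\<close>

lemma measure_le_card_mult_interval:
  fixes T :: "real set" and c :: "'i \<Rightarrow> real"
  assumes "finite H" "T \<subseteq> (\<Union>j\<in>H. {c j - \<mu>..c j + \<mu>})" "0 \<le> \<mu>"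
  shows "measure lebesgue T \<le> real (card H) * (2 * \<mu>)"
proof (cases "T \<in> sets lebesgue")
  case True
  then have "measure lebesgue T \<le> measure lebesgue (\<Union>j\<in>H. {c j - \<mu>..c j + \<mu>})"
    using assms by (intro measure_mono_fmeasurable fmeasurable.finite_UN) auto
  also have "\<dots> \<le> (\<Sum>j\<in>H. measure lebesgue {c j - \<mu>..c j + \<mu>})"
    using assms(1) by (intro measure_UNION_le) auto
  also have "\<dots> = real (card H) * (2 * \<mu>)" using assms(3) by simp
  finally show ?thesis .
next
  case False
  then show ?thesis using assms(3) by (simp add: measure_notin_sets)
qed

lemma
  fixes x y :: "'a::linordered_idom"
  assumes "\<bar>x\<bar> \<le> a" "\<bar>y\<bar> \<le> b"
  shows abs_mult_le_mult: "\<bar>x * y\<bar> \<le> a * b" and abs_add_le_add: "\<bar>x + y\<bar> \<le> a + b"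
proof -
  have "0 \<le> a" using assms(1) abs_ge_zero order_trans by blast
  then show "\<bar>x * y\<bar> \<le> a * b" unfolding abs_mult using assms by (intro mult_mono) auto
  show "\<bar>x + y\<bar> \<le> a + b" using abs_triangle_ineq add_mono[OF assms] by (rule order_trans)
qed

definition lattice_cell :: "real \<Rightarrow> int^'n \<Rightarrow> (real^'n) set" where
  "lattice_cell \<delta> k = {x. \<forall>i. \<bar>x $ i - of_int (k $ i) * \<delta>\<bar> \<le> \<delta>}"

lemma finite_if_coordinates_bounded:
  fixes K :: "(int^'n) set" and R :: real
  assumes "0 < \<delta>" "\<And>k i. k \<in> K \<Longrightarrow> \<bar>of_int (k $ i) * \<delta>\<bar> \<le> R"
  shows "finite K"
proof -
  have "- R / \<delta> \<le> of_int (k $ i) \<and> of_int (k $ i) \<le> R / \<delta>" if "k \<in> K" for k i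
  proof -
    have "- R \<le> of_int (k $ i) * \<delta>" "of_int (k $ i) * \<delta> \<le> R" using assms(2)[OF that, of i] by linarith+
    then show ?thesis using assms(1) by (simp only: pos_le_divide_eq pos_divide_le_eq)
  qed
  then have "finite (\<Union>i. (\<lambda>k. k $ i) ` K)"
    by (intro finite_ints_in_interval[of _ "- R / \<delta>" "R / \<delta>"]) auto
  then have "finite (\<Pi>\<^sub>E i\<in>(UNIV :: 'n set). \<Union>i. (\<lambda>k. k $ i) ` K)" by (intro finite_PiE) auto
  then have "finite (vec_nth ` K)" by (rule rev_finite_subset) auto
  then show ?thesis by (rule finite_imageD) (simp add: inj_on_def vec_nth_inject)
qed

definition spacing_const :: "real \<Rightarrow> real \<Rightarrow> real" where
  "spacing_const R N = N * (31 * R ^ 6)\<^sup>2"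

lemma spacing_const_ge:
  assumes "1 \<le> R" "1 \<le> N"
  shows "31 * R ^ 6 \<le> spacing_const R N" "1 \<le> spacing_const R N"
proof -
  have R: "1 \<le> R ^ 6" using assms(1) by (rule one_le_power)
  then have "31 * R ^ 6 \<le> (31 * R ^ 6)\<^sup>2" using self_le_power[of "31 * R ^ 6" 2] by simp
  also have "\<dots> \<le> N * (31 * R ^ 6)\<^sup>2" using assms(2) mult_right_mono[of 1 N "(31 * R ^ 6)\<^sup>2"] by simp
  finally show "31 * R ^ 6 \<le> spacing_const R N" by (simp add: spacing_const_def)
  then show "1 \<le> spacing_const R N" using R by linarith
qed

locale SL2_lines =
  fixes R N \<delta> lam :: real and L :: "(real^4) set" and E :: "(real^3) set" and K :: "(int^3) set"
  assumes R: "1 \<le> R" and N: "1 \<le> N" and \<delta>: "0 < \<delta>" "\<delta> \<le> 1/8"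
    and L: "finite L" "L \<subseteq> {p. SL2_param p} \<inter> ball 0 R" "real (card L) \<le> N / \<delta>\<^sup>2"
    and spacing: "\<And>x r. \<delta> \<le> r \<Longrightarrow> r \<le> 1 \<Longrightarrow> real (card (L \<inter> ball x r)) \<le> (r / \<delta>)\<^sup>2"
    and K: "finite K" "\<And>k i. k \<in> K \<Longrightarrow> \<bar>of_int (k $ i) * \<delta>\<bar> \<le> R"
    and E: "E \<subseteq> (\<Union>k\<in>K. lattice_cell \<delta> k)"
    and rich: "0 < lam" "\<And>p. p \<in> L \<Longrightarrow> lam \<le> measure lebesgue {s. line_of p s \<in> E}"
begin

lemma det: "p \<in> L \<Longrightarrow> p $ 1 * p $ 4 - p $ 2 * p $ 3 = 1"
  using L(2) by (auto simp: SL2_param_def)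

lemma abs_component_le: "p \<in> L \<Longrightarrow> \<bar>p $ i\<bar> \<le> R"
  using L(2) order_trans[OF component_le_norm_cart, of p R i] by auto

lemma R_power_mono: "i \<le> j \<Longrightarrow> R ^ i \<le> R ^ j"
  using R by (intro power_increasing)

lemma card_ball_le:
  assumes "\<delta> \<le> r"
  shows "real (card (L \<inter> ball x r)) \<le> N * (r / \<delta>)\<^sup>2"
proof (cases "r \<le> 1")
  case True
  have "real (card (L \<inter> ball x r)) \<le> 1 * (r / \<delta>)\<^sup>2" using spacing[OF assms True] by simp
  also have "\<dots> \<le> N * (r / \<delta>)\<^sup>2" using N by (intro mult_right_mono) auto
  finally show ?thesis .
next
  case False
  have "real (card (L \<inter> ball x r)) \<le> real (card L)" using L(1) by (simp add: card_mono)
  also have "\<dots> \<le> N * (1 / \<delta>\<^sup>2)" using L(3) by simp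
  also have "\<dots> \<le> N * (r / \<delta>)\<^sup>2"
    using N False one_le_power[of r 2] by (intro mult_left_mono) (auto simp: power_divide divide_right_mono)
  finally show ?thesis .
qed

lemma SL2_lines_subset:
  assumes "M \<subseteq> L"
  shows "SL2_lines R N \<delta> lam M E K"
proof
  show "real (card M) \<le> N / \<delta>\<^sup>2"
    using card_mono[OF L(1) assms] L(3) by simp
  show "real (card (M \<inter> ball x r)) \<le> (r / \<delta>)\<^sup>2" if "\<delta> \<le> r" "r \<le> 1" for x r
  proof -
    have "card (M \<inter> ball x r) \<le> card (L \<inter> ball x r)" using L(1) assms by (intro card_mono) auto
    then show ?thesis using spacing[OF that, of x] by linarith
  qed
qed (use R N \<delta> L K E rich assms finite_subset in auto)

end

locale SL2_chart = SL2_lines +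
  assumes steep: "\<And>p. p \<in> L \<Longrightarrow> 1 \<le> 2 * R * \<bar>p $ 4\<bar>"
begin

definition chart :: "real^4 \<Rightarrow> pt" where
  "chart p = (p $ 2 / p $ 4, p $ 3 / p $ 4, 1 / p $ 4)"

definition cells :: "(int \<times> int \<times> int) set" where
  "cells = (\<lambda>k. (k $ 2, k $ 1, k $ 3)) ` K"

abbreviation Q :: real where
  "Q \<equiv> spacing_const R N"

lemma nonzero: "p \<in> L \<Longrightarrow> p $ 4 \<noteq> 0"
  using steep by fastforce

lemma abs_divide_le:
  assumes "p \<in> L" "\<bar>x\<bar> \<le> a"
  shows "\<bar>x / p $ 4\<bar> \<le> a * (2 * R)"
proof -
  have "\<bar>1 / p $ 4\<bar> \<le> 2 * R" using steep[OF assms(1)] nonzero[OF assms(1)] by (simp add: field_simps)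
  from abs_mult_le_mult[OF assms(2) this] show ?thesis by simp
qed

lemma component_1_eq: "p \<in> L \<Longrightarrow> p $ 1 = 1 / p $ 4 + p $ 2 * (p $ 3 / p $ 4)"
  using det[of p] nonzero[of p] by (simp add: field_simps)

lemma mem_chart_cube:
  assumes "chart p \<in> cube (chart q) r"
  shows "\<bar>p $ 2 / p $ 4 - q $ 2 / q $ 4\<bar> \<le> r" "\<bar>p $ 3 / p $ 4 - q $ 3 / q $ 4\<bar> \<le> r" "\<bar>1 / p $ 4 - 1 / q $ 4\<bar> \<le> r"
  using assms by (auto simp: mem_cube chart_def Basis_prod_def)

lemma chart_mem_cube: "p \<in> L \<Longrightarrow> chart p \<in> cube 0 Q"
proof -
  assume p: "p \<in> L"
  have "2 * R \<le> Q" "R * (2 * R) \<le> Q"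
    using spacing_const_ge[OF R N] R_power_mono[of 1 6] R_power_mono[of 2 6] R by (auto simp: power2_eq_square)
  then show ?thesis
    using abs_divide_le[OF p abs_component_le[OF p], of 2] abs_divide_le[OF p abs_component_le[OF p], of 3]
      abs_divide_le[OF p, of 1 1]
    by (auto simp: mem_cube chart_def Basis_prod_def)
qed

lemma component_4_diff_le:
  assumes pq: "p \<in> L" "q \<in> L" and close: "chart p \<in> cube (chart q) r"
  shows "\<bar>p $ 4 - q $ 4\<bar> \<le> R\<^sup>2 * r"
proof -
  have "p $ 4 - q $ 4 = - (p $ 4 * (q $ 4 * (1 / p $ 4 - 1 / q $ 4)))"
    using nonzero[OF pq(1)] nonzero[OF pq(2)] by (simp add: field_simps)
  then have "\<bar>p $ 4 - q $ 4\<bar> = \<bar>p $ 4 * (q $ 4 * (1 / p $ 4 - 1 / q $ 4))\<bar>" by (simp only: abs_minus_cancel)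
  also have "\<dots> \<le> R * (R * r)"
    by (intro abs_mult_le_mult abs_component_le pq mem_chart_cube close)
  finally show ?thesis by (simp add: power2_eq_square mult_ac)
qed

lemma component_diff_le:
  assumes pq: "p \<in> L" "q \<in> L" and close: "chart p \<in> cube (chart q) r"
    and quotient: "\<bar>p $ i / p $ 4 - q $ i / q $ 4\<bar> \<le> r"
  shows "\<bar>p $ i - q $ i\<bar> \<le> 3 * R ^ 4 * r"
proof -
  have r: "0 \<le> r" using quotient by linarith
  have "p $ i - q $ i = (p $ i / p $ 4 - q $ i / q $ 4) * p $ 4 + q $ i / q $ 4 * (p $ 4 - q $ 4)"
    using nonzero[OF pq(1)] nonzero[OF pq(2)] by (simp add: algebra_simps)
  also have "\<bar>\<dots>\<bar> \<le> r * R + R * (2 * R) * (R\<^sup>2 * r)"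
    by (intro abs_add_le_add abs_mult_le_mult quotient abs_divide_le abs_component_le component_4_diff_le pq close)
  also have "\<dots> = R ^ 1 * r + 2 * R ^ 4 * r" by (simp add: power2_eq_square power4_eq_xxxx)
  also have "\<dots> \<le> R ^ 4 * r + 2 * R ^ 4 * r"
    using R_power_mono[of 1 4] r by (intro add_right_mono mult_right_mono) auto
  finally show ?thesis by (simp add: mult_ac)
qed

lemma component_1_diff_le:
  assumes pq: "p \<in> L" "q \<in> L" and close: "chart p \<in> cube (chart q) r"
  shows "\<bar>p $ 1 - q $ 1\<bar> \<le> 8 * R ^ 6 * r"
proof -
  note chart_close = mem_chart_cube[OF close]
  have r: "0 \<le> r" using chart_close(1) by linarith
  have "p $ 1 - q $ 1 = (1 / p $ 4 - 1 / q $ 4) + (p $ 2 - q $ 2) * (p $ 3 / p $ 4) + q $ 2 * (p $ 3 / p $ 4 - q $ 3 / q $ 4)"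
    unfolding component_1_eq[OF pq(1)] component_1_eq[OF pq(2)] right_diff_distrib left_diff_distrib by simp
  also have "\<bar>\<dots>\<bar> \<le> r + 3 * R ^ 4 * r * (R * (2 * R)) + R * r"
    by (intro abs_add_le_add abs_mult_le_mult component_diff_le abs_divide_le abs_component_le chart_close pq close)
  also have "\<dots> = R ^ 0 * r + 6 * R ^ 6 * r + R ^ 1 * r" by (simp add: eval_nat_numeral)
  also have "\<dots> \<le> R ^ 6 * r + 6 * R ^ 6 * r + R ^ 6 * r"
    using r by (intro add_mono mult_right_mono R_power_mono) auto
  finally show ?thesis by (simp add: mult_ac)
qed

lemma norm_diff_le_if_chart_close:
  assumes pq: "p \<in> L" "q \<in> L" and close: "chart p \<in> cube (chart q) r"
  shows "norm (p - q) \<le> 15 * R ^ 6 * r"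
proof -
  note chart_close = mem_chart_cube[OF close]
  have r: "0 \<le> r" using chart_close(1) by linarith
  have "norm (p - q) \<le> \<bar>p $ 1 - q $ 1\<bar> + \<bar>p $ 2 - q $ 2\<bar> + \<bar>p $ 3 - q $ 3\<bar> + \<bar>p $ 4 - q $ 4\<bar>"
    using norm_le_l1_cart[of "p - q"] by (simp add: sum_4)
  also have "\<dots> \<le> 8 * R ^ 6 * r + 3 * R ^ 4 * r + 3 * R ^ 4 * r + R\<^sup>2 * r"
    using component_1_diff_le[OF pq close] component_diff_le[OF pq close chart_close(1)]
      component_diff_le[OF pq close chart_close(2)] component_4_diff_le[OF pq close]
    by linarith
  also have "\<dots> \<le> 8 * R ^ 6 * r + 3 * R ^ 6 * r + 3 * R ^ 6 * r + R ^ 6 * r"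
    using r by (intro add_mono mult_right_mono mult_left_mono R_power_mono) auto
  finally show ?thesis by (simp add: mult_ac)
qed

lemma inj_on_chart: "inj_on chart L"
proof (rule inj_onI)
  fix p q assume pq: "p \<in> L" "q \<in> L" "chart p = chart q"
  have "norm (p - q) \<le> 15 * R ^ 6 * 0"
    by (intro norm_diff_le_if_chart_close pq) (simp add: pq(3) mem_cube)
  then show "p = q" by simp
qed

lemma card_chart_image_cube_le:
  assumes r: "\<delta> \<le> r"
  shows "real (card (chart ` L \<inter> cube a r)) \<le> Q * (r / \<delta>)\<^sup>2"
proof (cases "chart ` L \<inter> cube a r = {}")
  case True
  then show ?thesis using spacing_const_ge[OF R N] by (simp only: card.empty) simp
next
  case False
  then obtain q where q: "q \<in> L" "chart q \<in> cube a r" by auto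
  define r' where "r' = 31 * R ^ 6 * r"
  have r_pos: "0 < r" using r \<delta> by linarith
  have R6: "1 \<le> R ^ 6" using R by (rule one_le_power)
  have "chart ` L \<inter> cube a r \<subseteq> chart ` (L \<inter> ball q r')"
  proof
    fix y assume "y \<in> chart ` L \<inter> cube a r"
    then obtain p where p: "p \<in> L" "y = chart p" "chart p \<in> cube a r" by auto
    have "chart q \<in> cube (chart p) (r + r)"
      using q(2) p(3) by (rule cube_triangle)
    then have "norm (q - p) \<le> 15 * R ^ 6 * (r + r)" by (rule norm_diff_le_if_chart_close[OF q(1) p(1)])
    also have "\<dots> < r'"
    proof -
      have "0 < R ^ 6 * r" using R6 r_pos by (intro mult_pos_pos) auto
      then show ?thesis by (simp add: r'_def mult_ac)
    qed
    finally show "y \<in> chart ` (L \<inter> ball q r')" using p by (auto simp: dist_norm)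
  qed
  then have "card (chart ` L \<inter> cube a r) \<le> card (chart ` (L \<inter> ball q r'))"
    using L(1) by (intro card_mono) auto
  also have "\<dots> \<le> card (L \<inter> ball q r')" using L(1) by (intro card_image_le) auto
  finally have "real (card (chart ` L \<inter> cube a r)) \<le> real (card (L \<inter> ball q r'))" by simp
  also have "\<dots> \<le> N * (r' / \<delta>)\<^sup>2"
  proof (rule card_ball_le)
    have "1 * r \<le> 31 * R ^ 6 * r" using R6 r_pos by (intro mult_right_mono) auto
    then show "\<delta> \<le> r'" using r by (simp add: r'_def)
  qed
  also have "\<dots> = Q * (r / \<delta>)\<^sup>2" by (simp add: spacing_const_def r'_def power_divide power_mult_distrib)
  finally show ?thesis .
qed

text \<open>In terms of \<open>(B, C, W) = chart p\<close> and \<open>y = b + s d\<close> the point at height \<open>s\<close> is \<open>(W + C y, y, s)\<close> with \<open>s = W y - B\<close>.\<close>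
lemma
  assumes p: "p \<in> L" and cell: "line_of p s \<in> lattice_cell \<delta> k"
  shows incident_if_line_meets_cell: "incident \<delta> Q (chart p) (k $ 2, k $ 1, k $ 3)"
    and height_close_if_line_meets_cell: "\<bar>s - (of_int (k $ 2) * \<delta> - p $ 2) / p $ 4\<bar> \<le> 2 * R * \<delta>"
proof -
  define y where "y = p $ 2 + s * p $ 4"
  let ?j = "of_int (k $ 2) * \<delta>"
  have near: "\<bar>p $ 1 + s * p $ 3 - of_int (k $ 1) * \<delta>\<bar> \<le> \<delta>" "\<bar>y - ?j\<bar> \<le> \<delta>" "\<bar>s - of_int (k $ 3) * \<delta>\<bar> \<le> \<delta>"
    using cell by (auto simp: lattice_cell_def line_of_def forall_3 y_def)
  then have j: "\<bar>?j - y\<bar> \<le> \<delta>" by (simp add: abs_minus_commute)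
  have "s - (?j - p $ 2) / p $ 4 = (y - ?j) / p $ 4"
    using nonzero[OF p] by (simp add: y_def field_simps)
  then show "\<bar>s - (?j - p $ 2) / p $ 4\<bar> \<le> 2 * R * \<delta>"
    using abs_divide_le[OF p near(2)] by (simp add: mult_ac)
  have scale: "\<delta> + R * (2 * R) * \<delta> \<le> Q * \<delta>" "\<delta> + 2 * R * \<delta> \<le> Q * \<delta>"
  proof -
    have "1 + R * (2 * R) \<le> Q" "1 + 2 * R \<le> Q"
      using spacing_const_ge[OF R N] R_power_mono[of 0 6] R_power_mono[of 1 6] R_power_mono[of 2 6]
      by (auto simp: power2_eq_square)
    then have "(1 + R * (2 * R)) * \<delta> \<le> Q * \<delta>" "(1 + 2 * R) * \<delta> \<le> Q * \<delta>" using \<delta>(1) by auto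
    then show "\<delta> + R * (2 * R) * \<delta> \<le> Q * \<delta>" "\<delta> + 2 * R * \<delta> \<le> Q * \<delta>"
      by (simp_all add: distrib_right)
  qed
  have "1 / p $ 4 + p $ 3 / p $ 4 * ?j - of_int (k $ 1) * \<delta>
      = (p $ 1 + s * p $ 3 - of_int (k $ 1) * \<delta>) + p $ 3 / p $ 4 * (?j - y)"
    unfolding component_1_eq[OF p] using nonzero[OF p] by (simp add: y_def field_simps)
  also have "\<bar>\<dots>\<bar> \<le> \<delta> + R * (2 * R) * \<delta>"
    by (intro abs_add_le_add abs_mult_le_mult near j abs_divide_le abs_component_le p)
  finally have x_close: "\<bar>1 / p $ 4 + p $ 3 / p $ 4 * ?j - of_int (k $ 1) * \<delta>\<bar> \<le> Q * \<delta>"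
    using scale(1) by (rule order_trans)
  have "1 / p $ 4 * ?j - p $ 2 / p $ 4 - of_int (k $ 3) * \<delta>
      = (s - of_int (k $ 3) * \<delta>) + (?j - y) / p $ 4"
    using nonzero[OF p] by (simp add: y_def field_simps)
  also have "\<bar>\<dots>\<bar> \<le> \<delta> + \<delta> * (2 * R)"
    by (intro abs_add_le_add near j abs_divide_le p)
  finally have "\<bar>1 / p $ 4 * ?j - p $ 2 / p $ 4 - of_int (k $ 3) * \<delta>\<bar> \<le> Q * \<delta>"
    using scale(2) by (simp only: mult.commute[of \<delta>])
  with x_close show "incident \<delta> Q (chart p) (k $ 2, k $ 1, k $ 3)"
    by (simp add: incident_def chart_def)
qed

lemma finite_cells: "finite cells"
  using K(1) by (simp add: cells_def)

lemma card_incident_layers_ge: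
  assumes p: "p \<in> L"
  shows "lam / (4 * R) / \<delta> \<le> real (card {j. \<exists>c. (j, c) \<in> cells \<and> incident \<delta> Q (chart p) (j, c)})"
    (is "_ \<le> real (card ?H)")
proof -
  let ?c = "\<lambda>j. (of_int j * \<delta> - p $ 2) / p $ 4"
  have "?H \<subseteq> fst ` cells" by force
  then have "finite ?H" by (rule finite_subset) (simp add: finite_cells)
  moreover have "{s. line_of p s \<in> E} \<subseteq> (\<Union>j\<in>?H. {?c j - 2 * R * \<delta>..?c j + 2 * R * \<delta>})"
  proof
    fix s assume "s \<in> {s. line_of p s \<in> E}"
    then obtain k where k: "k \<in> K" "line_of p s \<in> lattice_cell \<delta> k" using E by auto
    then have "k $ 2 \<in> ?H" using incident_if_line_meets_cell[OF p k(2)] by (auto simp: cells_def)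
    moreover have "s \<in> {?c (k $ 2) - 2 * R * \<delta>..?c (k $ 2) + 2 * R * \<delta>}"
      using height_close_if_line_meets_cell[OF p k(2)] by (auto simp only: abs_le_iff atLeastAtMost_iff)
    ultimately show "s \<in> (\<Union>j\<in>?H. {?c j - 2 * R * \<delta>..?c j + 2 * R * \<delta>})" by blast
  qed
  ultimately have "measure lebesgue {s. line_of p s \<in> E} \<le> real (card ?H) * (2 * (2 * R * \<delta>))"
    by (rule measure_le_card_mult_interval) (use R \<delta> in simp)
  then have "lam \<le> real (card ?H) * (4 * R * \<delta>)" using rich(2)[OF p] by simp
  then show ?thesis using R \<delta> by (simp add: divide_le_eq mult_ac)
qed

theorem chart_bound:
  assumes k: "8 \<le> k" "8 * Q\<^sup>2 * \<delta> * real k ^ (2 * (n + 2)) \<le> 1" "1 \<le> 8 * Q\<^sup>2 * \<delta> * (2 * real k) ^ (2 * (n + 2))"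
  shows "(lam / (4 * R)) ^ 7 * (\<delta>\<^sup>2 * real (card L)) \<le> kakeya_const Q n * real k ^ 128 * (\<delta> ^ 3 * real (card K))"
proof -
  have Q: "1 \<le> Q" by (rule spacing_const_ge[OF R N])
  interpret discrete_kakeya \<delta> Q "lam / (4 * R)" k n "chart ` L" cells
  proof
    show "\<bar>of_int j * \<delta>\<bar> \<le> Q" if "(j, c) \<in> cells" for j c
    proof -
      have "R \<le> 31 * R ^ 6" using R_power_mono[of 1 6] R by simp
      then have "R \<le> Q" using spacing_const_ge(1)[OF R N] by linarith
      moreover obtain k where "k \<in> K" "j = k $ 2" using \<open>(j, c) \<in> cells\<close> by (auto simp: cells_def)
      ultimately show ?thesis using K(2)[of k 2] by simp
    qed
  qed (use \<delta> k Q rich(1) R L(1) finite_cells chart_mem_cube card_incident_layers_ge card_chart_image_cube_le in auto)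
  have "card cells \<le> card K" unfolding cells_def using K(1) by (rule card_image_le)
  then have "kakeya_const Q n * real k ^ 128 * (\<delta> ^ 3 * real (card cells)) \<le> kakeya_const Q n * real k ^ 128 * (\<delta> ^ 3 * real (card K))"
    using \<delta> kakeya_const_nonneg[OF Q] by (intro mult_left_mono) auto
  then show ?thesis using discrete_bound card_image[OF inj_on_chart] by simp
qed

end

text \<open>The quarter turn about the vertical axis maps \<open>SL\<^sub>2\<close> lines to \<open>SL\<^sub>2\<close> lines and exchanges \<open>\<bar>c\<bar>\<close> and \<open>\<bar>d\<bar>\<close>.\<close>
definition quarter_turn :: "'a::ab_group_add^3 \<Rightarrow> 'a^3" where
  "quarter_turn x = vector [x $ 2, - x $ 1, x $ 3]"

definition param_turn :: "real^4 \<Rightarrow> real^4" where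
  "param_turn p = vector [p $ 2, - p $ 1, p $ 4, - p $ 3]"

lemma quarter_turn_component [simp]:
  "quarter_turn x $ 1 = x $ 2" "quarter_turn x $ 2 = - x $ 1" "quarter_turn x $ 3 = x $ 3"
  by (simp_all add: quarter_turn_def)

lemma param_turn_component [simp]:
  "param_turn p $ 1 = p $ 2" "param_turn p $ 2 = - p $ 1" "param_turn p $ 3 = p $ 4" "param_turn p $ 4 = - p $ 3"
  by (simp_all add: param_turn_def vector_def)

lemma inj_quarter_turn: "inj quarter_turn"
  by (rule injI) (simp add: vec_eq_iff forall_3)

lemma line_of_param_turn: "line_of (param_turn p) s = quarter_turn (line_of p s)"
  by (simp add: vec_eq_iff forall_3 line_of_def)

lemma quarter_turn_lattice_cell: "x \<in> lattice_cell \<delta> k \<Longrightarrow> quarter_turn x \<in> lattice_cell \<delta> (quarter_turn k)"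
  by (auto simp: lattice_cell_def forall_3 abs_le_iff)

lemma norm_param_turn: "norm (param_turn p) = norm p"
  by (simp add: norm_eq_sqrt_inner inner_vec_def sum_4 add_ac)

lemma dist_param_turn: "dist (param_turn p) x = dist p (- param_turn x)"
proof -
  have "param_turn p - x = param_turn (p + param_turn x)" by (simp add: vec_eq_iff forall_4)
  then have "norm (param_turn p - x) = norm (p + param_turn x)" by (simp only: norm_param_turn)
  then show ?thesis by (simp add: dist_norm)
qed

lemma inj_param_turn: "inj param_turn"
  by (rule injI) (simp add: vec_eq_iff forall_4)

context SL2_lines
begin

lemma SL2_lines_turn:
  "SL2_lines R N \<delta> lam (param_turn ` L) (quarter_turn ` E) (quarter_turn ` K)"
proof
  show "param_turn ` L \<subseteq> {p. SL2_param p} \<inter> ball 0 R"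
    using L(2) by (auto simp: SL2_param_def norm_param_turn algebra_simps)
  show "real (card (param_turn ` L)) \<le> N / \<delta>\<^sup>2"
    using L(3) by (simp add: card_image inj_on_subset[OF inj_param_turn])
  show "real (card (param_turn ` L \<inter> ball x r)) \<le> (r / \<delta>)\<^sup>2" if "\<delta> \<le> r" "r \<le> 1" for x r
  proof -
    have "param_turn ` L \<inter> ball x r = param_turn ` (L \<inter> ball (- param_turn x) r)"
      using dist_param_turn by (auto simp: dist_commute)
    then show ?thesis
      using spacing[OF that] by (simp add: card_image inj_on_subset[OF inj_param_turn])
  qed
  show "\<bar>of_int (k $ i) * \<delta>\<bar> \<le> R" if "k \<in> quarter_turn ` K" for k i
    using that K(2) exhaust_3[of i] by (auto simp flip: minus_mult_left)
  show "quarter_turn ` E \<subseteq> (\<Union>k\<in>quarter_turn ` K. lattice_cell \<delta> k)"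
    using E quarter_turn_lattice_cell by blast
  show "lam \<le> measure lebesgue {s. line_of p s \<in> quarter_turn ` E}" if "p \<in> param_turn ` L" for p
    using that rich(2) by (auto simp: line_of_param_turn inj_image_mem_iff[OF inj_quarter_turn])
qed (use R N \<delta> L K rich in auto)

theorem SL2_lines_bound:
  assumes k: "8 \<le> k" "8 * (spacing_const R N)\<^sup>2 * \<delta> * real k ^ (2 * (n + 2)) \<le> 1"
    "1 \<le> 8 * (spacing_const R N)\<^sup>2 * \<delta> * (2 * real k) ^ (2 * (n + 2))"
  shows "(lam / (4 * R)) ^ 7 * (\<delta>\<^sup>2 * real (card L))
    \<le> 2 * kakeya_const (spacing_const R N) n * real k ^ 128 * (\<delta> ^ 3 * real (card K))"
proof -
  define L4 where "L4 = {p\<in>L. 1 \<le> 2 * R * \<bar>p $ 4\<bar>}"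
  define L3 where "L3 = {p\<in>L. 1 \<le> 2 * R * \<bar>p $ 3\<bar>}"
  let ?bound = "kakeya_const (spacing_const R N) n * real k ^ 128 * (\<delta> ^ 3 * real (card K))"
  have "L \<subseteq> L4 \<union> L3"
  proof
    fix p assume p: "p \<in> L"
    have "\<bar>p $ 1 * p $ 4\<bar> \<le> R * \<bar>p $ 4\<bar>" "\<bar>p $ 2 * p $ 3\<bar> \<le> R * \<bar>p $ 3\<bar>"
      by (intro abs_mult_le_mult abs_component_le[OF p]; simp)+
    then have "1 \<le> R * \<bar>p $ 4\<bar> + R * \<bar>p $ 3\<bar>" using det[OF p] by linarith
    then show "p \<in> L4 \<union> L3" using p by (auto simp: L4_def L3_def)
  qed
  then have "card L \<le> card L4 + card L3"
    using card_mono[of "L4 \<union> L3" L] card_Un_le[of L4 L3] L(1) by (simp add: L4_def L3_def)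
  then have "real (card L) \<le> real (card L4) + real (card L3)" by linarith
  then have "(lam / (4 * R)) ^ 7 * (\<delta>\<^sup>2 * real (card L))
      \<le> (lam / (4 * R)) ^ 7 * (\<delta>\<^sup>2 * real (card L4)) + (lam / (4 * R)) ^ 7 * (\<delta>\<^sup>2 * real (card L3))"
    unfolding distrib_left[symmetric] using rich(1) R by (intro mult_left_mono) auto
  also have "\<dots> \<le> ?bound + ?bound"
  proof (rule add_mono)
    interpret L4: SL2_lines R N \<delta> lam L4 E K by (rule SL2_lines_subset) (auto simp: L4_def)
    interpret SL2_chart R N \<delta> lam L4 E K by unfold_locales (simp add: L4_def)
    show "(lam / (4 * R)) ^ 7 * (\<delta>\<^sup>2 * real (card L4)) \<le> ?bound" by (rule chart_bound[OF k])
  next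
    interpret L3: SL2_lines R N \<delta> lam L3 E K by (rule SL2_lines_subset) (auto simp: L3_def)
    interpret turned: SL2_lines R N \<delta> lam "param_turn ` L3" "quarter_turn ` E" "quarter_turn ` K"
      by (rule L3.SL2_lines_turn)
    interpret SL2_chart R N \<delta> lam "param_turn ` L3" "quarter_turn ` E" "quarter_turn ` K"
      by unfold_locales (auto simp: L3_def)
    show "(lam / (4 * R)) ^ 7 * (\<delta>\<^sup>2 * real (card L3)) \<le> ?bound"
      using chart_bound[OF k]
      by (simp add: card_image inj_on_subset[OF inj_param_turn] inj_on_subset[OF inj_quarter_turn])
  qed
  finally show ?thesis by (simp add: mult_ac)
qed

end

lemma
  assumes "0 < \<delta>"
  shows lmeasurable_delta_cube: "delta_cube \<delta> k \<in> lmeasurable"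
    and measure_delta_cube: "measure lebesgue (delta_cube \<delta> k) = \<delta> ^ 3"
proof -
  let ?a = "\<chi> i. \<delta> * of_int (k $ i)" and ?b = "\<chi> i. \<delta> * (of_int (k $ i) + 1)"
  have cbox: "delta_cube \<delta> k = cbox ?a ?b" by (auto simp: delta_cube_def mem_box_cart)
  then show "delta_cube \<delta> k \<in> lmeasurable" by simp
  have "?a \<in> cbox ?a ?b" using assms by (simp add: mem_box_cart)
  then have "cbox ?a ?b \<noteq> {}" by blast
  from content_cbox_cart[OF this] show "measure lebesgue (delta_cube \<delta> k) = \<delta> ^ 3"
    unfolding cbox by (simp add: algebra_simps power3_eq_cube)
qed

lemma delta_cube_subset_lattice_cell: "delta_cube \<delta> k \<subseteq> lattice_cell \<delta> k"
proof
  fix x assume x: "x \<in> delta_cube \<delta> k"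
  have "\<bar>x $ i - of_int (k $ i) * \<delta>\<bar> \<le> \<delta>" for i
  proof -
    have "\<delta> * of_int (k $ i) \<le> x $ i" "x $ i \<le> \<delta> * (of_int (k $ i) + 1)" using x by (auto simp: delta_cube_def)
    then show ?thesis by (simp add: abs_le_iff algebra_simps)
  qed
  then show "x \<in> lattice_cell \<delta> k" by (simp add: lattice_cell_def)
qed

lemma negligible_Int_delta_cubes:
  assumes "0 < \<delta>" "k \<noteq> l"
  shows "negligible (delta_cube \<delta> k \<inter> delta_cube \<delta> l)"
proof -
  obtain i where i: "k $ i \<noteq> l $ i" using assms(2) by (auto simp: vec_eq_iff)
  have shared_face: "x = \<delta> * of_int b" if "a < b" "x \<le> \<delta> * (of_int a + 1)" "\<delta> * of_int b \<le> x" for x and a b :: int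
  proof -
    have "of_int a + 1 \<le> (of_int b :: real)" using that(1) by linarith
    then have "\<delta> * (of_int a + 1) \<le> \<delta> * of_int b" using assms(1) by (intro mult_left_mono) auto
    then show ?thesis using that by linarith
  qed
  have "delta_cube \<delta> k \<inter> delta_cube \<delta> l \<subseteq> {x. x $ i = \<delta> * of_int (max (k $ i) (l $ i))}"
  proof
    fix x assume "x \<in> delta_cube \<delta> k \<inter> delta_cube \<delta> l"
    then have "\<delta> * of_int (k $ i) \<le> x $ i" "x $ i \<le> \<delta> * (of_int (k $ i) + 1)"
        "\<delta> * of_int (l $ i) \<le> x $ i" "x $ i \<le> \<delta> * (of_int (l $ i) + 1)"
      by (auto simp: delta_cube_def)
    then show "x \<in> {x. x $ i = \<delta> * of_int (max (k $ i) (l $ i))}"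
      using shared_face[of "k $ i" "l $ i" "x $ i"] shared_face[of "l $ i" "k $ i" "x $ i"] i by (auto simp: max_def)
  qed
  moreover have "negligible {x::real^3. x $ i = \<delta> * of_int (max (k $ i) (l $ i))}"
    unfolding cart_eq_inner_axis by (rule negligible_standard_hyperplane) (simp add: axis_in_Basis_iff)
  ultimately show ?thesis by (rule negligible_subset[rotated])
qed

lemma measure_Union_delta_cubes:
  assumes "0 < \<delta>" "finite K"
  shows "measure lebesgue (\<Union>k\<in>K. delta_cube \<delta> k) = \<delta> ^ 3 * real (card K)"
proof -
  have "measure lebesgue (\<Union> (delta_cube \<delta> ` K)) = (\<Sum>k\<in>K. measure lebesgue (delta_cube \<delta> k))"
    using assms by (intro measure_negligible_finite_Union_image lmeasurable_delta_cube)
      (auto simp: pairwise_def negligible_Int_delta_cubes)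
  then show ?thesis using assms by (simp add: measure_delta_cube mult.commute)
qed

lemma delta_cube_coordinate_le:
  assumes "0 < \<delta>" "delta_cube \<delta> k \<subseteq> ball 0 R"
  shows "\<bar>of_int (k $ i) * \<delta>\<bar> \<le> R"
proof -
  define x :: "real^3" where "x = (\<chi> i. \<delta> * of_int (k $ i))"
  have "x \<in> delta_cube \<delta> k" using assms(1) by (simp add: x_def delta_cube_def)
  then have "norm x < R" using assms(2) by auto
  moreover have "\<bar>x $ i\<bar> \<le> norm x" by (rule component_le_norm_cart)
  ultimately show ?thesis by (simp add: x_def mult.commute)
qed

lemma line_meas_le:
  assumes "1 \<le> R" "p \<in> ball 0 R"
  shows "line_meas p E \<le> 2 * R * measure lebesgue {s. line_of p s \<in> E}"
proof -
  have "(p $ i)\<^sup>2 \<le> R\<^sup>2" for i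
    using power_mono[of "\<bar>p $ i\<bar>" R 2] component_le_norm_cart[of p i] assms(2) by simp
  from this[of 3] this[of 4] have "(p $ 3)\<^sup>2 + (p $ 4)\<^sup>2 + 1 \<le> (2 * R)\<^sup>2"
    using one_le_power[OF assms(1), of 2] by (simp add: power_mult_distrib)
  then have "sqrt ((p $ 3)\<^sup>2 + (p $ 4)\<^sup>2 + 1) \<le> 2 * R" using assms(1) by (intro real_le_lsqrt) auto
  then show ?thesis unfolding line_meas_def by (intro mult_right_mono) auto
qed

lemma exists_card_unit_balls_bound:
  fixes c :: "'a::euclidean_space"
  obtains N :: real where "1 \<le> N"
    "\<And>L q. \<lbrakk>finite L; L \<subseteq> ball c R; \<And>x. real (card (L \<inter> ball x 1)) \<le> q\<rbrakk> \<Longrightarrow> real (card L) \<le> N * q"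
proof -
  obtain S where S: "finite S" "cball c R \<subseteq> (\<Union>x\<in>S. ball x 1)"
    using compact_cball[of c R] unfolding compact_eq_totally_bounded by (metis zero_less_one)
  have "real (card L) \<le> real (card S + 1) * q"
    if "finite L" "L \<subseteq> ball c R" "\<And>x. real (card (L \<inter> ball x 1)) \<le> q" for L q
  proof -
    have "L \<subseteq> (\<Union>x\<in>S. L \<inter> ball x 1)" using that(2) S(2) ball_subset_cball[of c R] by blast
    then have "card L \<le> card (\<Union>x\<in>S. L \<inter> ball x 1)" using that(1) S(1) by (intro card_mono) auto
    also have "\<dots> \<le> (\<Sum>x\<in>S. card (L \<inter> ball x 1))" by (rule card_UN_le[OF S(1)])
    finally have "real (card L) \<le> (\<Sum>x\<in>S. real (card (L \<inter> ball x 1)))" by (simp flip: of_nat_sum)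
    also have "\<dots> \<le> (\<Sum>x\<in>S. q)" by (intro sum_mono that(3))
    finally have "real (card L) \<le> real (card S) * q" by simp
    moreover have "0 \<le> q" using that(3)[of c] by linarith
    ultimately show ?thesis by (simp add: distrib_right)
  qed
  then show ?thesis using that[of "real (card S + 1)"] by simp
qed

lemma exists_nat_scale:
  fixes D :: real
  assumes "0 < D" "D * real a ^ m \<le> 1" "0 < m" "0 < a"
  obtains k :: nat where "a \<le> k" "D * real k ^ m \<le> 1" "1 \<le> D * (2 * real k) ^ m"
proof -
  obtain i :: nat where i: "1 / D < real i" using reals_Archimedean2 by blast
  have "1 / D < real (Suc i) ^ m"
    using i self_le_power[of "real (Suc i)" m] assms(3) by simp
  then have "1 < D * real (Suc i) ^ m" using assms(1) by (simp only: pos_divide_less_eq mult.commute)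
  then have "\<exists>l. 1 < D * real l ^ m" by blast
  then obtain l where l: "1 < D * real l ^ m" "\<And>i. i < l \<Longrightarrow> D * real i ^ m \<le> 1"
    using exists_least_iff[of "\<lambda>i. 1 < D * real i ^ m"] by (meson not_less)
  have "a < l"
  proof (rule ccontr)
    assume "\<not> a < l"
    then have "D * real l ^ m \<le> D * real a ^ m" using assms(1) by (intro mult_left_mono power_mono) auto
    then show False using l(1) assms(2) by simp
  qed
  then obtain k where k: "l = Suc k" "a \<le> k" by (cases l) auto
  have "D * real l ^ m \<le> D * (2 * real k) ^ m"
    using assms(1,4) k by (intro mult_left_mono power_mono) auto
  then show ?thesis using that[of k] l k by simp
qed

lemma power_le_powr_if_power_le:
  fixes x \<delta> e :: real
  assumes "1 \<le> x" "0 < \<delta>" "\<delta> \<le> 1" "\<delta> * x ^ m \<le> 1" "0 < m" "real a \<le> e * real m"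
  shows "x ^ a \<le> \<delta> powr (- e)"
proof -
  have "x ^ m \<le> 1 / \<delta>" using assms(2,4) by (simp add: pos_le_divide_eq mult.commute)
  have "x ^ a = (x powr real m) powr (real a / real m)"
    unfolding powr_powr using assms(1,5) by (simp add: powr_realpow)
  also have "\<dots> \<le> (1 / \<delta>) powr (real a / real m)"
    using \<open>x ^ m \<le> 1 / \<delta>\<close> assms(1) by (intro powr_mono2) (auto simp: powr_realpow)
  also have "\<dots> \<le> (1 / \<delta>) powr e"
    using assms(2,3,5,6) by (intro powr_mono) (auto simp: pos_divide_le_eq)
  also have "\<dots> = \<delta> powr (- e)" using assms(2) by (simp add: powr_minus powr_divide inverse_eq_divide)
  finally show ?thesis .
qed

lemma mult_powr_le_1:
  fixes D :: real
  assumes "0 < e" "1 \<le> D" "0 < \<delta>" "\<delta> \<le> (1 / D) powr (1 / e)"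
  shows "D * \<delta> powr e \<le> 1"
proof -
  have "\<delta> powr e \<le> ((1 / D) powr (1 / e)) powr e" using assms by (intro powr_mono2) auto
  also have "\<dots> = 1 / D" using assms by (simp add: powr_powr)
  finally show ?thesis using assms(2) by (simp add: pos_le_divide_eq mult.commute)
qed

locale SL2_kakeya =
  fixes R \<delta> lam :: real and L :: "(real^4) set" and E :: "(real^3) set"
  assumes \<delta>_pos: "0 < \<delta>" and L: "finite L" "L \<subseteq> {p. SL2_param p} \<inter> ball 0 R"
    and spacing: "\<And>r x. \<delta> \<le> r \<Longrightarrow> r \<le> 1 \<Longrightarrow> real (card (L \<inter> ball x r)) \<le> (r / \<delta>)\<^sup>2"
    and E: "union_of_delta_cubes \<delta> E" "E \<subseteq> ball 0 R"
    and rich: "0 < lam" "\<And>p. p \<in> L \<Longrightarrow> lam \<le> line_meas p E"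
begin

theorem SL2_kakeya_bound:
  assumes R: "1 \<le> R" and N: "1 \<le> N" "real (card L) \<le> N / \<delta>\<^sup>2" and \<delta>: "\<delta> \<le> 1/8"
    and k: "8 \<le> k" "8 * (spacing_const R N)\<^sup>2 * \<delta> * real k ^ (2 * (n + 2)) \<le> 1"
      "1 \<le> 8 * (spacing_const R N)\<^sup>2 * \<delta> * (2 * real k) ^ (2 * (n + 2))"
  shows "lam ^ 7 * (\<delta>\<^sup>2 * real (card L))
    \<le> 2 * (8 * R\<^sup>2) ^ 7 * kakeya_const (spacing_const R N) n * real k ^ 128 * measure lebesgue E"
proof -
  obtain K where E_eq: "E = (\<Union>k\<in>K. delta_cube \<delta> k)" using E(1) by (auto simp: union_of_delta_cubes_def)
  have K: "\<bar>of_int (k $ i) * \<delta>\<bar> \<le> R" if "k \<in> K" for k i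
    using that E(2) by (intro delta_cube_coordinate_le \<delta>_pos) (auto simp: E_eq)
  then have "finite K" using \<delta>_pos finite_if_coordinates_bounded by blast
  interpret SL2_lines R N \<delta> "lam / (2 * R)" L E K
  proof
    show "E \<subseteq> (\<Union>k\<in>K. lattice_cell \<delta> k)" unfolding E_eq using delta_cube_subset_lattice_cell by blast
    show "lam / (2 * R) \<le> measure lebesgue {s. line_of p s \<in> E}" if "p \<in> L" for p
      using order_trans[OF rich(2)[OF that] line_meas_le[OF R]] L(2) that R
      by (auto simp: pos_divide_le_eq mult_ac)
  qed (use R N \<delta> \<delta>_pos L spacing K \<open>finite K\<close> rich in auto)
  have "lam ^ 7 * (\<delta>\<^sup>2 * real (card L)) = (8 * R\<^sup>2) ^ 7 * ((lam / (2 * R) / (4 * R)) ^ 7 * (\<delta>\<^sup>2 * real (card L)))"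
    using R by (simp add: power_divide power_mult_distrib power2_eq_square)
  also have "\<dots> \<le> (8 * R\<^sup>2) ^ 7 * (2 * kakeya_const (spacing_const R N) n * real k ^ 128 * (\<delta> ^ 3 * real (card K)))"
    by (intro mult_left_mono SL2_lines_bound k) simp
  also have "\<delta> ^ 3 * real (card K) = measure lebesgue E"
    unfolding E_eq by (rule measure_Union_delta_cubes[OF \<delta>_pos \<open>finite K\<close>, symmetric])
  finally show ?thesis by (simp add: mult_ac)
qed

theorem SL2_kakeya_powr_bound:
  assumes R: "1 \<le> R" and N: "1 \<le> N" "real (card L) \<le> N / \<delta>\<^sup>2" and \<delta>: "\<delta> \<le> 1/8"
    and n: "128 \<le> e * real (2 * (n + 2))" and small: "8 * (spacing_const R N)\<^sup>2 * \<delta> * 8 ^ (2 * (n + 2)) \<le> 1"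
  shows "lam ^ 7 * (\<delta>\<^sup>2 * real (card L))
    \<le> 2 * (8 * R\<^sup>2) ^ 7 * kakeya_const (spacing_const R N) n * \<delta> powr (- e) * measure lebesgue E"
proof -
  define Q where "Q = spacing_const R N"
  have Q: "1 \<le> Q" using spacing_const_ge(2)[OF R N(1)] by (simp add: Q_def)
  obtain k where k: "8 \<le> k" "8 * Q\<^sup>2 * \<delta> * real k ^ (2 * (n + 2)) \<le> 1" "1 \<le> 8 * Q\<^sup>2 * \<delta> * (2 * real k) ^ (2 * (n + 2))"
    using exists_nat_scale[of "8 * Q\<^sup>2 * \<delta>" 8 "2 * (n + 2)"] Q \<delta>_pos small by (auto simp: Q_def)
  have "real k ^ 128 \<le> \<delta> powr (- e)"
  proof (rule power_le_powr_if_power_le)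
    have "1 * (\<delta> * real k ^ (2 * (n + 2))) \<le> 8 * Q\<^sup>2 * (\<delta> * real k ^ (2 * (n + 2)))"
      using \<delta>_pos one_le_power[OF Q, of 2] by (intro mult_right_mono) auto
    then show "\<delta> * real k ^ (2 * (n + 2)) \<le> 1" using k(2) by (simp add: mult_ac)
  qed (use k(1) \<delta> \<delta>_pos n in auto)
  then have "2 * (8 * R\<^sup>2) ^ 7 * kakeya_const Q n * real k ^ 128 * measure lebesgue E
      \<le> 2 * (8 * R\<^sup>2) ^ 7 * kakeya_const Q n * \<delta> powr (- e) * measure lebesgue E"
    using kakeya_const_nonneg[OF Q] by (intro mult_right_mono mult_left_mono) auto
  with SL2_kakeya_bound[OF R N \<delta> k(1) k(2,3)[unfolded Q_def]] show ?thesis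
    unfolding Q_def by (rule order_trans)
qed

end

lemma SL2_kakeya_mono: "SL2_kakeya R \<delta> lam L E \<Longrightarrow> R \<le> R' \<Longrightarrow> SL2_kakeya R' \<delta> lam L E"
  using subset_ball[of R R' "0 :: real^4"] subset_ball[of R R' "0 :: real^3"]
  by (auto simp: SL2_kakeya_def)

lemma SL2_kakeya_estimate:
  fixes \<epsilon> R :: real
  assumes \<epsilon>: "0 < \<epsilon>"
  shows "\<exists>\<delta>0>0. \<forall>\<delta> lam L E. \<delta> \<le> \<delta>0 \<longrightarrow> SL2_kakeya R \<delta> lam L E \<longrightarrow>
    \<delta> powr \<epsilon> * lam powr 7 * (\<delta>\<^sup>2 * real (card L)) \<le> measure lebesgue E"
proof -
  define R' where "R' = max 1 R"
  have R': "1 \<le> R'" "R \<le> R'" by (auto simp: R'_def)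
  obtain N where N: "1 \<le> N" "\<And>(L :: (real^4) set) q. \<lbrakk>finite L; L \<subseteq> ball 0 R'; \<And>x. real (card (L \<inter> ball x 1)) \<le> q\<rbrakk>
      \<Longrightarrow> real (card L) \<le> N * q"
    using exists_card_unit_balls_bound by blast
  obtain n :: nat where n: "128 / \<epsilon> < real n" using reals_Archimedean2 by blast
  define Q where "Q = spacing_const R' N"
  define D where "D = max 1 (2 * (8 * R'\<^sup>2) ^ 7 * kakeya_const Q n)"
  define \<delta>0 where "\<delta>0 = min (1/8) (min (1 / (8 * Q\<^sup>2 * 8 ^ (2 * (n + 2)))) ((1 / D) powr (1 / (\<epsilon> / 2))))"
  have Q: "1 \<le> Q" using spacing_const_ge(2)[OF R'(1) N(1)] by (simp add: Q_def)
  have D: "1 \<le> D" "2 * (8 * R'\<^sup>2) ^ 7 * kakeya_const Q n \<le> D" by (auto simp: D_def)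
  have "0 < \<delta>0" using Q D(1) by (simp add: \<delta>0_def)
  moreover have "\<delta> powr \<epsilon> * lam powr 7 * (\<delta>\<^sup>2 * real (card L)) \<le> measure lebesgue E"
    if \<delta>_le: "\<delta> \<le> \<delta>0" and "SL2_kakeya R \<delta> lam L E" for \<delta> lam L E
  proof -
    interpret SL2_kakeya R' \<delta> lam L E by (rule SL2_kakeya_mono) fact+
    have \<delta>: "\<delta> \<le> 1/8" "8 * Q\<^sup>2 * \<delta> * 8 ^ (2 * (n + 2)) \<le> 1" "\<delta> \<le> (1 / D) powr (1 / (\<epsilon> / 2))"
      using \<delta>_le Q by (auto simp: \<delta>0_def pos_le_divide_eq mult_ac)
    have "real (card L) \<le> N / \<delta>\<^sup>2" using N(2)[of L "(1 / \<delta>)\<^sup>2"] L spacing[of 1] \<delta>(1) by (simp add: power_divide)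
    moreover have "128 \<le> \<epsilon> / 2 * real (2 * (n + 2))" using n \<epsilon> by (simp add: field_simps)
    ultimately have "lam ^ 7 * (\<delta>\<^sup>2 * real (card L))
        \<le> 2 * (8 * R'\<^sup>2) ^ 7 * kakeya_const Q n * \<delta> powr (- (\<epsilon> / 2)) * measure lebesgue E"
      using R'(1) N(1) \<delta>(1,2) unfolding Q_def by (intro SL2_kakeya_powr_bound)
    also have "\<dots> \<le> D * \<delta> powr (- (\<epsilon> / 2)) * measure lebesgue E"
      using D(2) by (intro mult_right_mono) auto
    finally have "\<delta> powr \<epsilon> * (lam ^ 7 * (\<delta>\<^sup>2 * real (card L))) \<le> \<delta> powr \<epsilon> * (D * \<delta> powr (- (\<epsilon> / 2)) * measure lebesgue E)"
      by (rule mult_left_mono) simp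
    also have "\<dots> = D * \<delta> powr (\<epsilon> / 2) * measure lebesgue E"
      using powr_add[of \<delta> \<epsilon> "- (\<epsilon> / 2)"] by (simp add: mult_ac)
    also have "\<dots> \<le> 1 * measure lebesgue E"
      using \<epsilon> D(1) \<delta>(3) \<delta>_pos by (intro mult_right_mono mult_powr_le_1) auto
    finally show ?thesis using rich(1) by (simp add: mult_ac)
  qed
  ultimately show ?thesis by auto
qed

theorem theorem1p2:
  "\<forall>\<epsilon>>0. \<exists>M>0. \<forall>R>0. \<exists>\<delta>0>0. \<forall>\<delta>. 0 < \<delta> \<and> \<delta> \<le> \<delta>0 \<longrightarrow>
     (\<forall>(L :: (real^4) set) (E :: (real^3) set) (lam::real).
        finite L \<and> L \<subseteq> {p. SL2_param p} \<inter> ball 0 R \<and>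
        (\<forall>r x. \<delta> \<le> r \<and> r \<le> 1 \<longrightarrow> real (card (L \<inter> ball x r)) \<le> (r / \<delta>)\<^sup>2) \<and>
        union_of_delta_cubes \<delta> E \<and> E \<subseteq> ball 0 R \<and>
        0 < lam \<and> (\<forall>p\<in>L. line_meas p E \<ge> lam)
        \<longrightarrow> measure lebesgue E \<ge> \<delta> powr \<epsilon> * lam powr M * (\<delta>\<^sup>2 * real (card L)))"
proof (intro allI impI, rule exI[of _ 7], intro conjI allI impI)
  fix \<epsilon> R :: real assume "0 < \<epsilon>"
  from SL2_kakeya_estimate[OF this, of R] obtain \<delta>0 where "0 < \<delta>0"
    and estimate: "\<forall>\<delta> lam L E. \<delta> \<le> \<delta>0 \<longrightarrow> SL2_kakeya R \<delta> lam L E \<longrightarrow>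
      \<delta> powr \<epsilon> * lam powr 7 * (\<delta>\<^sup>2 * real (card L)) \<le> measure lebesgue E"
    by (elim exE conjE)
  show "\<exists>\<delta>0>0. \<forall>\<delta>. 0 < \<delta> \<and> \<delta> \<le> \<delta>0 \<longrightarrow>
     (\<forall>(L :: (real^4) set) (E :: (real^3) set) (lam::real).
        finite L \<and> L \<subseteq> {p. SL2_param p} \<inter> ball 0 R \<and>
        (\<forall>r x. \<delta> \<le> r \<and> r \<le> 1 \<longrightarrow> real (card (L \<inter> ball x r)) \<le> (r / \<delta>)\<^sup>2) \<and>
        union_of_delta_cubes \<delta> E \<and> E \<subseteq> ball 0 R \<and>
        0 < lam \<and> (\<forall>p\<in>L. line_meas p E \<ge> lam)
        \<longrightarrow> measure lebesgue E \<ge> \<delta> powr \<epsilon> * lam powr 7 * (\<delta>\<^sup>2 * real (card L)))"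
  proof (intro exI conjI allI impI, rule \<open>0 < \<delta>0\<close>, elim conjE)
    fix \<delta> L E lam
    assume "0 < \<delta>" "\<delta> \<le> \<delta>0" "finite L" "L \<subseteq> {p. SL2_param p} \<inter> ball 0 R"
      "\<forall>r x. \<delta> \<le> r \<and> r \<le> 1 \<longrightarrow> real (card (L \<inter> ball x r)) \<le> (r / \<delta>)\<^sup>2"
      "union_of_delta_cubes \<delta> E" "E \<subseteq> ball 0 R" "0 < lam" "\<forall>p\<in>L. lam \<le> line_meas p E"
    then have "SL2_kakeya R \<delta> lam L E" by (simp add: SL2_kakeya_def)
    with estimate \<open>\<delta> \<le> \<delta>0\<close> show "\<delta> powr \<epsilon> * lam powr 7 * (\<delta>\<^sup>2 * real (card L)) \<le> measure lebesgue E" by simp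
  qed
qed simp

end
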